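(* Let $n\geqslant 3$. The monomorphism $\eta: A_{B_n}\to A_{A_n}$ defined by $\eta(\tau_1)=\sigma_1^2$ and $\eta(\tau_i)=\sigma_i$ for $2\leqslant i\leqslant n$ is a quasi-isometry between $(A_{B_n},d_{\mathcal{NP}(A_{B_n})})$ and $(A_{A_n},d_{\mathcal{NP}(A_{A_n})})$.
   Context: Artin-Tits groups. $A_{A_n}$ is the braid group on $n+1$ strands, with standard generators $\sigma_1,\dots,\sigma_n$ and relations $\sigma_i\sigma_j=\sigma_j\sigma_i$ for $|i-j|\geqslant 2$ and $\sigma_i\sigma_{i+1}\sigma_i=\sigma_{i+1}\sigma_i\sigma_{i+1}$ for $1\leqslant i\leqslant n-1$. $A_{B_n}$ is the Artin-Tits group of type $B_n$, with standard generators $\tau_1,\dots,\tau_n$ and relations $\tau_i\tau_j=\tau_j\tau_i$ for $|i-j|\geqslant 2$, $\tau_1\tau_2\tau_1\tau_2=\tau_2\tau_1\tau_2\tau_1$, and $\tau_i\tau_{i+1}\tau_i=\tau_{i+1}\tau_i\tau_{i+1}$ for $2\leqslant i\leqslant n-1$. It is well known that $\eta$ is an injective homomorphism. Let $A$ be $A_{A_n}$ or $A_{B_n}$. A proper irreducible standard parabolic subgroup of $A$ is a subgroup generated by the standard generators with index in $I$, where $I$ is a nonempty proper subset of $\{1,\dots,n\}$ consisting of consecutive integers. $\mathcal{NP}(A)$ is the set of all elements of $A$ which normalize some proper irreducible standard parabolic subgroup of $A$; it is an (infinite) generating set of $A$. $d_{\mathcal{NP}(A)}$ is the associated word metric: $d_{\mathcal{NP}(A)}(g,h)$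 is the minimal length of a word in elements of $\mathcal{NP}(A)$ and their inverses representing $g^{-1}h$. *)

theory Defs
  imports Complex_Main "HOL-Algebra.Generated_Groups" "HOL-Algebra.Group_Action"
begin

section \<open>Groups given by generators and relations\<close>

text \<open>The letter \<open>(x, True)\<close> stands for the generator \<open>x\<close> and \<open>(x, False)\<close> for its formal inverse.
  A relation is a pair of positive words.\<close>

definition words :: "'a set \<Rightarrow> ('a \<times> bool) list set"
  where "words X = lists (X \<times> UNIV)"

abbreviation pos_word :: "'a list \<Rightarrow> ('a \<times> bool) list"
  where "pos_word \<equiv> map (\<lambda>x. (x, True))"

inductive pres_cong ::
  "'a set \<Rightarrow> ('a list \<times> 'a list) set \<Rightarrow> ('a \<times> bool) list \<Rightarrow> ('a \<times> bool) list \<Rightarrow> bool"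
  for X R where
  pc_refl: "w \<in> words X \<Longrightarrow> pres_cong X R w w"
| pc_sym: "pres_cong X R v w \<Longrightarrow> pres_cong X R w v"
| pc_trans: "pres_cong X R u v \<Longrightarrow> pres_cong X R v w \<Longrightarrow> pres_cong X R u w"
| pc_cancel: "u \<in> words X \<Longrightarrow> v \<in> words X \<Longrightarrow> x \<in> X \<Longrightarrow>
    pres_cong X R (u @ [(x, b), (x, \<not> b)] @ v) (u @ v)"
| pc_rel: "u \<in> words X \<Longrightarrow> v \<in> words X \<Longrightarrow> (l, r) \<in> R \<Longrightarrow> set l \<subseteq> X \<Longrightarrow> set r \<subseteq> X \<Longrightarrow>
    pres_cong X R (u @ pos_word l @ v) (u @ pos_word r @ v)"

definition pres_class ::
  "'a set \<Rightarrow> ('a list \<times> 'a list) set \<Rightarrow> ('a \<times> bool) list \<Rightarrow> ('a \<times> bool) list set"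
  where "pres_class X R w = {v. pres_cong X R w v}"

definition presented_group ::
  "'a set \<Rightarrow> ('a list \<times> 'a list) set \<Rightarrow> ('a \<times> bool) list set monoid"
  where "presented_group X R =
    \<lparr>carrier = pres_class X R ` words X,
     monoid.mult = (\<lambda>A B. \<Union>u\<in>A. \<Union>v\<in>B. pres_class X R (u @ v)),
     one = pres_class X R []\<rparr>"

definition pres_gen ::
  "'a set \<Rightarrow> ('a list \<times> 'a list) set \<Rightarrow> 'a \<Rightarrow> ('a \<times> bool) list set"
  where "pres_gen X R x = pres_class X R [(x, True)]"

lemma words_simps [simp]:
  "[] \<in> words X" "p # w \<in> words X \<longleftrightarrow> fst p \<in> X \<and> w \<in> words X"
  "v @ w \<in> words X \<longleftrightarrow> v \<in> words X \<and> w \<in> words X"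
  "pos_word l \<in> words X \<longleftrightarrow> set l \<subseteq> X"
  by (cases p; auto simp: words_def)+

lemma pres_cong_words:
  "pres_cong X R v w \<Longrightarrow> v \<in> words X \<and> w \<in> words X"
  by (induction rule: pres_cong.induct) auto

lemma pres_cong_append_left:
  "pres_cong X R v w \<Longrightarrow> u \<in> words X \<Longrightarrow> pres_cong X R (u @ v) (u @ w)"
proof (induction rule: pres_cong.induct)
  case (pc_cancel u' v x b)
  then show ?case using pres_cong.pc_cancel[of "u @ u'" X v x R b] by simp
next
  case (pc_rel u' v l r)
  then show ?case using pres_cong.pc_rel[of "u @ u'" X v l r R] by simp
qed (auto intro: pres_cong.intros)

lemma pres_cong_append_right:
  "pres_cong X R v w \<Longrightarrow> u \<in> words X \<Longrightarrow> pres_cong X R (v @ u) (w @ u)"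
proof (induction rule: pres_cong.induct)
  case (pc_cancel u' v x b)
  then show ?case using pres_cong.pc_cancel[of u' X "v @ u" x R b] by simp
next
  case (pc_rel u' v l r)
  then show ?case using pres_cong.pc_rel[of u' X "v @ u" l r R] by simp
qed (auto intro: pres_cong.intros)

lemma pres_class_eq_iff:
  assumes "v \<in> words X"
  shows "pres_class X R v = pres_class X R w \<longleftrightarrow> pres_cong X R v w"
proof
  assume "pres_class X R v = pres_class X R w"
  moreover have "v \<in> pres_class X R v" using assms by (simp add: pres_class_def pc_refl)
  ultimately show "pres_cong X R v w" by (auto simp: pres_class_def intro: pc_sym)
next
  assume "pres_cong X R v w"
  then show "pres_class X R v = pres_class X R w"
    by (auto simp: pres_class_def intro: pc_sym pc_trans)
qed

lemma presented_group_mult: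
  assumes "v \<in> words X" "w \<in> words X"
  shows "pres_class X R v \<otimes>\<^bsub>presented_group X R\<^esub> pres_class X R w = pres_class X R (v @ w)"
proof -
  have "pres_class X R (v' @ w') = pres_class X R (v @ w)"
    if "v' \<in> pres_class X R v" "w' \<in> pres_class X R w" for v' w'
  proof -
    have v: "pres_cong X R v v'" and w: "pres_cong X R w w'"
      using that by (auto simp: pres_class_def)
    have "pres_cong X R (v @ w) (v' @ w')"
      using pres_cong_append_right[OF v assms(2)]
        pres_cong_append_left[OF w, of v'] pres_cong_words[OF v] pc_trans by blast
    then show ?thesis using assms pres_class_eq_iff[of "v @ w" X R "v' @ w'"] by simp
  qed
  moreover have "v \<in> pres_class X R v" "w \<in> pres_class X R w"
    using assms by (auto simp: pres_class_def pc_refl)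
  ultimately have "(\<Union>v'\<in>pres_class X R v. \<Union>w'\<in>pres_class X R w. pres_class X R (v' @ w')) =
      pres_class X R (v @ w)"
    by blast
  then show ?thesis by (simp add: presented_group_def)
qed

lemma presented_group_one: "\<one>\<^bsub>presented_group X R\<^esub> = pres_class X R []"
  by (simp add: presented_group_def)

lemma presented_group_carrier: "carrier (presented_group X R) = pres_class X R ` words X"
  by (simp add: presented_group_def)

lemma presented_group_inv_ex:
  assumes "w \<in> words X"
  shows "\<exists>v\<in>words X. pres_cong X R (v @ w) []"
  using assms
proof (induction w)
  case Nil
  then show ?case by (auto intro!: bexI[of _ "[]"] pc_refl)
next
  case (Cons p w)
  obtain x b where p: "p = (x, b)" by (cases p)
  from Cons obtain v where v: "v \<in> words X" "pres_cong X R (v @ w) []" by auto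
  have "pres_cong X R (v @ [(x, \<not> b), (x, \<not> \<not> b)] @ w) (v @ w)"
    using Cons.prems v p by (intro pc_cancel) auto
  then have "pres_cong X R ((v @ [(x, \<not> b)]) @ p # w) []"
    using v p pc_trans by fastforce
  then show ?case using v Cons.prems p by (intro bexI[of _ "v @ [(x, \<not> b)]"]) auto
qed

lemma group_presented_group: "group (presented_group X R)"
proof (rule groupI)
  fix g assume "g \<in> carrier (presented_group X R)"
  then obtain w where w: "w \<in> words X" "g = pres_class X R w"
    by (auto simp: presented_group_carrier)
  with presented_group_inv_ex[of w X R] obtain v
    where "v \<in> words X" "pres_cong X R (v @ w) []" by blast
  then show "\<exists>h\<in>carrier (presented_group X R). h \<otimes>\<^bsub>presented_group X R\<^esub> g = \<one>\<^bsub>presented_group X R\<^esub>"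
    using w by (auto simp: presented_group_carrier presented_group_one presented_group_mult
        pres_class_eq_iff)
qed (auto simp: presented_group_carrier presented_group_one presented_group_mult)

lemma pres_gen_closed: "x \<in> X \<Longrightarrow> pres_gen X R x \<in> carrier (presented_group X R)"
  by (auto simp: pres_gen_def presented_group_carrier)

lemma presented_group_generated:
  "generate (presented_group X R) (pres_gen X R ` X) = carrier (presented_group X R)"
proof -
  interpret group "presented_group X R" by (rule group_presented_group)
  let ?H = "generate (presented_group X R) (pres_gen X R ` X)"
  have "pres_class X R w \<in> ?H" if "w \<in> words X" for w
    using that
  proof (induction w)
    case Nil
    then show ?case using generate.one[of "presented_group X R"] by (simp add: presented_group_one)
  next
    case (Cons p w)
    obtain x b where p: "p = (x, b)" by (cases p)
    with Cons have x: "x \<in> X" and w: "w \<in> words X" by auto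
    have "pres_cong X R ([] @ [(x, False), (x, \<not> False)] @ []) ([] @ [])"
      using x by (intro pc_cancel) auto
    then have "pres_class X R [(x, False)] \<otimes>\<^bsub>presented_group X R\<^esub> pres_gen X R x =
        \<one>\<^bsub>presented_group X R\<^esub>"
      using x by (simp add: pres_gen_def presented_group_mult presented_group_one pres_class_eq_iff)
    moreover have "pres_class X R [(x, False)] \<in> carrier (presented_group X R)"
      using x by (auto simp: presented_group_carrier)
    ultimately have "pres_class X R [(x, False)] = inv\<^bsub>presented_group X R\<^esub> pres_gen X R x"
      using inv_equality pres_gen_closed[OF x] by metis
    then have "pres_class X R [p] \<in> ?H"
      using p x by (cases b) (auto simp: pres_gen_def intro: generate.incl generate.inv)
    from generate.eng[OF this Cons.IH[OF w]] show ?case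
      using presented_group_mult[of "[p]" X w R] p x w by simp
  qed
  moreover have "?H \<subseteq> carrier (presented_group X R)"
    by (rule generate_incl) (auto intro: pres_gen_closed)
  ultimately show ?thesis by (auto simp: presented_group_carrier)
qed

fun eval_word :: "('g, 'm) monoid_scheme \<Rightarrow> ('a \<Rightarrow> 'g) \<Rightarrow> ('a \<times> bool) list \<Rightarrow> 'g"
  where
    "eval_word G f [] = \<one>\<^bsub>G\<^esub>"
  | "eval_word G f ((x, b) # w) =
      (if b then f x else inv\<^bsub>G\<^esub> (f x)) \<otimes>\<^bsub>G\<^esub> eval_word G f w"

lemma eval_word_closed:
  assumes "group G" "f \<in> X \<rightarrow> carrier G" "w \<in> words X"
  shows "eval_word G f w \<in> carrier G"
proof -
  interpret group G by fact
  show ?thesis using assms(3)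
  proof (induction w)
    case (Cons p w)
    then show ?case using assms(2) by (cases p) auto
  qed simp
qed

lemma eval_word_append:
  assumes "group G" "f \<in> X \<rightarrow> carrier G" "v \<in> words X" "w \<in> words X"
  shows "eval_word G f (v @ w) = eval_word G f v \<otimes>\<^bsub>G\<^esub> eval_word G f w"
proof -
  interpret group G by fact
  note closed = eval_word_closed[OF assms(1,2)]
  show ?thesis using assms(3)
  proof (induction v)
    case Nil
    then show ?case using closed assms by simp
  next
    case (Cons p v)
    obtain x b where p: "p = (x, b)" by (cases p)
    then have "f x \<in> carrier G" using Cons.prems assms(2) by auto
    then show ?case using Cons closed assms(4) p by (simp add: m_assoc)
  qed
qed

theorem presented_group_universal:
  assumes G: "group G" and f: "f \<in> X \<rightarrow> carrier G"
    and rel: "\<And>l r. (l, r) \<in> R \<Longrightarrow> set l \<subseteq> X \<Longrightarrow> set r \<subseteq> X \<Longrightarrow>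
      eval_word G f (pos_word l) = eval_word G f (pos_word r)"
  shows "\<exists>h \<in> hom (presented_group X R) G. \<forall>x\<in>X. h (pres_gen X R x) = f x"
proof -
  interpret group G by (rule G)
  note closed = eval_word_closed[OF G f] and app = eval_word_append[OF G f]
  have eq: "eval_word G f v = eval_word G f w" if "pres_cong X R v w" for v w
    using that
  proof (induction rule: pres_cong.induct)
    case (pc_cancel u v x b)
    then have "f x \<in> carrier G" using f by auto
    then have "eval_word G f ([(x, b), (x, \<not> b)] @ v) = eval_word G f v"
      using pc_cancel closed by (simp flip: m_assoc)
    then show ?case using pc_cancel app[of u v] app[of u "[(x, b), (x, \<not> b)] @ v"] by simp
  next
    case (pc_rel u v l r)
    then show ?case using rel[of l r] by (simp add: app)
  qed auto
  define h where "h A = eval_word G f (SOME w. w \<in> A)" for A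
  have h: "h (pres_class X R w) = eval_word G f w" if "w \<in> words X" for w
  proof -
    have "w \<in> pres_class X R w" using that by (simp add: pres_class_def pc_refl)
    then have "(SOME v. v \<in> pres_class X R w) \<in> pres_class X R w" by (rule someI)
    then show ?thesis using eq unfolding h_def pres_class_def by fastforce
  qed
  have "h \<in> hom (presented_group X R) G"
    by (rule homI) (auto simp: presented_group_carrier presented_group_mult h closed app)
  moreover have "h (pres_gen X R x) = f x" if "x \<in> X" for x
  proof -
    have "f x \<in> carrier G" using f that by auto
    then show ?thesis using that h[of "[(x, True)]"] by (simp add: pres_gen_def)
  qed
  ultimately show ?thesis by blast
qed

section \<open>Artin-Tits groups of types A and B\<close>

definition commutation_rels :: "nat \<Rightarrow> (nat list \<times> nat list) set"
  where "commutation_rels n =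
    {([i, j], [j, i]) | i j. i \<in> {1..n} \<and> j \<in> {1..n} \<and> \<bar>int i - int j\<bar> \<ge> 2}"

definition braid_rels :: "nat \<Rightarrow> nat \<Rightarrow> (nat list \<times> nat list) set"
  where "braid_rels m n = {([i, i + 1, i], [i + 1, i, i + 1]) | i. m \<le> i \<and> i + 1 \<le> n}"

definition A_rels :: "nat \<Rightarrow> (nat list \<times> nat list) set"
  where "A_rels n = commutation_rels n \<union> braid_rels 1 n"

definition B_rels :: "nat \<Rightarrow> (nat list \<times> nat list) set"
  where "B_rels n = commutation_rels n \<union> {([1, 2, 1, 2], [2, 1, 2, 1])} \<union> braid_rels 2 n"

definition artin_A :: "nat \<Rightarrow> (nat \<times> bool) list set monoid"
  where "artin_A n = presented_group {1..n} (A_rels n)"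

definition sigma :: "nat \<Rightarrow> nat \<Rightarrow> (nat \<times> bool) list set"
  where "sigma n i = pres_gen {1..n} (A_rels n) i"

definition artin_B :: "nat \<Rightarrow> (nat \<times> bool) list set monoid"
  where "artin_B n = presented_group {1..n} (B_rels n)"

definition tau :: "nat \<Rightarrow> nat \<Rightarrow> (nat \<times> bool) list set"
  where "tau n i = pres_gen {1..n} (B_rels n) i"

lemma group_artin_A: "group (artin_A n)"
  unfolding artin_A_def by (rule group_presented_group)

lemma group_artin_B: "group (artin_B n)"
  unfolding artin_B_def by (rule group_presented_group)

lemma sigma_closed: "i \<in> {1..n} \<Longrightarrow> sigma n i \<in> carrier (artin_A n)"
  unfolding artin_A_def sigma_def by (rule pres_gen_closed)

lemma tau_closed: "i \<in> {1..n} \<Longrightarrow> tau n i \<in> carrier (artin_B n)"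
  unfolding artin_B_def tau_def by (rule pres_gen_closed)

lemma generate_sigma: "generate (artin_A n) (sigma n ` {1..n}) = carrier (artin_A n)"
  using presented_group_generated[of "{1..n}" "A_rels n"]
  by (simp add: artin_A_def sigma_def[abs_def])

lemma generate_tau: "generate (artin_B n) (tau n ` {1..n}) = carrier (artin_B n)"
  using presented_group_generated[of "{1..n}" "B_rels n"]
  by (simp add: artin_B_def tau_def[abs_def])

lemma pres_gen_rel:
  assumes "(l, r) \<in> R" "set l \<subseteq> X" "set r \<subseteq> X"
  shows "pres_class X R (pos_word l) = pres_class X R (pos_word r)"
  using assms pc_rel[of "[]" X "[]" l r R] by (simp add: pres_class_eq_iff)

lemma sigma_commute:
  assumes "i \<in> {1..n}" "j \<in> {1..n}" "\<bar>int i - int j\<bar> \<ge> 2"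
  shows "sigma n i \<otimes>\<^bsub>artin_A n\<^esub> sigma n j = sigma n j \<otimes>\<^bsub>artin_A n\<^esub> sigma n i"
proof -
  have "([i, j], [j, i]) \<in> A_rels n"
    using assms unfolding A_rels_def commutation_rels_def by blast
  from pres_gen_rel[OF this, of "{1..n}"] show ?thesis using assms
    by (simp add: artin_A_def sigma_def pres_gen_def presented_group_mult)
qed

lemma sigma_braid:
  assumes "1 \<le> i" "i + 1 \<le> n"
  shows "sigma n i \<otimes>\<^bsub>artin_A n\<^esub> sigma n (i + 1) \<otimes>\<^bsub>artin_A n\<^esub> sigma n i =
    sigma n (i + 1) \<otimes>\<^bsub>artin_A n\<^esub> sigma n i \<otimes>\<^bsub>artin_A n\<^esub> sigma n (i + 1)"
proof -
  have "([i, i + 1, i], [i + 1, i, i + 1]) \<in> A_rels n"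
    using assms by (auto simp: A_rels_def braid_rels_def)
  from pres_gen_rel[OF this, of "{1..n}"] show ?thesis using assms
    by (simp add: artin_A_def sigma_def pres_gen_def presented_group_mult)
qed

lemma eta_exists:
  "\<exists>\<eta> \<in> hom (artin_B n) (artin_A n).
    \<forall>i\<in>{1..n}. \<eta> (tau n i) =
      (if i = 1 then sigma n 1 [^]\<^bsub>artin_A n\<^esub> (2::nat) else sigma n i)"
proof -
  let ?G = "artin_A n"
  interpret group ?G by (rule group_artin_A)
  define f where "f i = (if i = 1 then sigma n 1 [^]\<^bsub>?G\<^esub> (2::nat) else sigma n i)" for i
  have f1: "f 1 = sigma n 1 \<otimes>\<^bsub>?G\<^esub> sigma n 1" if "1 \<le> n"
    using that sigma_closed[of 1 n] by (simp add: f_def numeral_2_eq_2)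
  have f2: "f i = sigma n i" if "i \<noteq> 1" for i using that by (simp add: f_def)
  have fc: "f i \<in> carrier ?G" if "i \<in> {1..n}" for i
    using that sigma_closed[of i n] by (auto simp: f_def)
  have comm: "f i \<otimes>\<^bsub>?G\<^esub> f j = f j \<otimes>\<^bsub>?G\<^esub> f i"
    if ij: "i \<in> {1..n}" "j \<in> {1..n}" "\<bar>int i - int j\<bar> \<ge> 2" for i j
  proof -
    have c: "sigma n i \<otimes>\<^bsub>?G\<^esub> sigma n j = sigma n j \<otimes>\<^bsub>?G\<^esub> sigma n i"
      by (rule sigma_commute) (use ij in auto)
    have cl: "sigma n i \<in> carrier ?G" "sigma n j \<in> carrier ?G"
      using ij sigma_closed by auto
    have comm_sq: "(x \<otimes>\<^bsub>?G\<^esub> x) \<otimes>\<^bsub>?G\<^esub> y = y \<otimes>\<^bsub>?G\<^esub> (x \<otimes>\<^bsub>?G\<^esub> x)"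
      if "x \<otimes>\<^bsub>?G\<^esub> y = y \<otimes>\<^bsub>?G\<^esub> x" "x \<in> carrier ?G" "y \<in> carrier ?G" for x y
      using that by (metis m_assoc)
    consider "i = 1" "j \<noteq> 1" | "i \<noteq> 1" "j = 1" | "i \<noteq> 1" "j \<noteq> 1" using ij by linarith
    then show ?thesis
    proof cases
      case 1
      then show ?thesis using comm_sq[OF c cl] f1 f2[of j] ij by simp
    next
      case 2
      then show ?thesis using comm_sq[OF c[symmetric] cl(2,1)] f1 f2[of i] ij by simp
    next
      case 3
      then show ?thesis using c f2 by simp
    qed
  qed
  have four: "f 1 \<otimes>\<^bsub>?G\<^esub> (f 2 \<otimes>\<^bsub>?G\<^esub> (f 1 \<otimes>\<^bsub>?G\<^esub> f 2)) = f 2 \<otimes>\<^bsub>?G\<^esub> (f 1 \<otimes>\<^bsub>?G\<^esub> (f 2 \<otimes>\<^bsub>?G\<^esub> f 1))"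
    if n: "2 \<le> n"
  proof -
    define a b where "a = sigma n 1" and "b = sigma n 2"
    have ab: "a \<in> carrier ?G" "b \<in> carrier ?G" using n sigma_closed by (auto simp: a_def b_def)
    have br: "a \<otimes>\<^bsub>?G\<^esub> (b \<otimes>\<^bsub>?G\<^esub> a) = b \<otimes>\<^bsub>?G\<^esub> (a \<otimes>\<^bsub>?G\<^esub> b)"
      using sigma_braid[of 1 n] n ab by (simp add: a_def b_def m_assoc numeral_2_eq_2)
    have brx: "a \<otimes>\<^bsub>?G\<^esub> (b \<otimes>\<^bsub>?G\<^esub> (a \<otimes>\<^bsub>?G\<^esub> x)) = b \<otimes>\<^bsub>?G\<^esub> (a \<otimes>\<^bsub>?G\<^esub> (b \<otimes>\<^bsub>?G\<^esub> x))"
      if "x \<in> carrier ?G" for x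
      using br ab that by (metis m_assoc m_closed)
    have "a \<otimes>\<^bsub>?G\<^esub> (a \<otimes>\<^bsub>?G\<^esub> (b \<otimes>\<^bsub>?G\<^esub> (a \<otimes>\<^bsub>?G\<^esub> (a \<otimes>\<^bsub>?G\<^esub> b)))) =
        b \<otimes>\<^bsub>?G\<^esub> (a \<otimes>\<^bsub>?G\<^esub> (a \<otimes>\<^bsub>?G\<^esub> (b \<otimes>\<^bsub>?G\<^esub> (a \<otimes>\<^bsub>?G\<^esub> a))))"
      using brx br ab by (metis m_closed)
    then show ?thesis using ab f1 f2[of 2] n by (simp add: a_def b_def m_assoc)
  qed
  have "\<exists>h \<in> hom (presented_group {1..n} (B_rels n)) ?G.
      \<forall>x\<in>{1..n}. h (pres_gen {1..n} (B_rels n) x) = f x"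
  proof (rule presented_group_universal)
    fix l r assume lr: "(l, r) \<in> B_rels n" "set l \<subseteq> {1..n}" "set r \<subseteq> {1..n}"
    from lr(1) consider
        (c) i j where "l = [i, j]" "r = [j, i]" "i \<in> {1..n}" "j \<in> {1..n}" "\<bar>int i - int j\<bar> \<ge> 2"
      | (q) "l = [1, 2, 1, 2]" "r = [2, 1, 2, 1]"
      | (b) i where "l = [i, i + 1, i]" "r = [i + 1, i, i + 1]" "2 \<le> i" "i + 1 \<le> n"
      by (auto simp: B_rels_def commutation_rels_def braid_rels_def)
    then show "eval_word ?G f (pos_word l) = eval_word ?G f (pos_word r)"
    proof cases
      case c
      then show ?thesis using comm[of i j] fc[of i] fc[of j] by simp
    next
      case q
      then have "2 \<le> n" using lr by auto
      then show ?thesis using q four fc[of 1] fc[of 2] by simp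
    next
      case b
      then show ?thesis
        using sigma_braid[of i n] f2[of i] f2[of "i + 1"] sigma_closed[of i n]
          sigma_closed[of "i + 1" n] by (simp add: m_assoc)
    qed
  qed (use fc group_artin_A in auto)
  then show ?thesis unfolding artin_B_def tau_def f_def by blast
qed

section \<open>Normalizers of parabolic subgroups, word metrics, quasi-isometries\<close>

definition proper_irreducible_index :: "nat \<Rightarrow> nat set \<Rightarrow> bool"
  where "proper_irreducible_index n I \<longleftrightarrow> I \<noteq> {} \<and> I \<subset> {1..n} \<and> (\<exists>a b. I = {a..b})"

definition NP :: "('g, 'm) monoid_scheme \<Rightarrow> (nat \<Rightarrow> 'g) \<Rightarrow> nat \<Rightarrow> 'g set"
  where "NP G s n =
    (\<Union>I \<in> {I. proper_irreducible_index n I}. normalizer G (generate G (s ` I)))"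

lemma generator_in_NP:
  assumes "group G" "n \<ge> 2" "i \<in> {1..n}" "s i \<in> carrier G"
  shows "s i \<in> NP G s n"
proof -
  interpret group G by fact
  let ?H = "generate G (s ` {i})"
  have H: "subgroup ?H G" using assms(4) by (intro generate_is_subgroup) auto
  have "s i \<in> ?H" by (auto intro: generate.incl)
  then have "s i <#\<^bsub>G\<^esub> ?H #>\<^bsub>G\<^esub> inv\<^bsub>G\<^esub> (s i) = ?H"
    using H assms(4) coset_join3[of "s i" ?H] coset_join2[of "inv\<^bsub>G\<^esub> (s i)" ?H]
    by (simp add: subgroup.m_inv_closed)
  then have "s i \<in> normalizer G ?H"
    using assms(4) subgroup.subset[OF H] by (simp add: normalizer_def stabilizer_def)
  moreover have "{i} \<noteq> {1..n}"
  proof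
    assume "{i} = {1..n}"
    then have "card {1..n} = 1" by (metis is_singletonI is_singleton_altdef)
    then show False using assms(2) by simp
  qed
  then have "proper_irreducible_index n {i}"
    using assms(3) unfolding proper_irreducible_index_def
    by (metis atLeastAtMost_singleton empty_subsetI insert_not_empty insert_subset psubsetI)
  ultimately show ?thesis unfolding NP_def by blast
qed

lemma NP_subset: "NP G s n \<subseteq> carrier G"
  by (auto simp: NP_def normalizer_def stabilizer_def)

lemma NP_generates:
  assumes "n \<ge> 2"
  shows "generate (artin_A n) (NP (artin_A n) (sigma n) n) = carrier (artin_A n)"
    and "generate (artin_B n) (NP (artin_B n) (tau n) n) = carrier (artin_B n)"
proof -
  have "sigma n ` {1..n} \<subseteq> NP (artin_A n) (sigma n) n"
    using generator_in_NP[OF group_artin_A assms] sigma_closed by blast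
  from group.mono_generate[OF group_artin_A[of n] this]
  have "carrier (artin_A n) \<subseteq> generate (artin_A n) (NP (artin_A n) (sigma n) n)"
    unfolding generate_sigma .
  then show "generate (artin_A n) (NP (artin_A n) (sigma n) n) = carrier (artin_A n)"
    by (rule equalityI[OF group.generate_incl[OF group_artin_A NP_subset]])
  have "tau n ` {1..n} \<subseteq> NP (artin_B n) (tau n) n"
    using generator_in_NP[OF group_artin_B assms] tau_closed by blast
  from group.mono_generate[OF group_artin_B[of n] this]
  have "carrier (artin_B n) \<subseteq> generate (artin_B n) (NP (artin_B n) (tau n) n)"
    unfolding generate_tau .
  then show "generate (artin_B n) (NP (artin_B n) (tau n) n) = carrier (artin_B n)"
    by (rule equalityI[OF group.generate_incl[OF group_artin_B NP_subset]])
qed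

text \<open>\<open>LEAST\<close> is meaningful only when the set \<open>S\<close> generates \<open>G\<close>,
  which for \<open>NP\<close> is the lemma \<open>NP_generates\<close>.\<close>

definition word_metric :: "('g, 'm) monoid_scheme \<Rightarrow> 'g set \<Rightarrow> 'g \<Rightarrow> 'g \<Rightarrow> nat"
  where "word_metric G S g h =
    (LEAST k. \<exists>ws. set ws \<subseteq> S \<union> m_inv G ` S \<and> length ws = k \<and>
       foldr (monoid.mult G) ws \<one>\<^bsub>G\<^esub> = inv\<^bsub>G\<^esub> g \<otimes>\<^bsub>G\<^esub> h)"

definition quasi_isometry ::
  "'a set \<Rightarrow> ('a \<Rightarrow> 'a \<Rightarrow> real) \<Rightarrow> 'b set \<Rightarrow> ('b \<Rightarrow> 'b \<Rightarrow> real) \<Rightarrow> ('a \<Rightarrow> 'b) \<Rightarrow> bool"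
  where "quasi_isometry M dM N dN f \<longleftrightarrow>
    f \<in> M \<rightarrow> N \<and>
    (\<exists>K\<ge>1. \<exists>C\<ge>0.
      (\<forall>x\<in>M. \<forall>y\<in>M. dM x y / K - C \<le> dN (f x) (f y) \<and> dN (f x) (f y) \<le> K * dM x y + C) \<and>
      (\<forall>z\<in>N. \<exists>x\<in>M. dN (f x) z \<le> C))"

abbreviation d_NP_A :: "nat \<Rightarrow> (nat \<times> bool) list set \<Rightarrow> (nat \<times> bool) list set \<Rightarrow> nat"
  where "d_NP_A n \<equiv> word_metric (artin_A n) (NP (artin_A n) (sigma n) n)"

abbreviation d_NP_B :: "nat \<Rightarrow> (nat \<times> bool) list set \<Rightarrow> (nat \<times> bool) list set \<Rightarrow> nat"
  where "d_NP_B n \<equiv> word_metric (artin_B n) (NP (artin_B n) (tau n) n)"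

end

theory Submission
  imports Defs
begin

text \<open>
  The image of \<open>\<eta>\<close> consists of the braids whose permutation fixes the first strand; it has the
  \<open>n + 1\<close> coset representatives \<open>r\<^sub>j = \<sigma>\<^sub>1 \<dots> \<sigma>\<^sub>j\<^sub>-\<^sub>1\<close>. Write \<open>A\<^sub>I\<close> and \<open>B\<^sub>I\<close> for the standard parabolic
  subgroups.

  If \<open>y\<close> normalizes \<open>B\<^sub>I\<close> then \<open>\<eta> y\<close> normalizes \<open>A\<^sub>I\<close>, hence \<open>\<eta>\<close> does not increase distances. This is
  clear unless \<open>I = {1..b}\<close>, where it has to be seen that \<open>\<eta> y\<close> conjugates \<open>\<sigma>\<^sub>1\<close>, and not only \<open>\<sigma>\<^sub>1\<^sup>2\<close>, into
  \<open>A\<^sub>I\<close>. Deleting strands gives some \<open>p\<close> in \<open>A\<^sub>I\<close> which conjugates \<open>\<sigma>\<^sub>1\<^sup>2\<close> to the same element as \<open>\<eta> y\<close>, so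
  the claim follows from the fact that \<open>\<sigma>\<^sub>1\<close> and \<open>\<sigma>\<^sub>1\<^sup>2\<close> have the same centralizer. The latter is obtained,
  without Garside theory, from the free normal subgroup of \<open>artin_B n\<close> generated by the conjugates
  of \<open>\<tau>\<^sub>1\<close>: there the centralizer of \<open>\<tau>\<^sub>1\<close> is cyclic.

  Conversely, words in \<open>NP\<close> of \<open>artin_A n\<close> are rewritten along the representatives \<open>r\<^sub>j\<close>. It suffices
  to bound the \<open>B\<close>-length of the elements \<open>r\<^sub>i x r\<^sub>j\<inverse>\<close> of the image of \<open>\<eta>\<close> with \<open>x\<close> normalizing \<open>A\<^sub>I\<close>. This
  is possible since \<open>r\<^sub>i A\<^sub>I r\<^sub>i\<inverse>\<close> is conjugate, under the image of \<open>\<eta>\<close>, to some \<open>A\<^sub>J\<close>, and since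
  \<open>y\<close> normalizes \<open>B\<^sub>J\<close> if \<open>\<eta> y\<close> normalizes \<open>A\<^sub>J\<close>.
\<close>

section \<open>Conjugation and generated subgroups\<close>

context group
begin

lemma inv_l_cancel: "x \<in> carrier G \<Longrightarrow> y \<in> carrier G \<Longrightarrow> inv x \<otimes> (x \<otimes> y) = y"
  by (simp flip: m_assoc)

lemma inv_r_cancel: "x \<in> carrier G \<Longrightarrow> y \<in> carrier G \<Longrightarrow> x \<otimes> (inv x \<otimes> y) = y"
  by (simp flip: m_assoc)

lemma commute_mult:
  assumes "c \<otimes> a = a \<otimes> c" "c \<otimes> b = b \<otimes> c" "a \<in> carrier G" "b \<in> carrier G" "c \<in> carrier G"
  shows "c \<otimes> (a \<otimes> b) = a \<otimes> b \<otimes> c"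
  using assms by (metis m_assoc)

lemma commute_inv:
  assumes "c \<otimes> a = a \<otimes> c" "a \<in> carrier G" "c \<in> carrier G"
  shows "c \<otimes> inv a = inv a \<otimes> c"
  using assms by (metis inv_closed inv_solve_right inv_solve_left m_assoc m_closed)

lemma commute_generate:
  assumes "a \<in> generate G S" "S \<subseteq> carrier G" "c \<in> carrier G"
    and "\<And>s. s \<in> S \<Longrightarrow> c \<otimes> s = s \<otimes> c"
  shows "c \<otimes> a = a \<otimes> c"
  using assms(1)
proof (induction rule: generate.induct)
  case (eng h1 h2)
  then show ?case using commute_mult[of c h1 h2] generate_in_carrier[OF assms(2)] assms(3) by simp
qed (use assms commute_inv in auto)

text \<open>\<open>T\<close> need not be a subgroup: closure under right multiplication by letters
  suffices, because the induction proves \<open>t \<otimes> g \<in> T\<close> for all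
  \<open>t\<close> in \<open>T\<close> at once. It serves for unions of right cosets.\<close>

lemma generate_right_closed_subset:
  assumes S: "S \<subseteq> carrier G" and T: "T \<subseteq> carrier G" "\<one> \<in> T"
    and "\<And>t s. t \<in> T \<Longrightarrow> s \<in> S \<Longrightarrow> t \<otimes> s \<in> T"
    and "\<And>t s. t \<in> T \<Longrightarrow> s \<in> S \<Longrightarrow> t \<otimes> inv s \<in> T"
  shows "generate G S \<subseteq> T"
proof
  fix g assume g: "g \<in> generate G S"
  have "t \<otimes> g \<in> T" if "t \<in> T" for t
    using g that
  proof (induction arbitrary: t rule: generate.induct)
    case one
    then show ?case using T by auto
  next
    case (eng h1 h2)
    then have "t \<otimes> h1 \<otimes> h2 \<in> T" by blast
    moreover have "t \<in> carrier G" using eng T by blast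
    ultimately show ?case using generate_in_carrier[OF S] eng by (simp add: m_assoc)
  qed (use assms in auto)
  from this[OF T(2)] show "g \<in> T" using generate_in_carrier[OF S g] by simp
qed

section \<open>Conjugation and normalizers\<close>

definition inner :: "'a \<Rightarrow> 'a \<Rightarrow> 'a"
  where "inner g x = g \<otimes> x \<otimes> inv g"

lemma inner_closed [simp]: "g \<in> carrier G \<Longrightarrow> x \<in> carrier G \<Longrightarrow> inner g x \<in> carrier G"
  by (simp add: inner_def)

lemma inner_one [simp]: "x \<in> carrier G \<Longrightarrow> inner \<one> x = x"
  by (simp add: inner_def)

lemma inner_mult:
  "g \<in> carrier G \<Longrightarrow> h \<in> carrier G \<Longrightarrow> x \<in> carrier G \<Longrightarrow> inner (g \<otimes> h) x = inner g (inner h x)"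
  by (simp add: inner_def m_assoc inv_mult_group)

lemma inner_inv_cancel [simp]:
  "g \<in> carrier G \<Longrightarrow> x \<in> carrier G \<Longrightarrow> inner (inv g) (inner g x) = x"
  "g \<in> carrier G \<Longrightarrow> x \<in> carrier G \<Longrightarrow> inner g (inner (inv g) x) = x"
  by (simp_all flip: inner_mult)

lemma inner_eqI:
  "g \<otimes> x = y \<otimes> g \<Longrightarrow> g \<in> carrier G \<Longrightarrow> x \<in> carrier G \<Longrightarrow> y \<in> carrier G \<Longrightarrow> inner g x = y"
  unfolding inner_def by (metis inv_solve_right m_closed)

lemma inner_eq_iff:
  "g \<in> carrier G \<Longrightarrow> x \<in> carrier G \<Longrightarrow> y \<in> carrier G \<Longrightarrow> inner g x = y \<longleftrightarrow> g \<otimes> x = y \<otimes> g"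
  unfolding inner_def by (metis inv_solve_right m_closed)

lemma group_hom_inner: "g \<in> carrier G \<Longrightarrow> group_hom G G (inner g)"
  by unfold_locales (auto simp: hom_def inner_def m_assoc inv_l_cancel)

lemma inner_image_mult:
  "g \<in> carrier G \<Longrightarrow> h \<in> carrier G \<Longrightarrow> H \<subseteq> carrier G \<Longrightarrow>
    inner (g \<otimes> h) ` H = inner g ` (inner h ` H)"
  by (force simp: inner_mult image_iff)

lemma inner_image_inv:
  "g \<in> carrier G \<Longrightarrow> H \<subseteq> carrier G \<Longrightarrow> inner (inv g) ` (inner g ` H) = H"
  by (force simp: image_iff)

lemma inner_image_generate:
  "g \<in> carrier G \<Longrightarrow> S \<subseteq> carrier G \<Longrightarrow> inner g ` generate G S = generate G (inner g ` S)"
  using group_hom.generate_img[OF group_hom_inner] by blast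

lemma mem_normalizer_iff:
  assumes "H \<subseteq> carrier G"
  shows "g \<in> normalizer G H \<longleftrightarrow> g \<in> carrier G \<and> inner g ` H = H"
proof -
  have "g <# H #> inv g = inner g ` H"
    by (auto simp: l_coset_def r_coset_def inner_def)
  then show ?thesis using assms by (simp add: normalizer_def stabilizer_def)
qed

text \<open>Checking generators for \<open>g\<close> alone gives only an inclusion, which can be
  strict in an infinite group; the condition on \<open>inv g\<close> supplies the other one.\<close>

lemma mem_normalizer_generateI:
  assumes "S \<subseteq> carrier G" "g \<in> carrier G"
    and "\<And>s. s \<in> S \<Longrightarrow> inner g s \<in> generate G S" "\<And>s. s \<in> S \<Longrightarrow> inner (inv g) s \<in> generate G S"
  shows "g \<in> normalizer G (generate G S)"
proof -
  have *: "inner h ` generate G S \<subseteq> generate G S"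
    if "h \<in> carrier G" "\<And>s. s \<in> S \<Longrightarrow> inner h s \<in> generate G S" for h
    unfolding inner_image_generate[OF that(1) assms(1)]
    using that(2) by (intro generate_subgroup_incl generate_is_subgroup assms) auto
  note 1 = *[of g, OF assms(2,3)] and 2 = *[of "inv g", OF inv_closed[OF assms(2)] assms(4)]
  have "x \<in> inner g ` generate G S" if "x \<in> generate G S" for x
  proof -
    have "inner (inv g) x \<in> generate G S" using 2 that by blast
    moreover have "inner g (inner (inv g) x) = x"
      using that generate_in_carrier[OF assms(1)] assms(2) by simp
    ultimately show ?thesis by (metis imageI)
  qed
  then show ?thesis
    using 1 generate_incl[OF assms(1)] assms(2) by (subst mem_normalizer_iff) auto
qed

lemma subset_normalizer:
  assumes "subgroup H G" shows "H \<subseteq> normalizer G H"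
proof
  fix g assume g: "g \<in> H"
  have "inner g ` H \<subseteq> H" "inner (inv g) ` H \<subseteq> H"
    using subgroup.m_closed[OF assms] subgroup.m_inv_closed[OF assms] g
    by (auto simp: inner_def)
  moreover have "H \<subseteq> carrier G" using subgroup.subset[OF assms] .
  ultimately show "g \<in> normalizer G H" using mem_normalizer_generateI[of H g]
    by (metis (no_types, lifting) assms g generateI imageI order_refl subgroup.mem_carrier subsetD)
qed

end

lemma (in group_hom) hom_inner:
  "g \<in> carrier G \<Longrightarrow> x \<in> carrier G \<Longrightarrow> h (group.inner G g x) = group.inner H (h g) (h x)"
  by (simp add: G.inner_def H.inner_def)

lemma group_homI: "group G \<Longrightarrow> group H \<Longrightarrow> h \<in> hom G H \<Longrightarrow> group_hom G H h"
  by (simp add: group_hom_def group_hom_axioms_def)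

lemma hom_eq_on_generate:
  assumes "group_hom G H f" "group_hom G H g" "S \<subseteq> carrier G" "\<And>s. s \<in> S \<Longrightarrow> f s = g s"
    and "x \<in> generate G S"
  shows "f x = g x"
proof -
  interpret f: group_hom G H f by fact
  interpret g: group_hom G H g by fact
  show ?thesis using assms(5)
  proof (induction rule: generate.induct)
    case (inv h)
    then have "h \<in> carrier G" using assms by blast
    then show ?case using assms(4)[OF inv] by simp
  next
    case (eng h1 h2)
    then show ?case using f.G.generate_in_carrier[OF assms(3)] by simp
  qed (use assms in auto)
qed

section \<open>Wreath products with a permutation group\<close>

text \<open>Wreath product of \<open>M\<close> with the permutations of the label type: \<open>f a = (m, b)\<close> means that \<open>f\<close>
  moves the label \<open>a\<close> to \<open>b\<close> and picks up the factor \<open>m\<close>. Permutations act from the right, so that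
  a word is read from left to right.\<close>

definition wreath :: "('m, 'x) monoid_scheme \<Rightarrow> ('l \<Rightarrow> 'm \<times> 'l) monoid"
  where "wreath M =
    \<lparr>carrier = {f. (\<forall>a. fst (f a) \<in> carrier M) \<and> bij (\<lambda>a. snd (f a))},
     monoid.mult = (\<lambda>f g a. (fst (f a) \<otimes>\<^bsub>M\<^esub> fst (g (snd (f a))), snd (g (snd (f a))))),
     one = (\<lambda>a. (\<one>\<^bsub>M\<^esub>, a))\<rparr>"

lemma wreath_simps:
  "f \<in> carrier (wreath M) \<longleftrightarrow> (\<forall>a. fst (f a) \<in> carrier M) \<and> bij (\<lambda>a. snd (f a))"
  "(f \<otimes>\<^bsub>wreath M\<^esub> g) a = (fst (f a) \<otimes>\<^bsub>M\<^esub> fst (g (snd (f a))), snd (g (snd (f a))))"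
  "\<one>\<^bsub>wreath M\<^esub> a = (\<one>\<^bsub>M\<^esub>, a)"
  by (simp_all add: wreath_def)

lemma group_wreath:
  assumes "group M" shows "group (wreath M :: ('l \<Rightarrow> 'm \<times> 'l) monoid)"
proof -
  interpret group M by fact
  show ?thesis
  proof (rule groupI)
    fix f :: "'l \<Rightarrow> 'm \<times> 'l" assume "f \<in> carrier (wreath M)"
    then have f: "\<And>a. fst (f a) \<in> carrier M" "bij (\<lambda>a. snd (f a))" by (auto simp: wreath_simps)
    define p where "p = inv_into UNIV (\<lambda>a. snd (f a))"
    have p: "snd (f (p a)) = a" "p (snd (f a)) = a" for a
      using f(2) bij_is_surj[THEN surj_f_inv_f] bij_is_inj[THEN inv_into_f_f]
      unfolding p_def by fastforce+
    have "bij p" unfolding p_def using f(2) by (rule bij_imp_bij_inv)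
    \<comment> \<open>The inverse returns the label \<open>a\<close> to \<open>p a\<close> and picks
      up the inverse of the factor that \<open>f\<close> picks up there.\<close>
    then show "\<exists>g\<in>carrier (wreath M). g \<otimes>\<^bsub>wreath M\<^esub> f = \<one>\<^bsub>wreath M\<^esub>"
      using f p by (intro bexI[of _ "\<lambda>a. (inv\<^bsub>M\<^esub> fst (f (p a)), p a)"])
        (auto simp: wreath_simps fun_eq_iff)
  next
    fix f g :: "'l \<Rightarrow> 'm \<times> 'l" assume "f \<in> carrier (wreath M)" "g \<in> carrier (wreath M)"
    then show "f \<otimes>\<^bsub>wreath M\<^esub> g \<in> carrier (wreath M)"
      using bij_comp[of "\<lambda>a. snd (f a)" "\<lambda>a. snd (g a)"] by (auto simp: wreath_simps o_def)
  qed (auto simp: wreath_simps fun_eq_iff m_assoc bij_id[unfolded id_def])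
qed

section \<open>The group of bijections of a set\<close>

lemma BijGroup_mult_apply:
  "f \<in> carrier (BijGroup S) \<Longrightarrow> g \<in> carrier (BijGroup S) \<Longrightarrow> x \<in> S \<Longrightarrow>
    (f \<otimes>\<^bsub>BijGroup S\<^esub> g) x = f (g x)"
  by (simp add: BijGroup_def compose_def)

lemma BijGroup_one_apply: "x \<in> S \<Longrightarrow> \<one>\<^bsub>BijGroup S\<^esub> x = x"
  by (simp add: BijGroup_def)

lemma BijGroup_eqI:
  assumes "f \<in> carrier (BijGroup S)" "g \<in> carrier (BijGroup S)" "\<And>x. x \<in> S \<Longrightarrow> f x = g x"
  shows "f = g"
  using assms by (auto simp: BijGroup_def Bij_def intro: extensionalityI)

lemma BijGroup_apply_closed: "f \<in> carrier (BijGroup S) \<Longrightarrow> x \<in> S \<Longrightarrow> f x \<in> S"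
  by (auto simp: BijGroup_def Bij_def bij_betw_def)

lemma restrict_in_BijGroup:
  assumes "\<And>x. x \<in> S \<Longrightarrow> f x \<in> S" "\<And>x. x \<in> S \<Longrightarrow> g x \<in> S"
    "\<And>x. x \<in> S \<Longrightarrow> g (f x) = x" "\<And>x. x \<in> S \<Longrightarrow> f (g x) = x"
  shows "restrict f S \<in> carrier (BijGroup S)"
proof -
  have "bij_betw f S S" by (rule bij_betwI[of _ _ _ g]) (use assms in auto)
  then have "bij_betw (restrict f S) S S" by (subst bij_betw_cong[where g = f]) auto
  then show ?thesis by (simp add: BijGroup_def Bij_def)
qed

section \<open>Free groups\<close>

fun flip :: "'a \<times> bool \<Rightarrow> 'a \<times> bool" where "flip (x, b) = (x, \<not> b)"

lemma flip_simps [simp]: "flip (flip p) = p" "fst (flip p) = fst p" "flip p \<noteq> p"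
  by (cases p; auto)+

abbreviation reduced :: "('a \<times> bool) list \<Rightarrow> bool"
  where "reduced \<equiv> successively (\<lambda>p q. q \<noteq> flip p)"

fun red_cons :: "'a \<times> bool \<Rightarrow> ('a \<times> bool) list \<Rightarrow> ('a \<times> bool) list" where
  "red_cons p [] = [p]"
| "red_cons p (q # w) = (if q = flip p then w else p # q # w)"

definition reduce :: "('a \<times> bool) list \<Rightarrow> ('a \<times> bool) list"
  where "reduce w = foldr red_cons w []"

lemma reduced_red_cons: "reduced w \<Longrightarrow> reduced (red_cons p w)"
  by (cases w rule: remdups_adj.cases) auto

lemma reduced_foldr_red_cons: "reduced w \<Longrightarrow> reduced (foldr red_cons v w)"
  by (induction v) (auto simp: reduced_red_cons)

lemma reduced_reduce: "reduced (reduce w)"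
  by (simp add: reduce_def reduced_foldr_red_cons)

text \<open>Van der Waerden's trick: opposite letters act on reduced words by mutually inverse maps,
  so \<open>reduce\<close> is invariant under cancellation. Reducedness excludes the words that
  begin with \<open>p\<close> and \<open>flip p\<close>, the only ones for which the equation
  fails.\<close>

lemma red_cons_flip: "reduced w \<Longrightarrow> red_cons p (red_cons (flip p) w) = w"
  by (cases w rule: remdups_adj.cases) auto

lemma reduce_id: "reduced w \<Longrightarrow> reduce w = w"
proof (induction w)
  case (Cons p w)
  then show ?case by (cases w) (auto simp: reduce_def)
qed (simp add: reduce_def)

lemma reduce_cong: "pres_cong X {} v w \<Longrightarrow> reduce v = reduce w"
proof (induction rule: pres_cong.induct)
  case (pc_cancel u v x b)
  have "red_cons (x, b) (red_cons (flip (x, b)) (foldr red_cons v [])) = foldr red_cons v []"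
    by (rule red_cons_flip) (simp add: reduced_foldr_red_cons)
  then show ?case by (simp add: reduce_def)
qed auto

lemma red_cons_cong:
  assumes "p # w \<in> words X" shows "pres_cong X {} (p # w) (red_cons p w)"
proof (cases w)
  case (Cons q w')
  obtain x b where p: "p = (x, b)" by (cases p)
  show ?thesis
  proof (cases "q = flip p")
    case True
    then show ?thesis using assms pc_cancel[of "[]" X w' x "{}" b] p Cons by simp
  qed (use assms Cons in \<open>auto intro: pc_refl\<close>)
qed (use assms in \<open>auto intro: pc_refl\<close>)

lemma cong_reduce: "w \<in> words X \<Longrightarrow> pres_cong X {} w (reduce w)"
proof (induction w)
  case (Cons p w)
  then have 1: "pres_cong X {} w (reduce w)" by simp
  have "pres_cong X {} ([p] @ w) ([p] @ reduce w)"
    by (rule pres_cong_append_left[OF 1]) (use Cons.prems in auto)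
  moreover have "pres_cong X {} (p # reduce w) (red_cons p (reduce w))"
    using red_cons_cong[of p "reduce w"] pres_cong_words[OF 1] Cons.prems by simp
  ultimately show ?case by (auto simp: reduce_def intro: pc_trans)
qed (simp add: reduce_def pc_refl)

section \<open>Unique reduced words and the centralizer of a free generator\<close>

lemma reduced_words_unique:
  "pres_cong X {} v w \<Longrightarrow> reduced v \<Longrightarrow> reduced w \<Longrightarrow> v = w"
  using reduce_cong reduce_id by metis

lemma free_group_gen_neq_one:
  assumes "x \<in> X" shows "pres_gen X {} x \<noteq> \<one>\<^bsub>presented_group X {}\<^esub>"
  using assms reduced_words_unique[of X "[(x, True)]" "[]"]
  by (auto simp: pres_gen_def presented_group_one pres_class_eq_iff)

lemma reduced_snoc: "reduced (w @ [p]) \<longleftrightarrow> reduced w \<and> (w \<noteq> [] \<longrightarrow> p \<noteq> flip (last w))"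
  by (auto simp: successively_append_iff)

text \<open>Induction on the word: a first letter with base \<open>x\<close> can be removed from
  both sides. If the first letter has another base, \<open>x w\<close> is reduced, while
  \<open>w x\<close> either cancels to a shorter word or is reduced with a different first letter,
  against \<open>reduced_words_unique\<close>.\<close>

lemma free_group_centralizer_word:
  assumes "x \<in> X" "w \<in> words X" "reduced w" "pres_cong X {} ((x, True) # w) (w @ [(x, True)])"
  shows "set w \<subseteq> {x} \<times> UNIV"
  using assms(2-4)
proof (induction w)
  case (Cons p w)
  let ?e = "(x, True)"
  have w: "w \<in> words X" "reduced w" using Cons.prems by (auto simp: successively_Cons)
  have cancel: "pres_cong X {} u v"
    if "pres_cong X {} ((x, b) # u) ((x, b) # v)" for b u v
  proof -
    have uv: "u \<in> words X" "v \<in> words X" using pres_cong_words[OF that] by auto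
    have "pres_cong X {} ([(x, \<not> b), (x, \<not> \<not> b)] @ z) z" if "z \<in> words X" for z
      using pc_cancel[of "[]" X z x "{}" "\<not> b"] that assms(1) by simp
    from this[of u] this[of v] show ?thesis
      using pres_cong_append_left[OF that, of "[(x, \<not> b)]"] uv assms(1)
      by (auto intro: pc_sym pc_trans)
  qed
  consider "p = ?e" | "p = (x, False)" | "fst p \<noteq> x" by (cases p) auto
  then show ?case
  proof cases
    case 1
    then have "pres_cong X {} (?e # w) (w @ [?e])" using Cons.prems(3) cancel by auto
    then show ?thesis using Cons.IH w 1 by auto
  next
    case 2
    have "pres_cong X {} ([] @ [?e, (x, \<not> True)] @ w) ([] @ w)" 
      using assms(1) w by (intro pc_cancel) auto
    then have "pres_cong X {} w ((x, False) # w @ [?e])"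
      using Cons.prems(3) 2 pc_sym pc_trans by fastforce
    then have "pres_cong X {} (?e # w) ([?e] @ (x, False) # w @ [?e])"
      using pres_cong_append_left[of X "{}" w "(x, False) # w @ [?e]" "[?e]"] assms(1) by simp
    moreover have "pres_cong X {} ([] @ [?e, (x, \<not> True)] @ w @ [?e]) ([] @ w @ [?e])"
      using assms(1) w by (intro pc_cancel) auto
    ultimately have "pres_cong X {} (?e # w) (w @ [?e])" by (auto intro: pc_trans)
    then show ?thesis using Cons.IH w 2 by auto
  next
    case 3
    let ?v = "p # w"
    have red1: "reduced (?e # ?v)" using 3 Cons.prems(2) by auto
    show ?thesis
    proof (cases "last ?v = (x, False)")
      case True
      then obtain u where u: "?v = u @ [(x, False)]" by (metis append_butlast_last_id list.distinct(1))
      have "pres_cong X {} (u @ [(x, False), (x, \<not> False)] @ []) (u @ [])"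
        using assms(1) Cons.prems(1) unfolding u by (intro pc_cancel) auto
      then have "pres_cong X {} (?e # ?v) u" using Cons.prems(3) u by (auto intro: pc_trans)
      moreover have "reduced u" using Cons.prems(2) unfolding u reduced_snoc by auto
      ultimately have "?e # ?v = u" using red1 reduced_words_unique by blast
      then have "length (?e # ?v) = length u" by simp
      then show ?thesis unfolding u by simp
    next
      case False
      then have "reduced (?v @ [?e])" using Cons.prems(2) unfolding reduced_snoc
        by (metis flip.simps flip_simps(1))
      then show ?thesis using 3 red1 reduced_words_unique[OF Cons.prems(3)] by auto
    qed
  qed
qed simp

lemma pres_class_inv_letter:
  assumes "x \<in> X"
  shows "pres_class X R [(x, False)] = inv\<^bsub>presented_group X R\<^esub> pres_gen X R x"
proof -
  have "pres_cong X R ([] @ [(x, False), (x, \<not> False)] @ []) ([] @ [])"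
    using assms by (intro pc_cancel) auto
  then have "pres_class X R [(x, False)] \<otimes>\<^bsub>presented_group X R\<^esub> pres_gen X R x =
      \<one>\<^bsub>presented_group X R\<^esub>"
    using assms by (simp add: pres_gen_def presented_group_mult presented_group_one pres_class_eq_iff)
  moreover have "pres_class X R [(x, False)] \<in> carrier (presented_group X R)"
    using assms by (auto simp: presented_group_carrier)
  ultimately show ?thesis
    using group.inv_equality[OF group_presented_group] pres_gen_closed[OF assms] by metis
qed

lemma free_group_centralizer:
  assumes "x \<in> X" "u \<in> carrier (presented_group X {})"
    and "pres_gen X {} x \<otimes>\<^bsub>presented_group X {}\<^esub> u = u \<otimes>\<^bsub>presented_group X {}\<^esub> pres_gen X {} x"
  shows "u \<in> generate (presented_group X {}) {pres_gen X {} x}"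
proof -
  interpret group "presented_group X {}" by (rule group_presented_group)
  obtain w where "w \<in> words X" "u = pres_class X {} w"
    using assms(2) by (auto simp: presented_group_carrier)
  then have w: "reduce w \<in> words X" "u = pres_class X {} (reduce w)"
    using cong_reduce[of w X] pres_cong_words pres_class_eq_iff by metis+
  have "set (reduce w) \<subseteq> {x} \<times> UNIV"
    using assms(1,3) w
    by (intro free_group_centralizer_word[of x X])
      (auto simp: reduced_reduce pres_gen_def presented_group_mult pres_class_eq_iff)
  moreover have "pres_class X {} v \<in> generate (presented_group X {}) {pres_gen X {} x}"
    if "set v \<subseteq> {x} \<times> UNIV" for v
    using that
  proof (induction v)
    case Nil
    then show ?case by (simp add: generate.one flip: presented_group_one)
  next
    case (Cons p v)
    then obtain b where p: "p = (x, b)" by auto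
    have "pres_class X {} [p] \<in> generate (presented_group X {}) {pres_gen X {} x}"
      using p pres_class_inv_letter[OF assms(1)]
      by (cases b) (auto simp: pres_gen_def intro: generate.incl generate.inv)
    moreover have "pres_class X {} (p # v) =
        pres_class X {} [p] \<otimes>\<^bsub>presented_group X {}\<^esub> pres_class X {} v"
      using Cons.prems assms(1) by (subst presented_group_mult) (auto simp: words_def)
    ultimately show ?case using Cons by (auto intro: generate.eng)
  qed
  ultimately show ?thesis using w by blast
qed

section \<open>Families satisfying the Artin relations\<close>

text \<open>The relations common to both types, for elements of an arbitrary group. The locales are
  used for the standard generators and also for families in wreath products and in
  \<open>BijGroup\<close>, from which homomorphisms are obtained.\<close>

locale artin_family = group +
  fixes n :: nat and s :: "nat \<Rightarrow> 'a"
  assumes gen_closed [simp]: "i \<in> {1..n} \<Longrightarrow> s i \<in> carrier G"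
    and gen_commute: "i \<in> {1..n} \<Longrightarrow> j \<in> {1..n} \<Longrightarrow> i + 2 \<le> j \<Longrightarrow> s i \<otimes> s j = s j \<otimes> s i"
    and gen_braid: "2 \<le> i \<Longrightarrow> Suc i \<le> n \<Longrightarrow> s i \<otimes> (s (Suc i) \<otimes> s i) = s (Suc i) \<otimes> (s i \<otimes> s (Suc i))"

locale type_A_family = artin_family +
  assumes gen_braid_1: "2 \<le> n \<Longrightarrow> s 1 \<otimes> (s 2 \<otimes> s 1) = s 2 \<otimes> (s 1 \<otimes> s 2)"

locale type_B_family = artin_family +
  assumes gen_four: "2 \<le> n \<Longrightarrow> s 1 \<otimes> (s 2 \<otimes> (s 1 \<otimes> s 2)) = s 2 \<otimes> (s 1 \<otimes> (s 2 \<otimes> s 1))"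

lemma (in type_A_family) braid:
  "1 \<le> i \<Longrightarrow> Suc i \<le> n \<Longrightarrow> s i \<otimes> (s (Suc i) \<otimes> s i) = s (Suc i) \<otimes> (s i \<otimes> s (Suc i))"
  using gen_braid[of i] gen_braid_1 by (cases "i = 1") (auto simp: numeral_2_eq_2)

lemma (in artin_family) commutation_rels_hold:
  assumes "(l, r) \<in> commutation_rels n"
  shows "eval_word G s (pos_word l) = eval_word G s (pos_word r)"
proof -
  obtain i j where "l = [i, j]" "r = [j, i]" "i \<in> {1..n}" "j \<in> {1..n}" "\<bar>int i - int j\<bar> \<ge> 2"
    using assms by (auto simp: commutation_rels_def)
  moreover from this have "i + 2 \<le> j \<or> j + 2 \<le> i" by linarith
  ultimately show ?thesis using gen_commute[of i j] gen_commute[of j i] by auto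
qed

lemma (in type_A_family) artin_A_hom_exists:
  "\<exists>h \<in> hom (artin_A n) G. \<forall>i\<in>{1..n}. h (sigma n i) = s i"
  unfolding artin_A_def sigma_def
proof (rule presented_group_universal)
  fix l r assume "(l, r) \<in> A_rels n"
  then show "eval_word G s (pos_word l) = eval_word G s (pos_word r)"
    using commutation_rels_hold[of l r] braid by (auto simp: A_rels_def braid_rels_def)
qed (auto simp: is_group)

lemma (in type_B_family) artin_B_hom_exists:
  "\<exists>h \<in> hom (artin_B n) G. \<forall>i\<in>{1..n}. h (tau n i) = s i"
  unfolding artin_B_def tau_def
proof (rule presented_group_universal)
  fix l r assume "(l, r) \<in> B_rels n" "set l \<subseteq> {1..n}"
  then show "eval_word G s (pos_word l) = eval_word G s (pos_word r)"
    using commutation_rels_hold[of l r] gen_braid gen_four by (auto simp: B_rels_def braid_rels_def)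
qed (auto simp: is_group)

lemma type_A_family_sigma: "type_A_family (artin_A n) n (sigma n)"
proof -
  interpret group "artin_A n" by (rule group_artin_A)
  show ?thesis
  proof unfold_locales
    show "sigma n i \<otimes>\<^bsub>artin_A n\<^esub> (sigma n (Suc i) \<otimes>\<^bsub>artin_A n\<^esub> sigma n i) =
        sigma n (Suc i) \<otimes>\<^bsub>artin_A n\<^esub> (sigma n i \<otimes>\<^bsub>artin_A n\<^esub> sigma n (Suc i))"
      if "2 \<le> i" "Suc i \<le> n" for i
      using that sigma_braid[of i n] by (simp add: m_assoc sigma_closed)
    show "sigma n 1 \<otimes>\<^bsub>artin_A n\<^esub> (sigma n 2 \<otimes>\<^bsub>artin_A n\<^esub> sigma n 1) =
        sigma n 2 \<otimes>\<^bsub>artin_A n\<^esub> (sigma n 1 \<otimes>\<^bsub>artin_A n\<^esub> sigma n 2)" if "2 \<le> n"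
      using that sigma_braid[of 1 n] by (simp add: m_assoc sigma_closed numeral_2_eq_2)
    show "sigma n i \<otimes>\<^bsub>artin_A n\<^esub> sigma n j = sigma n j \<otimes>\<^bsub>artin_A n\<^esub> sigma n i"
      if "i \<in> {1..n}" "j \<in> {1..n}" "i + 2 \<le> j" for i j
      using that by (intro sigma_commute) auto
  qed (rule sigma_closed)
qed

lemma type_B_family_tau: "type_B_family (artin_B n) n (tau n)"
proof -
  interpret group "artin_B n" by (rule group_artin_B)
  have rel: "pres_class {1..n} (B_rels n) (pos_word l) = pres_class {1..n} (B_rels n) (pos_word r)"
    if "(l, r) \<in> B_rels n" "set l \<subseteq> {1..n}" "set r \<subseteq> {1..n}" for l r
    using that by (rule pres_gen_rel)
  show ?thesis
  proof unfold_locales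
    show "tau n i \<otimes>\<^bsub>artin_B n\<^esub> tau n j = tau n j \<otimes>\<^bsub>artin_B n\<^esub> tau n i"
      if "i \<in> {1..n}" "j \<in> {1..n}" "i + 2 \<le> j" for i j
    proof -
      have "([i, j], [j, i]) \<in> B_rels n"
        using that by (force simp: B_rels_def commutation_rels_def)
      from rel[OF this] show ?thesis
        using that by (simp add: artin_B_def tau_def pres_gen_def presented_group_mult)
    qed
    show "tau n i \<otimes>\<^bsub>artin_B n\<^esub> (tau n (Suc i) \<otimes>\<^bsub>artin_B n\<^esub> tau n i) =
        tau n (Suc i) \<otimes>\<^bsub>artin_B n\<^esub> (tau n i \<otimes>\<^bsub>artin_B n\<^esub> tau n (Suc i))"
      if "2 \<le> i" "Suc i \<le> n" for i
    proof -
      have "([i, i + 1, i], [i + 1, i, i + 1]) \<in> B_rels n"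
        using that by (force simp: B_rels_def braid_rels_def)
      from rel[OF this] show ?thesis
        using that by (simp add: artin_B_def tau_def pres_gen_def presented_group_mult)
    qed
    show "tau n 1 \<otimes>\<^bsub>artin_B n\<^esub> (tau n 2 \<otimes>\<^bsub>artin_B n\<^esub> (tau n 1 \<otimes>\<^bsub>artin_B n\<^esub> tau n 2)) =
        tau n 2 \<otimes>\<^bsub>artin_B n\<^esub> (tau n 1 \<otimes>\<^bsub>artin_B n\<^esub> (tau n 2 \<otimes>\<^bsub>artin_B n\<^esub> tau n 1))" if "2 \<le> n"
      using that rel[of "[1, 2, 1, 2]" "[2, 1, 2, 1]"]
      by (simp add: B_rels_def artin_B_def tau_def pres_gen_def presented_group_mult)
  qed (auto intro: tau_closed)
qed

section \<open>The free normal subgroup of type B\<close>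

context type_B_family
begin

text \<open>\<open>loop j\<close> is the conjugate of \<open>s 1\<close> by
  \<open>s j \<otimes> \<dots> \<otimes> s 2\<close>. In type B its image under \<eta> is the
  standard pure braid generator linking the strands 1 and \<open>j + 1\<close>. The value at 0 is a
  default.\<close>

fun loop :: "nat \<Rightarrow> 'a" where
  "loop 0 = \<one>"
| "loop (Suc 0) = s 1"
| "loop (Suc (Suc j)) = inner (s (Suc (Suc j))) (loop (Suc j))"

lemma loop_Suc: "1 \<le> j \<Longrightarrow> loop (Suc j) = inner (s (Suc j)) (loop j)"
  by (cases j) auto

declare loop.simps(3) [simp del]

lemma loop_closed [simp]: "j \<le> n \<Longrightarrow> loop j \<in> carrier G"
  by (induction j rule: loop.induct) (auto simp: loop.simps)

lemma loop_Suc_mult: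
  "1 \<le> j \<Longrightarrow> Suc j \<le> n \<Longrightarrow> s (Suc j) \<otimes> loop j = loop (Suc j) \<otimes> s (Suc j)"
  by (subst inner_eq_iff[symmetric]) (auto simp: loop_Suc)

lemma commute_inner:
  assumes "c \<otimes> a = a \<otimes> c" "c \<otimes> b = b \<otimes> c" "a \<in> carrier G" "b \<in> carrier G" "c \<in> carrier G"
  shows "c \<otimes> inner a b = inner a b \<otimes> c"
  unfolding inner_def using assms by (intro commute_mult commute_inv) auto

lemma gen_loop_commute_above:
  "1 \<le> j \<Longrightarrow> j + 2 \<le> k \<Longrightarrow> k \<le> n \<Longrightarrow> s k \<otimes> loop j = loop j \<otimes> s k"
proof (induction j)
  case (Suc j)
  show ?case
  proof (cases "j = 0")
    case True
    then show ?thesis using Suc.prems gen_commute[of 1 k] by simp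
  next
    case False
    have "s k \<otimes> loop j = loop j \<otimes> s k" using Suc False by auto
    then show ?thesis using Suc.prems gen_commute[of "Suc j" k] False
      by (auto simp: loop_Suc intro!: commute_inner)
  qed
qed simp

text \<open>The essential case is \<open>k = j\<close>: conjugation by
  \<open>s (j + 1) \<otimes> s j\<close> sends \<open>s (j + 1)\<close> to \<open>s j\<close> and
  \<open>loop (j - 1)\<close> to \<open>loop (j + 1)\<close>, and the two elements before
  conjugation commute. The other cases follow by induction.\<close>

lemma gen_loop_commute_below:
  "2 \<le> k \<Longrightarrow> k < j \<Longrightarrow> j \<le> n \<Longrightarrow> s k \<otimes> loop j = loop j \<otimes> s k"
proof (induction j)
  case (Suc j)
  have cl: "s k \<in> carrier G" "s (Suc j) \<in> carrier G" "loop j \<in> carrier G" using Suc.prems by auto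
  show ?case
  proof (cases "k = j")
    case False
    then have "s k \<otimes> loop j = loop j \<otimes> s k" using Suc by auto
    then show ?thesis using Suc.prems gen_commute[of k "Suc j"] False
      by (auto simp: loop_Suc intro!: commute_inner)
  next
    case True
    obtain i where j: "j = Suc i" "1 \<le> i" using Suc.prems True by (cases j) auto
    let ?w = "s (Suc j) \<otimes> s j"
    have cl: "s j \<in> carrier G" "s (Suc j) \<in> carrier G" "loop i \<in> carrier G"
      using Suc.prems j by auto
    have L: "loop (Suc j) = inner ?w (loop i)"
      using j Suc.prems cl by (simp add: loop_Suc inner_mult)
    have "s j = inner ?w (s (Suc j))"
      using gen_braid[of j] Suc.prems True cl by (subst eq_commute, intro inner_eqI) (auto simp: m_assoc)
    moreover have "s (Suc j) \<otimes> loop i = loop i \<otimes> s (Suc j)"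
      using j Suc.prems by (intro gen_loop_commute_above) auto
    moreover have "inner ?w (s (Suc j) \<otimes> loop i) = inner ?w (s (Suc j)) \<otimes> inner ?w (loop i)"
      "inner ?w (loop i \<otimes> s (Suc j)) = inner ?w (loop i) \<otimes> inner ?w (s (Suc j))"
      using cl group_hom.hom_mult[OF group_hom_inner[of ?w]] by auto
    ultimately show ?thesis using True L by metis
  qed
qed simp

text \<open>Conjugation by \<open>s (j + 1) \<otimes> s (j + 2)\<close> carries
  \<open>loop j\<close> to \<open>loop (j + 1)\<close> and \<open>s (j + 1)\<close> to
  \<open>s (j + 2)\<close>, hence carries each instance of the relation to the next one, starting
  from \<open>gen_four\<close>.\<close>

lemma loop_four:
  "1 \<le> j \<Longrightarrow> Suc j \<le> n \<Longrightarrow>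
    loop j \<otimes> (s (Suc j) \<otimes> (loop j \<otimes> s (Suc j))) = s (Suc j) \<otimes> (loop j \<otimes> (s (Suc j) \<otimes> loop j))"
proof (induction j)
  case (Suc j)
  show ?case
  proof (cases "j = 0")
    case True
    then show ?thesis using Suc.prems gen_four by (simp add: numeral_2_eq_2)
  next
    case False
    let ?a = "s (Suc j)" and ?b = "s (Suc (Suc j))" and ?x = "loop j"
    let ?w = "?a \<otimes> ?b"
    have cl: "?a \<in> carrier G" "?b \<in> carrier G" "?x \<in> carrier G" using Suc.prems by auto
    have IH: "?x \<otimes> (?a \<otimes> (?x \<otimes> ?a)) = ?a \<otimes> (?x \<otimes> (?a \<otimes> ?x))" using Suc False by auto
    have bx: "inner ?b ?x = ?x"
      using gen_loop_commute_above[of j "Suc (Suc j)"] False Suc.prems cl by (intro inner_eqI) auto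
    have 1: "inner ?w ?a = ?b"
      using gen_braid[of "Suc j"] False Suc.prems cl by (intro inner_eqI) (auto simp: m_assoc)
    have 2: "inner ?w ?x = loop (Suc j)"
      using cl bx False by (simp add: inner_mult loop_Suc)
    have "inner ?w (?x \<otimes> (?a \<otimes> (?x \<otimes> ?a))) = inner ?w (?a \<otimes> (?x \<otimes> (?a \<otimes> ?x)))" using IH by simp
    then show ?thesis
      using cl group_hom.hom_mult[OF group_hom_inner[of ?w]] by (simp add: 1 2)
  qed
qed simp

text \<open>This is \<open>loop_four\<close> rewritten by means of \<open>loop_Suc_mult\<close>.
  Together with \<open>loop_Suc\<close> it gives Artin's formulas for the action of a braid
  generator on free generators.\<close>

lemma gen_inner_loop_Suc:
  assumes "1 \<le> j" "Suc j \<le> n"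
  shows "inner (s (Suc j)) (loop (Suc j)) = inner (inv loop (Suc j)) (loop j)"
proof -
  let ?a = "s (Suc j)" and ?x = "loop j" and ?y = "loop (Suc j)"
  have cl: "?a \<in> carrier G" "?x \<in> carrier G" "?y \<in> carrier G" using assms by auto
  have ax: "?a \<otimes> ?x = ?y \<otimes> ?a" using loop_Suc_mult assms by simp
  have "?x \<otimes> ?y \<otimes> ?a = ?x \<otimes> (?a \<otimes> ?x)" using ax cl by (simp add: m_assoc)
  have "?y \<otimes> (?a \<otimes> ?y) \<otimes> ?a = ?a \<otimes> (?x \<otimes> (?a \<otimes> ?x))" using ax cl by (metis m_assoc m_closed)
  also have "\<dots> = ?x \<otimes> (?a \<otimes> (?x \<otimes> ?a))" using loop_four assms by simp
  also have "\<dots> = ?x \<otimes> ?y \<otimes> ?a \<otimes> ?a" using ax cl by (metis m_assoc m_closed)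
  finally have "?y \<otimes> (?a \<otimes> ?y) = ?x \<otimes> ?y \<otimes> ?a" using cl by simp
  then have "?a \<otimes> ?y = inv ?y \<otimes> (?x \<otimes> ?y \<otimes> ?a)" using cl by (metis inv_l_cancel m_closed)
  then show ?thesis using cl by (intro inner_eqI) (auto simp: inner_def m_assoc)
qed

end

section \<open>Normality of the subgroup generated by the loops\<close>

context type_B_family
begin

abbreviation loop_subgroup :: "'a set"
  where "loop_subgroup \<equiv> generate G (loop ` {1..n})"

lemma loops_closed: "loop ` {1..n} \<subseteq> carrier G"
  by auto

text \<open>The first generator is itself a loop. Conjugation by any other \<open>s i\<close>
  affects only \<open>loop (i - 1)\<close> and \<open>loop i\<close>, by Artin's formulas, and the
  inverse conjugation is computed from these.\<close>

lemma gen_normalizes_loops: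
  assumes i: "i \<in> {1..n}" shows "s i \<in> normalizer G loop_subgroup"
proof -
  have incl: "loop j \<in> loop_subgroup" if "j \<in> {1..n}" for j
    using that by (auto intro: generate.incl)
  have sub: "subgroup loop_subgroup G" by (intro generate_is_subgroup loops_closed)
  have inn: "inner x y \<in> loop_subgroup" "inner (inv x) y \<in> loop_subgroup"
    if "x \<in> loop_subgroup" "y \<in> loop_subgroup" for x y
    using that subgroup.m_closed[OF sub] subgroup.m_inv_closed[OF sub] subgroup.mem_carrier[OF sub]
    by (auto simp: inner_def)
  show ?thesis
  proof (cases "i = 1")
    case True
    then show ?thesis using incl[of 1] i subset_normalizer[OF sub] by auto
  next
    case False
    then obtain k where k: "i = Suc k" "1 \<le> k" "Suc k \<le> n" using i by (cases i) auto
    have cl: "s i \<in> carrier G" "loop k \<in> carrier G" "loop i \<in> carrier G" using k by auto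
    have "inner (s i) (loop j) \<in> loop_subgroup \<and> inner (inv s i) (loop j) \<in> loop_subgroup"
      if j: "j \<in> {1..n}" for j
    proof -
      consider "j = k" | "j = i" | "j < k" | "i < j" using k by linarith
      then show ?thesis
      proof cases
        case 1
        have "inner (s i) (loop k) = loop i" using k loop_Suc by simp
        \<comment> \<open>Conjugate \<open>gen_inner_loop_Suc\<close> by \<open>inv s i\<close> and
          solve for the image of \<open>loop k\<close>.\<close>
        moreover have "inner (inv s i) (loop k) = inner (loop k) (loop i)"
        proof -
          have e: "inner (s i) (loop i) = inner (inv loop i) (loop k)"
            using gen_inner_loop_Suc k by simp
          have "loop i = inner (inv s i) (inner (inv loop i) (loop k))"
            using e cl by (metis inner_inv_cancel(1))
          also have "\<dots> = inner (inner (inv s i) (inv loop i)) (inner (inv s i) (loop k))"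
            using cl by (simp add: inner_def m_assoc inv_mult_group inv_l_cancel inv_r_cancel)
          also have "inner (inv s i) (inv loop i) = inv loop k"
            using group_hom.hom_inv[OF group_hom_inner[of "inv s i"], of "loop i"] cl k loop_Suc
            by simp
          finally have "inner (loop k) (loop i) = inner (loop k) (inner (inv loop k) (inner (inv s i) (loop k)))"
            by simp
          then show ?thesis using cl by simp
        qed
        ultimately show ?thesis using incl inn k 1 by auto
      next
        case 2
        have "inner (inv s i) (loop i) = loop k" using k loop_Suc cl by simp
        moreover have "inner (s i) (loop i) = inner (inv loop i) (loop k)"
          using gen_inner_loop_Suc k by simp
        ultimately show ?thesis using incl inn k 2 by auto
      next
        case 3
        then have "s i \<otimes> loop j = loop j \<otimes> s i" using gen_loop_commute_above[of j i] k j by auto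
        then have "inner (s i) (loop j) = loop j" using cl j by (intro inner_eqI) auto
        moreover from this have "inner (inv s i) (loop j) = loop j"
          using cl j by (metis inner_inv_cancel(1) loop_closed atLeastAtMost_iff)
        ultimately show ?thesis using incl j by simp
      next
        case 4
        then have "s i \<otimes> loop j = loop j \<otimes> s i" using gen_loop_commute_below[of i j] k j by auto
        then have "inner (s i) (loop j) = loop j" using cl j by (intro inner_eqI) auto
        moreover from this have "inner (inv s i) (loop j) = loop j"
          using cl j by (metis inner_inv_cancel(1) loop_closed atLeastAtMost_iff)
        ultimately show ?thesis using incl j by simp
      qed
    qed
    then show ?thesis using cl by (intro mem_normalizer_generateI loops_closed) auto
  qed
qed

lemma loop_subgroup_normalized:
  "g \<in> generate G (s ` {1..n}) \<Longrightarrow> g \<in> normalizer G loop_subgroup"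
  using generate_subgroup_incl[of "s ` {1..n}" "normalizer G loop_subgroup"]
    normalizer_imp_subgroup[OF generate_incl[OF loops_closed]] gen_normalizes_loops by blast

end

text \<open>The labels \<open>1..n + 1\<close> are the cosets of \<open>\<eta> (artin_B n)\<close> in \<open>artin_A n\<close>; \<open>coset_cocycle\<close> is the
  rewriting rule of Reidemeister and Schreier for the transversal with elements
  \<open>\<sigma>\<^sub>1\<inverse> \<dots> \<sigma>\<^sub>j\<^sub>-\<^sub>1\<inverse>\<close>.\<close>

definition adj_swap :: "nat \<Rightarrow> nat \<Rightarrow> nat"
  where "adj_swap i a = (if a = i then i + 1 else if a = i + 1 then i else a)"

lemma adj_swap_adj_swap [simp]: "adj_swap i (adj_swap i a) = a"
  by (simp add: adj_swap_def)

lemma bij_adj_swap: "bij (adj_swap i)"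
  by (rule involuntory_imp_bij) simp

definition coset_cocycle :: "nat \<Rightarrow> nat \<Rightarrow> nat \<Rightarrow> (nat \<times> bool) list set \<times> nat"
  where "coset_cocycle n i a =
    (if a = 0 \<or> a > n + 1 \<or> a = i + 1 then \<one>\<^bsub>artin_B n\<^esub>
     else if a < i then tau n i
     else if a = i then type_B_family.loop (artin_B n) (tau n) i
     else tau n (i + 1),
     adj_swap i a)"

text \<open>The relations of type A are compared label by label. Away from the crossing strands they
  become relations of \<open>artin_B n\<close>; on the crossing strands they become the identities
  proved above for the loops.\<close>

lemma type_A_family_coset_cocycle: "type_A_family (wreath (artin_B n)) n (coset_cocycle n)"
proof -
  interpret type_B_family "artin_B n" n "tau n" by (rule type_B_family_tau)
  interpret W: group "wreath (artin_B n) :: (nat \<Rightarrow> _) monoid" by (rule group_wreath) (rule is_group)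
  note defs = wreath_simps coset_cocycle_def adj_swap_def
  have braid: "coset_cocycle n i \<otimes>\<^bsub>wreath (artin_B n)\<^esub> (coset_cocycle n (Suc i) \<otimes>\<^bsub>wreath (artin_B n)\<^esub> coset_cocycle n i) =
     coset_cocycle n (Suc i) \<otimes>\<^bsub>wreath (artin_B n)\<^esub> (coset_cocycle n i \<otimes>\<^bsub>wreath (artin_B n)\<^esub> coset_cocycle n (Suc i))"
    if i: "1 \<le> i" "Suc i \<le> n" for i
  proof
    fix a
    have ax: "tau n (Suc i) \<otimes>\<^bsub>artin_B n\<^esub> loop i = loop (Suc i) \<otimes>\<^bsub>artin_B n\<^esub> tau n (Suc i)"
      using loop_Suc_mult i by simp
    \<comment> \<open>This is the braid relation read at the label \<open>i\<close>:
      \<open>\<tau>\<^sub>i\<^sub>+\<^sub>1\<close> commutes with the product of two consecutive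
      loops, which is \<open>loop_four\<close> in another form.\<close>
    have 4: "loop i \<otimes>\<^bsub>artin_B n\<^esub> (loop (Suc i) \<otimes>\<^bsub>artin_B n\<^esub> tau n (Suc i)) =
        tau n (Suc i) \<otimes>\<^bsub>artin_B n\<^esub> (loop i \<otimes>\<^bsub>artin_B n\<^esub> loop (Suc i))"
    proof -
      have "loop i \<otimes>\<^bsub>artin_B n\<^esub> (loop (Suc i) \<otimes>\<^bsub>artin_B n\<^esub> tau n (Suc i)) \<otimes>\<^bsub>artin_B n\<^esub> tau n (Suc i) =
        loop i \<otimes>\<^bsub>artin_B n\<^esub> (tau n (Suc i) \<otimes>\<^bsub>artin_B n\<^esub> (loop i \<otimes>\<^bsub>artin_B n\<^esub> tau n (Suc i)))"
        using ax i by (simp add: m_assoc flip: ax)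
      also have "\<dots> = tau n (Suc i) \<otimes>\<^bsub>artin_B n\<^esub> (loop i \<otimes>\<^bsub>artin_B n\<^esub> (tau n (Suc i) \<otimes>\<^bsub>artin_B n\<^esub> loop i))"
        using loop_four i by simp
      also have "\<dots> = tau n (Suc i) \<otimes>\<^bsub>artin_B n\<^esub> (loop i \<otimes>\<^bsub>artin_B n\<^esub> loop (Suc i)) \<otimes>\<^bsub>artin_B n\<^esub> tau n (Suc i)"
        using ax i by (simp add: m_assoc)
      finally show ?thesis using i by simp
    qed
    consider "a = 0 \<or> n + 1 < a" | "1 \<le> a" "a < i" | "a = i" | "a = i + 1" | "a = i + 2"
      | "i + 2 < a" "a \<le> n + 1" by linarith
    then show "(coset_cocycle n i \<otimes>\<^bsub>wreath (artin_B n)\<^esub> (coset_cocycle n (Suc i) \<otimes>\<^bsub>wreath (artin_B n)\<^esub> coset_cocycle n i)) a =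
     (coset_cocycle n (Suc i) \<otimes>\<^bsub>wreath (artin_B n)\<^esub> (coset_cocycle n i \<otimes>\<^bsub>wreath (artin_B n)\<^esub> coset_cocycle n (Suc i))) a"
      by cases (use i 4 ax gen_braid[of i] gen_braid[of "Suc i"] in \<open>auto simp: defs\<close>)
  qed
  show ?thesis
  proof unfold_locales
    show "coset_cocycle n i \<in> carrier (wreath (artin_B n))" if "i \<in> {1..n}" for i
      using that bij_adj_swap[of i] by (auto simp: wreath_simps coset_cocycle_def)
    show "coset_cocycle n i \<otimes>\<^bsub>wreath (artin_B n)\<^esub> coset_cocycle n j =
      coset_cocycle n j \<otimes>\<^bsub>wreath (artin_B n)\<^esub> coset_cocycle n i"
      if ij: "i \<in> {1..n}" "j \<in> {1..n}" "i + 2 \<le> j" for i j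
    proof
      fix a
      consider "a = 0 \<or> n + 1 < a" | "1 \<le> a" "a < i" | "a = i" | "a = i + 1" | "i + 2 \<le> a" "a < j"
        | "a = j" | "a = j + 1" | "j + 2 \<le> a" "a \<le> n + 1" by linarith
      then show "(coset_cocycle n i \<otimes>\<^bsub>wreath (artin_B n)\<^esub> coset_cocycle n j) a =
        (coset_cocycle n j \<otimes>\<^bsub>wreath (artin_B n)\<^esub> coset_cocycle n i) a"
        by cases (use ij gen_commute[of i j] gen_commute[of "i+1" j] gen_commute[of "i+1" "j+1"]
            gen_loop_commute_above[of i j] gen_loop_commute_below[of "i + 1" j] in \<open>auto simp: defs\<close>)
    qed
    show "2 \<le> i \<Longrightarrow> Suc i \<le> n \<Longrightarrow> coset_cocycle n i \<otimes>\<^bsub>wreath (artin_B n)\<^esub> (coset_cocycle n (Suc i) \<otimes>\<^bsub>wreath (artin_B n)\<^esub> coset_cocycle n i) =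
     coset_cocycle n (Suc i) \<otimes>\<^bsub>wreath (artin_B n)\<^esub> (coset_cocycle n i \<otimes>\<^bsub>wreath (artin_B n)\<^esub> coset_cocycle n (Suc i))" for i
      using braid by simp
    show "2 \<le> n \<Longrightarrow> coset_cocycle n 1 \<otimes>\<^bsub>wreath (artin_B n)\<^esub> (coset_cocycle n 2 \<otimes>\<^bsub>wreath (artin_B n)\<^esub> coset_cocycle n 1) =
     coset_cocycle n 2 \<otimes>\<^bsub>wreath (artin_B n)\<^esub> (coset_cocycle n 1 \<otimes>\<^bsub>wreath (artin_B n)\<^esub> coset_cocycle n 2)"
      using braid[of 1] by (simp add: numeral_2_eq_2)
  qed
qed

section \<open>The free action\<close>

lemma free_hom_exists:
  assumes "group G" "\<And>x. x \<in> X \<Longrightarrow> f x \<in> carrier G"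
  shows "\<exists>h. group_hom (presented_group X {}) G h \<and> (\<forall>x\<in>X. h (pres_gen X {} x) = f x)"
  using presented_group_universal[OF assms(1), of f X "{}"] assms group_homI[OF group_presented_group]
  by (metis Pi_I empty_iff)

lemma free_hom_eqI:
  assumes "f \<in> hom (presented_group X {}) G" "g \<in> hom (presented_group X {}) G" "group G"
    and "\<And>x. x \<in> X \<Longrightarrow> f (pres_gen X {} x) = g (pres_gen X {} x)"
    and "u \<in> carrier (presented_group X {})"
  shows "f u = g u"
  using hom_eq_on_generate[OF group_homI[OF group_presented_group assms(3,1)]
      group_homI[OF group_presented_group assms(3,2)], of "pres_gen X {} ` X" u] assms(4,5)
  using pres_gen_closed[of _ X "{} :: ('a list \<times> 'a list) set"]
  unfolding presented_group_generated by blast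

text \<open>In type B the generator \<open>\<tau>\<^sub>1\<close> acts on the free group by a left translation and the other
  generators by the automorphisms of Artin, so that the elements \<open>loop j\<close> act by left translations.\<close>

lemma free_action_exists:
  "\<exists>\<Theta>. group_hom (artin_B n) (BijGroup (carrier (presented_group {1..n} {}))) \<Theta> \<and>
    (\<forall>j\<in>{1..n}. \<forall>u\<in>carrier (presented_group {1..n} {}).
      \<Theta> (type_B_family.loop (artin_B n) (tau n) j) u = pres_gen {1..n} {} j \<otimes>\<^bsub>presented_group {1..n} {}\<^esub> u)"
proof -
  define F where "F = presented_group {1..n} ({} :: (nat list \<times> nat list) set)"
  define e where "e = pres_gen {1..n} ({} :: (nat list \<times> nat list) set)"
  interpret F: group F unfolding F_def by (rule group_presented_group)
  have e [simp]: "e j \<in> carrier F" if "j \<in> {1..n}" for j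
    using that pres_gen_closed unfolding F_def e_def by fast
  note homI = free_hom_eqI[of _ "{1..n}" F, folded F_def e_def]
  \<comment> \<open>Artin's automorphism, with the formulas that describe conjugation of
    \<open>loop i\<close> and \<open>loop (i + 1)\<close> by \<open>tau n (i + 1)\<close>.\<close>
  define a where "a i = (SOME h. group_hom F F h \<and> (\<forall>j\<in>{1..n}. h (e j) =
    (if j = i then e (i + 1) else if j = i + 1 then F.inner (inv\<^bsub>F\<^esub> e (i + 1)) (e i) else e j)))" for i
  have a: "group_hom F F (a i) \<and> (\<forall>j\<in>{1..n}. a i (e j) =
    (if j = i then e (i + 1) else if j = i + 1 then F.inner (inv\<^bsub>F\<^esub> e (i + 1)) (e i) else e j))"
    if "i \<in> {1..<n}" for i
  proof -
    have "\<exists>h. group_hom F F h \<and> (\<forall>j\<in>{1..n}. h (e j) =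
        (if j = i then e (i + 1) else if j = i + 1 then F.inner (inv\<^bsub>F\<^esub> e (i + 1)) (e i) else e j))"
      by (unfold F_def e_def, rule free_hom_exists, fold F_def e_def, use that in \<open>auto simp: F.is_group\<close>)
    then show ?thesis unfolding a_def by (rule someI_ex)
  qed
  have ah: "a i \<in> hom F F" and a_cl: "u \<in> carrier F \<Longrightarrow> a i u \<in> carrier F"
    and a_mult: "u \<in> carrier F \<Longrightarrow> v \<in> carrier F \<Longrightarrow> a i (u \<otimes>\<^bsub>F\<^esub> v) = a i u \<otimes>\<^bsub>F\<^esub> a i v"
    and a_inv: "u \<in> carrier F \<Longrightarrow> a i (inv\<^bsub>F\<^esub> u) = inv\<^bsub>F\<^esub> a i u"
    if "i \<in> {1..<n}" for i u v
    using a[OF that] group_hom.homh[of F F] group_hom.hom_closed[of F F]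
      group_hom.hom_mult[of F F] group_hom.hom_inv[of F F] by simp_all
  have ae: "a i (e i) = e (i + 1)" "a i (e (i + 1)) = F.inner (inv\<^bsub>F\<^esub> e (i + 1)) (e i)"
    "j \<in> {1..n} \<Longrightarrow> j \<noteq> i \<Longrightarrow> j \<noteq> i + 1 \<Longrightarrow> a i (e j) = e j" if "i \<in> {1..<n}" for i j
    using a[OF that] that by auto
  \<comment> \<open>These endomorphisms are the inverses of the \<open>a i\<close>; they are used to
    see that the \<open>a i\<close> are bijective.\<close>
  have b: "\<exists>b. group_hom F F b \<and> (\<forall>j\<in>{1..n}. b (e j) =
    (if j = i + 1 then e i else if j = i then F.inner (e i) (e (i + 1)) else e j))"
    if "i \<in> {1..<n}" for i
    by (unfold F_def e_def, rule free_hom_exists, fold F_def e_def, use that in \<open>auto simp: F.is_group\<close>)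
  \<comment> \<open>The index shifts by one: \<open>tau n i\<close> acts as the automorphism
    \<open>a (i - 1)\<close> for \<open>i \<ge> 2\<close>. The left translation for
    \<open>i = 1\<close> is not an automorphism, hence the target \<open>BijGroup\<close>.\<close>
  define T where "T i = restrict (if i = 1 then \<lambda>u. e 1 \<otimes>\<^bsub>F\<^esub> u else a (i - 1)) (carrier F)" for i
  let ?P = "BijGroup (carrier F)"
  interpret P: group ?P by (rule group_BijGroup)
  have T_cl: "T i \<in> carrier ?P" if "i \<in> {1..n}" for i
  proof (cases "i = 1")
    case True
    then have e1: "e (Suc 0) \<in> carrier F" using e[of i] that by simp
    show ?thesis unfolding T_def
      by (rule restrict_in_BijGroup[where g = "\<lambda>u. inv\<^bsub>F\<^esub> e 1 \<otimes>\<^bsub>F\<^esub> u"])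
        (use True e1 in \<open>auto simp: F.inv_l_cancel F.inv_r_cancel\<close>)
  next
    case False
    then have i: "i - 1 \<in> {1..<n}" using that by auto
    define k where "k = i - 1"
    note i = i[folded k_def]
    obtain b where b: "group_hom F F b" "\<forall>j\<in>{1..n}. b (e j) =
      (if j = k + 1 then e k else if j = k then F.inner (e k) (e (k + 1)) else e j)"
      using b[OF i] by blast
    interpret a: group_hom F F "a k" using a[OF i] by simp
    interpret b: group_hom F F b by fact
    have ek: "e k \<in> carrier F" "e (Suc k) \<in> carrier F" using i by auto
    have idh: "id \<in> hom F F" by (simp add: hom_def)
    have be: "b (e (Suc k)) = e k" "b (e k) = F.inner (e k) (e (Suc k))"
      "\<And>j. j \<in> {1..n} \<Longrightarrow> j \<noteq> k \<Longrightarrow> j \<noteq> Suc k \<Longrightarrow> b (e j) = e j"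
      using b i by auto
    have "(b \<circ> a k) u = id u" if "u \<in> carrier F" for u
    proof (rule homI[where f = "b \<circ> a k" and g = id])
      fix j assume j: "j \<in> {1..n}"
      consider "j = k" | "j = Suc k" | "j \<noteq> k" "j \<noteq> Suc k" by blast
      then show "(b \<circ> a k) (e j) = id (e j)"
        by cases (use ae[OF i] be j ek in \<open>simp_all add: F.inner_def F.m_assoc F.inv_l_cancel\<close>)
    qed (use that idh hom_compose[OF a.homh b.homh] in \<open>simp_all add: F.is_group\<close>)
    moreover have "(a k \<circ> b) u = id u" if "u \<in> carrier F" for u
    proof (rule homI[where f = "a k \<circ> b" and g = id])
      fix j assume j: "j \<in> {1..n}"
      consider "j = k" | "j = Suc k" | "j \<noteq> k" "j \<noteq> Suc k" by blast
      then show "(a k \<circ> b) (e j) = id (e j)"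
        by cases (use ae[OF i] be j ek in \<open>simp_all add: F.inner_def F.m_assoc F.inv_r_cancel\<close>)
    qed (use that idh hom_compose[OF b.homh a.homh] in \<open>simp_all add: F.is_group\<close>)
    moreover have "T i = restrict (a k) (carrier F)" using False by (simp add: T_def k_def)
    ultimately show ?thesis by (auto intro: restrict_in_BijGroup[where g = b])
  qed
  have T_1: "T 1 u = e 1 \<otimes>\<^bsub>F\<^esub> u" if "u \<in> carrier F" for u using that by (simp add: T_def)
  have T_a: "T i u = a (i - 1) u" if "i \<in> {2..n}" "u \<in> carrier F" for i u using that by (simp add: T_def)
  have "type_B_family ?P n T"
  proof unfold_locales
    show "T i \<otimes>\<^bsub>?P\<^esub> T j = T j \<otimes>\<^bsub>?P\<^esub> T i" if ij: "i \<in> {1..n}" "j \<in> {1..n}" "i + 2 \<le> j" for i j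
    proof (rule BijGroup_eqI)
      fix u assume u: "u \<in> carrier F"
      have j: "j - 1 \<in> {1..<n}" "j \<in> {2..n}" using ij by auto
      have "T i (T j u) = T j (T i u)"
      proof (cases "i = 1")
        case True
        then show ?thesis using T_1 T_a[OF j(2)] u a_cl[OF j(1)] a_mult[OF j(1)] ae(3)[OF j(1)] ij
          by (simp)
      next
        case False
        then obtain i' j' where i': "i = Suc i'" "j = Suc j'" using ij by (cases i; cases j) auto
        then have i: "i' \<in> {1..<n}" "j' \<in> {1..<n}" "i' + 2 \<le> j'" "i \<in> {2..n}" using ij False by auto
        have cl: "e i' \<in> carrier F" "e (Suc i') \<in> carrier F" "e j' \<in> carrier F" "e (Suc j') \<in> carrier F"
          using i by auto
        have "(a i' \<circ> a j') u = (a j' \<circ> a i') u"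
        proof (rule homI[where f = "a i' \<circ> a j'" and g = "a j' \<circ> a i'"])
          fix k assume k: "k \<in> {1..n}"
          consider "k = i'" | "k = Suc i'" | "k = j'" | "k = Suc j'"
            | "k \<noteq> i'" "k \<noteq> Suc i'" "k \<noteq> j'" "k \<noteq> Suc j'" by blast
          then show "(a i' \<circ> a j') (e k) = (a j' \<circ> a i') (e k)"
            by cases (use ae[OF i(1)] ae[OF i(2)] a_inv[OF i(1)] a_inv[OF i(2)] a_mult[OF i(1)]
              a_mult[OF i(2)] i k cl in \<open>simp_all add: F.inner_def\<close>)
        qed (use hom_compose[OF ah[OF i(1)] ah[OF i(2)]] hom_compose[OF ah[OF i(2)] ah[OF i(1)]] u
          in \<open>simp_all add: F.is_group\<close>)
        then show ?thesis using T_a i j u a_cl unfolding i' by simp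
      qed
      then show "(T i \<otimes>\<^bsub>?P\<^esub> T j) u = (T j \<otimes>\<^bsub>?P\<^esub> T i) u"
        using ij T_cl u by (simp add: BijGroup_mult_apply)
    qed (use T_cl ij in auto)
    show "T i \<otimes>\<^bsub>?P\<^esub> (T (Suc i) \<otimes>\<^bsub>?P\<^esub> T i) = T (Suc i) \<otimes>\<^bsub>?P\<^esub> (T i \<otimes>\<^bsub>?P\<^esub> T (Suc i))"
      if i: "2 \<le> i" "Suc i \<le> n" for i
    proof (rule BijGroup_eqI)
      fix u assume u: "u \<in> carrier F"
      obtain k where k: "i = Suc k" using i by (cases i) auto
      have k1: "k \<in> {1..<n}" "Suc k \<in> {1..<n}" using i k by auto
      have "(a k \<circ> (a (Suc k) \<circ> a k)) u = (a (Suc k) \<circ> (a k \<circ> a (Suc k))) u"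
      proof (rule homI[where f = "a k \<circ> (a (Suc k) \<circ> a k)" and g = "a (Suc k) \<circ> (a k \<circ> a (Suc k))"])
        fix j assume j: "j \<in> {1..n}"
        have ek: "e k \<in> carrier F" "e (Suc k) \<in> carrier F" "e (Suc (Suc k)) \<in> carrier F" using k1 by auto
        consider "j = k" | "j = Suc k" | "j = Suc (Suc k)" | "j \<noteq> k" "j \<noteq> Suc k" "j \<noteq> Suc (Suc k)" by auto
        then show "(a k \<circ> (a (Suc k) \<circ> a k)) (e j) = (a (Suc k) \<circ> (a k \<circ> a (Suc k))) (e j)"
          by cases (use ae[OF k1(1)] ae[OF k1(2)] k1 j ek a_inv[OF k1(1)] a_inv[OF k1(2)]
              a_mult[OF k1(1)] a_mult[OF k1(2)] in
              \<open>simp_all add: F.inner_def F.m_assoc F.inv_mult_group F.inv_l_cancel F.inv_r_cancel\<close>)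
      qed (use hom_compose[OF hom_compose[OF ah ah] ah, of k "Suc k" k]
        hom_compose[OF hom_compose[OF ah ah] ah, of "Suc k" k "Suc k"] k1 u
        in \<open>simp_all add: F.is_group comp_assoc\<close>)
      then have "T i (T (Suc i) (T i u)) = T (Suc i) (T i (T (Suc i) u))"
        using T_a i k k1 u a_cl by simp
      then show "(T i \<otimes>\<^bsub>?P\<^esub> (T (Suc i) \<otimes>\<^bsub>?P\<^esub> T i)) u = (T (Suc i) \<otimes>\<^bsub>?P\<^esub> (T i \<otimes>\<^bsub>?P\<^esub> T (Suc i))) u"
        using i T_cl u by (simp add: BijGroup_mult_apply BijGroup_apply_closed)
    qed (use T_cl i in auto)
    show "T 1 \<otimes>\<^bsub>?P\<^esub> (T 2 \<otimes>\<^bsub>?P\<^esub> (T 1 \<otimes>\<^bsub>?P\<^esub> T 2)) = T 2 \<otimes>\<^bsub>?P\<^esub> (T 1 \<otimes>\<^bsub>?P\<^esub> (T 2 \<otimes>\<^bsub>?P\<^esub> T 1))" if n: "2 \<le> n"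
    proof (rule BijGroup_eqI)
      fix u assume u: "u \<in> carrier F"
      have 1: "1 \<in> {1..<n}" "e 1 \<in> carrier F" "e 2 \<in> carrier F" using n by auto
      have v: "a 1 u \<in> carrier F" "a 1 (a 1 u) \<in> carrier F" using u a_cl[OF 1(1)] by auto
      have a12: "a 1 (e 1) = e 2" "a 1 (e 2) = inv\<^bsub>F\<^esub> e 2 \<otimes>\<^bsub>F\<^esub> e 1 \<otimes>\<^bsub>F\<^esub> e 2"
        using ae[OF 1(1)] 1 by (auto simp: F.inner_def numeral_2_eq_2)
      have "T 1 (T 2 (T 1 (T 2 u))) = T 2 (T 1 (T 2 (T 1 u)))"
        using T_1 T_a[of 2] n u 1 v a_mult[OF 1(1)] a12
        by (simp add: F.m_assoc F.inv_r_cancel)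
      then show "(T 1 \<otimes>\<^bsub>?P\<^esub> (T 2 \<otimes>\<^bsub>?P\<^esub> (T 1 \<otimes>\<^bsub>?P\<^esub> T 2))) u = (T 2 \<otimes>\<^bsub>?P\<^esub> (T 1 \<otimes>\<^bsub>?P\<^esub> (T 2 \<otimes>\<^bsub>?P\<^esub> T 1))) u"
        using n T_cl[of 1] T_cl[of 2] u by (simp add: BijGroup_mult_apply BijGroup_apply_closed)
    qed (use T_cl[of 1] T_cl[of 2] n in auto)
  qed (rule T_cl)
  then obtain \<Theta> where \<Theta>: "\<Theta> \<in> hom (artin_B n) ?P" "\<forall>i\<in>{1..n}. \<Theta> (tau n i) = T i"
    using type_B_family.artin_B_hom_exists by blast
  interpret B: type_B_family "artin_B n" n "tau n" by (rule type_B_family_tau)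
  interpret \<Theta>: group_hom "artin_B n" ?P \<Theta>
    by (rule group_homI) (use \<Theta> B.is_group P.is_group in auto)
  define L where "L j = restrict (\<lambda>u. e j \<otimes>\<^bsub>F\<^esub> u) (carrier F)" for j
  have L_cl: "L j \<in> carrier ?P" if "j \<in> {1..n}" for j
    unfolding L_def using e[OF that]
    by (intro restrict_in_BijGroup[where g = "\<lambda>u. inv\<^bsub>F\<^esub> e j \<otimes>\<^bsub>F\<^esub> u"])
      (auto simp: F.inv_l_cancel F.inv_r_cancel)
  \<comment> \<open>Since \<open>a j\<close> is multiplicative and sends \<open>e j\<close> to
    \<open>e (j + 1)\<close>, it conjugates the left translation by the one into that by the
    other.\<close>
  have "\<Theta> (B.loop j) = L j" if "1 \<le> j" "j \<le> n" for j
    using that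
  proof (induction j rule: nat_induct_at_least)
    case base
    then show ?case using \<Theta> by (simp add: T_def L_def)
  next
    case (Suc j)
    have j: "j \<in> {1..<n}" "Suc j \<in> {1..n}" "j \<in> {1..n}" using Suc by auto
    have "\<Theta> (B.loop (Suc j)) = P.inner (T (Suc j)) (L j)"
      using Suc j \<Theta> by (simp add: B.loop_Suc \<Theta>.hom_inner)
    also have "\<dots> = L (Suc j)"
    proof (rule P.inner_eqI[OF BijGroup_eqI])
      fix u assume u: "u \<in> carrier F"
      show "(T (Suc j) \<otimes>\<^bsub>?P\<^esub> L j) u = (L (Suc j) \<otimes>\<^bsub>?P\<^esub> T (Suc j)) u"
        using u j T_cl L_cl T_a[of "Suc j"] a_mult[OF j(1)] ae[OF j(1)] a_cl[OF j(1)] e[OF j(3)]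
        by (simp add: BijGroup_mult_apply) (simp add: L_def)
    qed (use j T_cl L_cl in auto)
    finally show ?case .
  qed
  then show ?thesis unfolding F_def[symmetric] e_def[symmetric]
    using \<Theta>.group_hom_axioms by (intro exI[of _ \<Theta>]) (auto simp: L_def)
qed

lemma wreath_inv_apply:
  assumes "group M" "f \<in> carrier (wreath M)" "f a = (m, b)"
  shows "(inv\<^bsub>wreath M\<^esub> f) b = (inv\<^bsub>M\<^esub> m, a)"
proof -
  interpret M: group M by fact
  interpret W: group "wreath M :: ('c \<Rightarrow> 'a \<times> 'c) monoid" by (rule group_wreath) fact
  let ?g = "inv\<^bsub>wreath M\<^esub> f"
  have g: "?g \<in> carrier (wreath M)" using assms(2) by simp
  have "(f \<otimes>\<^bsub>wreath M\<^esub> ?g) a = (\<one>\<^bsub>M\<^esub>, a)" using assms(2) by (simp add: wreath_simps)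
  then have "m \<otimes>\<^bsub>M\<^esub> fst (?g b) = \<one>\<^bsub>M\<^esub>" "snd (?g b) = a"
    using assms(3) by (auto simp: wreath_simps)
  moreover have "m \<in> carrier M" "fst (?g b) \<in> carrier M"
    using assms(2,3) g unfolding wreath_simps by (metis fst_conv, blast)
  ultimately show ?thesis by (metis M.inv_equality M.inv_inv M.inv_closed prod.collapse)
qed

section \<open>Centralizer of \<open>\<tau>\<^sub>1\<close> in the free normal subgroup\<close>

context
  fixes n :: nat
begin

interpretation B: type_B_family "artin_B n" n "tau n" by (rule type_B_family_tau)

text \<open>The free group maps onto \<open>loop_subgroup\<close>, and the composition with the
  action of \<open>free_action_exists\<close> is the left regular representation, which is faithful.
  So the commutation lifts to the free group, where \<open>free_group_centralizer\<close>
  applies.\<close>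

lemma loop_subgroup_centralizer:
  assumes "1 \<le> n" "x \<in> B.loop_subgroup"
    and "tau n 1 \<otimes>\<^bsub>artin_B n\<^esub> x = x \<otimes>\<^bsub>artin_B n\<^esub> tau n 1"
  shows "x \<in> generate (artin_B n) {tau n 1}"
proof -
  define F where "F = presented_group {1..n} ({} :: (nat list \<times> nat list) set)"
  define e where "e = pres_gen {1..n} ({} :: (nat list \<times> nat list) set)"
  let ?P = "BijGroup (carrier F)"
  interpret F: group F unfolding F_def by (rule group_presented_group)
  have e: "e j \<in> carrier F" if "j \<in> {1..n}" for j 
    using that unfolding F_def e_def by (rule pres_gen_closed)
  obtain \<theta> where \<theta>: "group_hom F (artin_B n) \<theta>" "\<forall>j\<in>{1..n}. \<theta> (e j) = B.loop j"
    using free_hom_exists[of "artin_B n" "{1..n}" B.loop] B.is_group unfolding F_def e_def by auto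
  interpret \<theta>: group_hom F "artin_B n" \<theta> by fact
  obtain \<Theta> where \<Theta>: "group_hom (artin_B n) ?P \<Theta>"
    "\<forall>j\<in>{1..n}. \<forall>u\<in>carrier F. \<Theta> (B.loop j) u = e j \<otimes>\<^bsub>F\<^esub> u"
    using free_action_exists unfolding F_def e_def by blast
  interpret \<Theta>: group_hom "artin_B n" ?P \<Theta> by fact
  define L where "L u = restrict (\<lambda>v. u \<otimes>\<^bsub>F\<^esub> v) (carrier F)" for u
  have L_cl: "L u \<in> carrier ?P" if "u \<in> carrier F" for u
    unfolding L_def using that
    by (intro restrict_in_BijGroup[where g = "\<lambda>v. inv\<^bsub>F\<^esub> u \<otimes>\<^bsub>F\<^esub> v"])
      (auto simp: F.inv_l_cancel F.inv_r_cancel)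
  have L: "L \<in> hom F ?P"
  proof (rule homI)
    fix u v assume uv: "u \<in> carrier F" "v \<in> carrier F"
    show "L (u \<otimes>\<^bsub>F\<^esub> v) = L u \<otimes>\<^bsub>?P\<^esub> L v"
    proof (rule BijGroup_eqI)
      show "L (u \<otimes>\<^bsub>F\<^esub> v) w = (L u \<otimes>\<^bsub>?P\<^esub> L v) w" if "w \<in> carrier F" for w
        using that uv L_cl by (simp add: BijGroup_mult_apply) (simp add: L_def F.m_assoc)
    qed (use uv L_cl in auto)
  qed (rule L_cl)
  have \<Theta>\<theta>: "(\<Theta> \<circ> \<theta>) u = L u" if "u \<in> carrier F" for u
  proof (rule free_hom_eqI[where f = "\<Theta> \<circ> \<theta>" and g = L, of "{1..n}", folded F_def e_def])
    fix j assume j: "j \<in> {1..n}"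
    show "(\<Theta> \<circ> \<theta>) (e j) = L (e j)"
    proof (rule BijGroup_eqI)
      show "(\<Theta> \<circ> \<theta>) (e j) u = L (e j) u" if "u \<in> carrier F" for u
        using j that \<theta>(2) \<Theta>(2) by (simp add: L_def)
    qed (use j e L_cl in auto)
  qed (use that L \<Theta>.H.is_group hom_compose[OF \<theta>.homh \<Theta>.homh] in auto)
  have "B.loop ` {1..n} = \<theta> ` e ` {1..n}" using \<theta>(2) by force
  then have "B.loop_subgroup = \<theta> ` carrier F"
    using \<theta>.generate_img[of "e ` {1..n}"] e presented_group_generated[of "{1..n}" "{}", folded F_def e_def]
    by (simp add: image_subset_iff)
  then obtain u where u: "u \<in> carrier F" "x = \<theta> u" using assms(2) by auto
  have \<theta>1: "\<theta> (e 1) = tau n 1" "e 1 \<in> carrier F" using \<theta>(2) e assms(1) by auto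
  have "\<theta> (e 1 \<otimes>\<^bsub>F\<^esub> u) = \<theta> (u \<otimes>\<^bsub>F\<^esub> e 1)" using assms(3) u \<theta>1 by simp
  then have "L (e 1 \<otimes>\<^bsub>F\<^esub> u) = L (u \<otimes>\<^bsub>F\<^esub> e 1)" using u \<theta>1 by (simp flip: \<Theta>\<theta>)
  then have "L (e 1 \<otimes>\<^bsub>F\<^esub> u) \<one>\<^bsub>F\<^esub> = L (u \<otimes>\<^bsub>F\<^esub> e 1) \<one>\<^bsub>F\<^esub>" by simp
  then have "e 1 \<otimes>\<^bsub>F\<^esub> u = u \<otimes>\<^bsub>F\<^esub> e 1" using u \<theta>1(2) by (simp add: L_def)
  then have "u \<in> generate F {e 1}" 
    using free_group_centralizer[of 1 "{1..n}" u, folded F_def e_def] assms(1) u by simp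
  then have "x \<in> \<theta> ` generate F {e 1}" using u by simp
  then show ?thesis using \<theta>.generate_img[of "{e 1}"] \<theta>1 by simp
qed

text \<open>\<open>\<tau>\<^sub>1\<close> acts as left translation by a free generator and so moves
  the unit.\<close>

lemma tau_1_neq_one:
  assumes "1 \<le> n" shows "tau n 1 \<noteq> \<one>\<^bsub>artin_B n\<^esub>"
proof
  assume *: "tau n 1 = \<one>\<^bsub>artin_B n\<^esub>"
  define F where "F = presented_group {1..n} ({} :: (nat list \<times> nat list) set)"
  define e where "e = pres_gen {1..n} ({} :: (nat list \<times> nat list) set)"
  interpret F: group F unfolding F_def by (rule group_presented_group)
  obtain \<Theta> where \<Theta>: "group_hom (artin_B n) (BijGroup (carrier F)) \<Theta>"
    "\<forall>j\<in>{1..n}. \<forall>u\<in>carrier F. \<Theta> (B.loop j) u = e j \<otimes>\<^bsub>F\<^esub> u"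
    using free_action_exists unfolding F_def e_def by blast
  have "\<Theta> (tau n 1) \<one>\<^bsub>F\<^esub> = e 1" 
  proof -
    have "e 1 \<in> carrier F" using assms pres_gen_closed[of 1 "{1..n}"] unfolding F_def e_def by simp
    then show ?thesis using \<Theta>(2) assms by (auto dest!: bspec[of _ _ 1] bspec[of _ _ "\<one>\<^bsub>F\<^esub>"])
  qed
  moreover have "\<Theta> (tau n 1) \<one>\<^bsub>F\<^esub> = \<one>\<^bsub>F\<^esub>"
    using group_hom.hom_one[OF \<Theta>(1)] * by (simp add: BijGroup_one_apply)
  ultimately show False 
    using free_group_gen_neq_one[of 1 "{1..n}", folded F_def e_def] assms by simp
qed

end

section \<open>Cosets of parabolic subgroups\<close>

context type_A_family
begin

abbreviation parabolic :: "nat \<Rightarrow> nat \<Rightarrow> 'a set"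
  where "parabolic a b \<equiv> generate G (s ` {a..b})"

text \<open>For braids this turns out to be the subgroup of \<open>parabolic m b\<close> fixing the
  strand \<open>m\<close>. The case \<open>m = 1\<close> gives images of parabolic subgroups of type
  B; \<open>m = 2\<close> enters in the centralizer argument.\<close>

abbreviation square_parabolic :: "nat \<Rightarrow> nat \<Rightarrow> 'a set"
  where "square_parabolic m b \<equiv> generate G (insert (s m \<otimes> s m) (s ` {Suc m..b}))"

text \<open>\<open>rep m j\<close> is the product
  \<open>s m \<otimes> \<dots> \<otimes> s (j - 1)\<close>, with value \<open>\<one>\<close> for
  \<open>j \<le> m\<close>. As a braid it carries the strand \<open>m\<close> to the position
  \<open>j\<close>.\<close>

primrec rep :: "nat \<Rightarrow> nat \<Rightarrow> 'a" where
  "rep m 0 = \<one>"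
| "rep m (Suc j) = (if j < m then \<one> else rep m j \<otimes> s j)"

lemma rep_self [simp]: "rep m m = \<one>"
  by (cases m) auto

lemma square_gens_closed:
  "1 \<le> m \<Longrightarrow> m \<le> n \<Longrightarrow> b \<le> n \<Longrightarrow> insert (s m \<otimes> s m) (s ` {Suc m..b}) \<subseteq> carrier G"
  by auto

lemma rep_closed [simp]: "1 \<le> m \<Longrightarrow> j \<le> n + 1 \<Longrightarrow> rep m j \<in> carrier G"
  by (induction j) auto

lemma rep_in_parabolic: "j \<le> b + 1 \<Longrightarrow> rep m j \<in> parabolic m b"
proof (induction j)
  case (Suc j)
  then have "rep m j \<in> parabolic m b" "s j \<in> parabolic m b" if "\<not> j < m"
    using that by (auto intro: generate.incl)
  then show ?case by (cases "j < m") (simp_all add: generate.one generate.eng)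
qed (simp add: generate.one)

lemma gen_rep_commute:
  assumes "1 \<le> m" "Suc j \<le> i" "i \<le> n" shows "s i \<otimes> rep m j = rep m j \<otimes> s i"
  using assms(2)
proof (induction j)
  case (Suc j)
  show ?case
  proof (cases "j < m")
    case False
    then have "s i \<otimes> s j = s j \<otimes> s i" using gen_commute[of j i] assms Suc by auto
    then show ?thesis using Suc False assms commute_mult[of "s i" "rep m j" "s j"] by simp
  qed (use assms Suc in simp)
qed (use assms in simp)

text \<open>For \<open>j = i + 2\<close> this is a braid relation, preceded by letters commuting
  with \<open>s (i + 1)\<close>; the letters added later commute with \<open>s i\<close>.\<close>

lemma rep_shift:
  assumes "1 \<le> m" "m \<le> i" "i + 2 \<le> j" "j \<le> n + 1"
  shows "rep m j \<otimes> s i = s (Suc i) \<otimes> rep m j"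
  using assms(3,4)
proof (induction j rule: nat_induct_at_least)
  case base
  have cl: "rep m i \<in> carrier G" "s i \<in> carrier G" "s (Suc i) \<in> carrier G"
    using assms base by auto
  have c: "s (Suc i) \<otimes> rep m i = rep m i \<otimes> s (Suc i)" using gen_rep_commute assms base by auto
  have "rep m i \<otimes> (s i \<otimes> (s (Suc i) \<otimes> s i)) = rep m i \<otimes> (s (Suc i) \<otimes> (s i \<otimes> s (Suc i)))"
    using braid[of i] assms base by simp
  also have "\<dots> = s (Suc i) \<otimes> (rep m i \<otimes> (s i \<otimes> s (Suc i)))"
    using c cl by (metis m_assoc m_closed)
  finally show ?case using assms cl by (simp add: m_assoc)
next
  case (Suc j)
  have cl: "rep m j \<in> carrier G" "s i \<in> carrier G" "s (Suc i) \<in> carrier G" "s j \<in> carrier G"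
    using assms Suc by auto
  have "s i \<otimes> s j = s j \<otimes> s i" using gen_commute[of i j] Suc assms by auto
  moreover have "rep m j \<otimes> s i = s (Suc i) \<otimes> rep m j" using Suc by auto
  ultimately have "rep m j \<otimes> s j \<otimes> s i = s (Suc i) \<otimes> (rep m j \<otimes> s j)"
    using cl by (metis m_assoc)
  then show ?case using Suc assms by simp
qed

text \<open>The induction step rests on the identity \<open>inner (s k) (s (k + 1) \<otimes> s (k +
  1)) = inner (inv s (k + 1)) (s k \<otimes> s k)\<close> and on the fact that
  \<open>s (k + 1)\<close> commutes with \<open>rep m k\<close>.\<close>

lemma inner_rep_square:
  assumes "1 \<le> m" "m \<le> k" "k \<le> b" "b \<le> n"
  shows "inner (rep m k) (s k \<otimes> s k) \<in> square_parabolic m b"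
  using assms(2,3)
proof (induction k rule: nat_induct_at_least)
  case base
  then show ?case using assms by (auto intro: generate.incl)
next
  case (Suc k)
  let ?a = "s k" and ?b = "s (Suc k)" and ?r = "rep m k"
  have cl: "?a \<in> carrier G" "?b \<in> carrier G" "?r \<in> carrier G" using assms Suc by auto
  have br: "?a \<otimes> (?b \<otimes> ?a) = ?b \<otimes> (?a \<otimes> ?b)" using braid[of k] Suc assms by auto
  have "?b \<otimes> (?a \<otimes> (?b \<otimes> ?b)) = ?b \<otimes> (?a \<otimes> ?b) \<otimes> ?b" using cl by (simp add: m_assoc)
  also have "\<dots> = ?a \<otimes> (?b \<otimes> (?a \<otimes> ?b))" using cl by (subst br[symmetric]) (simp add: m_assoc)
  also have "\<dots> = ?a \<otimes> (?a \<otimes> (?b \<otimes> ?a))" by (simp only: br)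
  finally have "inv ?b \<otimes> (?b \<otimes> (?a \<otimes> (?b \<otimes> ?b))) = inv ?b \<otimes> (?a \<otimes> (?a \<otimes> (?b \<otimes> ?a)))"
    by simp
  then have "?a \<otimes> (?b \<otimes> ?b) = inv ?b \<otimes> (?a \<otimes> (?a \<otimes> (?b \<otimes> ?a)))"
    using cl by (simp add: inv_l_cancel)
  then have "inner ?a (?b \<otimes> ?b) = inner (inv ?b) (?a \<otimes> ?a)"
    using cl by (intro inner_eqI) (auto simp: inner_def m_assoc)
  moreover have "inner ?r (inner (inv ?b) (?a \<otimes> ?a)) = inner (inv ?b) (inner ?r (?a \<otimes> ?a))"
  proof -
    have "?b \<otimes> ?r = ?r \<otimes> ?b" using gen_rep_commute assms Suc by auto
    then have "?r \<otimes> inv ?b = inv ?b \<otimes> ?r" using commute_inv[of ?r ?b] cl by simp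
    then show ?thesis using cl by (simp flip: inner_mult)
  qed
  ultimately have eq: "inner (rep m (Suc k)) (?b \<otimes> ?b) = inner (inv ?b) (inner ?r (?a \<otimes> ?a))"
    using Suc cl by (simp add: inner_mult)
  have sub: "subgroup (square_parabolic m b) G"
    using assms Suc by (intro generate_is_subgroup square_gens_closed) auto
  have b: "?b \<in> square_parabolic m b" using Suc by (auto intro: generate.incl)
  have "inner ?r (?a \<otimes> ?a) \<in> square_parabolic m b" using Suc by simp
  then show ?case unfolding eq using b subgroup.m_closed[OF sub] subgroup.m_inv_closed[OF sub]
    by (subst inner_def) simp
qed

text \<open>A Schreier coset enumeration: the union of the cosets of
  \<open>square_parabolic m b\<close> with representatives \<open>rep m j\<close> contains
  \<open>\<one>\<close> and is stable under right multiplication by each \<open>s i\<close> and its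
  inverse. The index \<open>j\<close> changes only if it is \<open>i\<close> or
  \<open>i + 1\<close>.\<close>

lemma parabolic_cosets:
  assumes "1 \<le> m" "m \<le> n" "b \<le> n" "m \<le> b + 1" "g \<in> parabolic m b"
  shows "\<exists>h\<in>square_parabolic m b. \<exists>j\<in>{m..b + 1}. g = h \<otimes> rep m j"
proof -
  let ?Q = "square_parabolic m b"
  let ?T = "{h \<otimes> rep m j |h j. h \<in> ?Q \<and> j \<in> {m..b + 1}}"
  have Qc: "?Q \<subseteq> carrier G" using assms by (intro generate_incl square_gens_closed) auto
  have Q: "subgroup ?Q G" using assms by (intro generate_is_subgroup square_gens_closed) auto
  note Qm = subgroup.m_closed[OF Q] and Qi = subgroup.m_inv_closed[OF Q]
  have sQ: "s i \<in> ?Q" if "m < i" "i \<le> b" for i using that by (auto intro!: generate.incl)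
  have key: "\<exists>q\<in>?Q. \<exists>j'\<in>{m..b + 1}. rep m j \<otimes> s i = q \<otimes> rep m j'"
    and key': "\<exists>q\<in>?Q. \<exists>j'\<in>{m..b + 1}. rep m j \<otimes> inv s i = q \<otimes> rep m j'"
    if j: "j \<in> {m..b + 1}" and i: "i \<in> {m..b}" for i j
  proof -
    have cl: "rep m j \<in> carrier G" "s i \<in> carrier G" "rep m i \<in> carrier G" "rep m (Suc i) \<in> carrier G"
      using assms j i by auto
    have loopQ: "inner (rep m i) (s i \<otimes> s i) \<in> ?Q" using inner_rep_square i assms by auto
    then have loopQ': "inner (rep m i) (inv (s i \<otimes> s i)) \<in> ?Q"
      using Qi[OF loopQ] cl by (simp add: inner_def inv_mult_group m_assoc)
    have rS: "rep m (Suc i) = rep m i \<otimes> s i" using i by simp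
    consider "j < i" | "j = i" | "j = Suc i" | "i + 2 \<le> j" by linarith
    then have "(\<exists>q\<in>?Q. \<exists>j'\<in>{m..b + 1}. rep m j \<otimes> s i = q \<otimes> rep m j') \<and>
      (\<exists>q\<in>?Q. \<exists>j'\<in>{m..b + 1}. rep m j \<otimes> inv s i = q \<otimes> rep m j')"
    proof cases
      case 1
      have c: "rep m j \<otimes> s i = s i \<otimes> rep m j" using gen_rep_commute assms i j 1 by simp
      then have "rep m j \<otimes> inv s i = inv s i \<otimes> rep m j" using commute_inv cl by simp
      with c show ?thesis using j i sQ[of i] Qi 1 by (metis atLeastAtMost_iff order_le_less_trans)
    next
      case 2
      have "rep m j \<otimes> s i = \<one> \<otimes> rep m (Suc i)" using 2 rS cl by simp
      moreover have "rep m j \<otimes> inv s i = inner (rep m i) (inv (s i \<otimes> s i)) \<otimes> rep m (Suc i)"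
        unfolding rS 2 using cl by (simp add: inner_def m_assoc inv_mult_group inv_l_cancel)
      moreover have "Suc i \<in> {m..b + 1}" using i by auto
      ultimately show ?thesis using loopQ' generate.one by blast
    next
      case 3
      have "rep m j \<otimes> inv s i = \<one> \<otimes> rep m i" using 3 rS cl by (simp add: m_assoc)
      moreover have "rep m j \<otimes> s i = inner (rep m i) (s i \<otimes> s i) \<otimes> rep m i"
        unfolding 3 rS using cl by (simp add: inner_def m_assoc)
      moreover have "i \<in> {m..b + 1}" using i by auto
      ultimately show ?thesis using loopQ generate.one by blast
    next
      case 4
      have Si: "Suc i \<in> {Suc m..b}" using i j 4 by auto
      have c: "rep m j \<otimes> s i = s (Suc i) \<otimes> rep m j" using rep_shift assms i j 4 by simp
      then have "inv s (Suc i) \<otimes> (rep m j \<otimes> s i) \<otimes> inv s i =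
          inv s (Suc i) \<otimes> (s (Suc i) \<otimes> rep m j) \<otimes> inv s i" by simp
      then have "rep m j \<otimes> inv s i = inv s (Suc i) \<otimes> rep m j"
        using cl Si assms by (simp add: m_assoc inv_l_cancel)
      with c show ?thesis using j sQ[of "Suc i"] Si Qi
        by (metis atLeastAtMost_iff Suc_le_lessD)
    qed
    then show "\<exists>q\<in>?Q. \<exists>j'\<in>{m..b + 1}. rep m j \<otimes> s i = q \<otimes> rep m j'"
      "\<exists>q\<in>?Q. \<exists>j'\<in>{m..b + 1}. rep m j \<otimes> inv s i = q \<otimes> rep m j'" by auto
  qed
  have rc: "rep m j \<in> carrier G" if "j \<in> {m..b + 1}" for j using that assms by auto
  have "parabolic m b \<subseteq> ?T"
  proof (rule generate_right_closed_subset)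
    show "s ` {m..b} \<subseteq> carrier G" using assms by auto
    show "?T \<subseteq> carrier G" using Qc rc by auto
    show "\<one> \<in> ?T"
      by (rule CollectI, intro exI[of _ "\<one>"] exI[of _ m]) (use assms in \<open>auto intro: generate.one\<close>)
  next
    fix t x assume "t \<in> ?T" "x \<in> s ` {m..b}"
    then obtain h j i where h: "h \<in> ?Q" "j \<in> {m..b + 1}" "t = h \<otimes> rep m j" "i \<in> {m..b}" "x = s i"
      by auto
    then have cl: "h \<in> carrier G" "rep m j \<in> carrier G" "s i \<in> carrier G" using Qc rc assms by auto
    obtain q j' where q: "q \<in> ?Q" "j' \<in> {m..b + 1}" "rep m j \<otimes> s i = q \<otimes> rep m j'"
      using key h by blast
    have "t \<otimes> x = (h \<otimes> q) \<otimes> rep m j'" using h q cl Qc rc by (simp add: m_assoc subsetD)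
    then show "t \<otimes> x \<in> ?T" using q h Qm by blast
    obtain q j' where q: "q \<in> ?Q" "j' \<in> {m..b + 1}" "rep m j \<otimes> inv s i = q \<otimes> rep m j'"
      using key' h by blast
    have "t \<otimes> inv x = (h \<otimes> q) \<otimes> rep m j'" using h q cl Qc rc by (simp add: m_assoc subsetD)
    then show "t \<otimes> inv x \<in> ?T" using q h Qm by blast
  qed
  then show ?thesis using assms(5) by blast
qed

end

section \<open>Deleting strands\<close>

lemma mem_adj_swap_image: "a \<in> adj_swap i ` S \<longleftrightarrow> adj_swap i a \<in> S"
  by (metis adj_swap_adj_swap image_iff)

lemma bij_image_adj_swap: "bij (image (adj_swap i))"
  by (rule involuntory_imp_bij) (simp add: image_comp o_def)

text \<open>\<open>S\<close> is the set of positions of the strands which are kept: a crossing survives if both of its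
  strands do, and is renumbered by the rank of its left strand within \<open>S\<close>.\<close>

definition strand_cocycle :: "nat \<Rightarrow> nat \<Rightarrow> nat set \<Rightarrow> (nat \<times> bool) list set \<times> nat set"
  where "strand_cocycle n i S =
    (if i \<in> S \<and> Suc i \<in> S then sigma n (Suc (card (S \<inter> {0<..<i}))) else \<one>\<^bsub>artin_A n\<^esub>,
     adj_swap i ` S)"

lemma card_Int_le: "1 \<le> i \<Longrightarrow> card (S \<inter> {0<..<i}) < i"
  using card_mono[of "{0<..<i}" "S \<inter> {0<..<i}"] by simp

lemma card_Int_Suc:
  "1 \<le> i \<Longrightarrow> card (S \<inter> {0<..<Suc i}) = (if i \<in> S then Suc (card (S \<inter> {0<..<i})) else card (S \<inter> {0<..<i}))"
proof -
  assume "1 \<le> i"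
  then have "S \<inter> {0<..<Suc i} = (if i \<in> S then insert i (S \<inter> {0<..<i}) else S \<inter> {0<..<i})"
    by (auto simp: less_Suc_eq)
  then show ?thesis by simp
qed

lemma adj_swap_image_Int:
  "i \<le> k \<Longrightarrow> adj_swap k ` S \<inter> {0<..<i} = S \<inter> {0<..<i}"
  by (auto simp: mem_adj_swap_image) (auto simp: adj_swap_def split: if_splits)

lemma card_adj_swap_image_Int:
  assumes "1 \<le> k" "k + 2 \<le> i" shows "card (adj_swap k ` S \<inter> {0<..<i}) = card (S \<inter> {0<..<i})"
proof -
  have "adj_swap k ` S \<inter> {0<..<i} = adj_swap k ` (S \<inter> {0<..<i})"
    using assms unfolding set_eq_iff mem_adj_swap_image Int_iff by (auto simp: adj_swap_def)
  then show ?thesis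
    by (simp add: card_image inj_on_subset[OF bij_is_inj[OF bij_adj_swap]])
qed

text \<open>For the braid relation there are eight cases, according to which of the three crossing
  strands are kept. With all three it is a braid relation at the rank \<open>?r\<close>; otherwise
  the surviving crossings agree on both sides.\<close>

lemma type_A_family_strand_cocycle: "type_A_family (wreath (artin_A n)) n (strand_cocycle n)"
proof -
  interpret type_A_family "artin_A n" n "sigma n" by (rule type_A_family_sigma)
  interpret W: group "wreath (artin_A n) :: (nat set \<Rightarrow> _) monoid" by (rule group_wreath) (rule is_group)
  have ext: "p = q" if "fst p = fst q" "snd p = snd q" for p q :: "(nat \<times> bool) list set \<times> nat set"
    using that by (rule prod_eqI)
  have rank: "Suc (card (S \<inter> {0<..<i})) \<in> {1..n}" if "1 \<le> i" "i \<le> n" for S i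
    using card_Int_le[OF that(1), of S] that by auto
  have braid: "strand_cocycle n i \<otimes>\<^bsub>wreath (artin_A n)\<^esub> (strand_cocycle n (Suc i) \<otimes>\<^bsub>wreath (artin_A n)\<^esub> strand_cocycle n i) =
     strand_cocycle n (Suc i) \<otimes>\<^bsub>wreath (artin_A n)\<^esub> (strand_cocycle n i \<otimes>\<^bsub>wreath (artin_A n)\<^esub> strand_cocycle n (Suc i))"
    if i: "1 \<le> i" "Suc i \<le> n" for i
  proof (rule ext[THEN HOL.ext[of "strand_cocycle n i \<otimes>\<^bsub>wreath (artin_A n)\<^esub> _"]])
    fix S
    let ?r = "Suc (card (S \<inter> {0<..<i}))"
    have cl: "sigma n ?r \<in> carrier (artin_A n)" using rank[of i S] i by auto
    have br: "sigma n ?r \<otimes>\<^bsub>artin_A n\<^esub> (sigma n (Suc ?r) \<otimes>\<^bsub>artin_A n\<^esub> sigma n ?r) =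
      sigma n (Suc ?r) \<otimes>\<^bsub>artin_A n\<^esub> (sigma n ?r \<otimes>\<^bsub>artin_A n\<^esub> sigma n (Suc ?r))"
      using braid[of ?r] card_Int_le[of i S] i by simp
    have sw: "adj_swap i i = Suc i" "adj_swap i (Suc i) = i" "adj_swap i (Suc (Suc i)) = Suc (Suc i)"
      "adj_swap (Suc i) i = i" "adj_swap (Suc i) (Suc i) = Suc (Suc i)" "adj_swap (Suc i) (Suc (Suc i)) = Suc i"
      by (auto simp: adj_swap_def)
    show "fst ((strand_cocycle n i \<otimes>\<^bsub>wreath (artin_A n)\<^esub> (strand_cocycle n (Suc i) \<otimes>\<^bsub>wreath (artin_A n)\<^esub> strand_cocycle n i)) S) =
     fst ((strand_cocycle n (Suc i) \<otimes>\<^bsub>wreath (artin_A n)\<^esub> (strand_cocycle n i \<otimes>\<^bsub>wreath (artin_A n)\<^esub> strand_cocycle n (Suc i))) S)"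
      using i cl br
      by (cases "i \<in> S"; cases "Suc i \<in> S"; cases "Suc (Suc i) \<in> S")
        (simp_all add: wreath_simps strand_cocycle_def mem_adj_swap_image sw card_Int_Suc
          adj_swap_image_Int)
    have "adj_swap i \<circ> adj_swap (Suc i) \<circ> adj_swap i = adj_swap (Suc i) \<circ> adj_swap i \<circ> adj_swap (Suc i)"
      by (auto simp: fun_eq_iff adj_swap_def)
    then show "snd ((strand_cocycle n i \<otimes>\<^bsub>wreath (artin_A n)\<^esub> (strand_cocycle n (Suc i) \<otimes>\<^bsub>wreath (artin_A n)\<^esub> strand_cocycle n i)) S) =
     snd ((strand_cocycle n (Suc i) \<otimes>\<^bsub>wreath (artin_A n)\<^esub> (strand_cocycle n i \<otimes>\<^bsub>wreath (artin_A n)\<^esub> strand_cocycle n (Suc i))) S)"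
      unfolding wreath_simps strand_cocycle_def fst_conv snd_conv image_comp by (simp only: comp_assoc)
  qed
  show ?thesis
  proof unfold_locales
    show "strand_cocycle n i \<in> carrier (wreath (artin_A n))" if "i \<in> {1..n}" for i
      using that rank[of i] bij_image_adj_swap[of i] by (auto simp: wreath_simps strand_cocycle_def)
    show "strand_cocycle n i \<otimes>\<^bsub>wreath (artin_A n)\<^esub> strand_cocycle n j =
      strand_cocycle n j \<otimes>\<^bsub>wreath (artin_A n)\<^esub> strand_cocycle n i"
      if ij: "i \<in> {1..n}" "j \<in> {1..n}" "i + 2 \<le> j" for i j
    proof (rule ext[THEN HOL.ext[of "strand_cocycle n i \<otimes>\<^bsub>wreath (artin_A n)\<^esub> _"]])
      fix S
      let ?r = "Suc (card (S \<inter> {0<..<i}))" and ?q = "Suc (card (S \<inter> {0<..<j}))"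
      have rq: "?r \<in> {1..n}" "?q \<in> {1..n}" using rank[of i S] rank[of j S] ij by auto
      have comm: "sigma n ?r \<otimes>\<^bsub>artin_A n\<^esub> sigma n ?q = sigma n ?q \<otimes>\<^bsub>artin_A n\<^esub> sigma n ?r"
        if "i \<in> S" "Suc i \<in> S"
      proof (rule gen_commute[OF rq])
        \<comment> \<open>Both kept strands at \<open>i\<close> and \<open>i + 1\<close> are counted
          on the way to \<open>j\<close>, so the ranks differ by at least 2.\<close>
        have "card (S \<inter> {0<..<Suc (Suc i)}) \<le> card (S \<inter> {0<..<j})" using ij by (intro card_mono) auto
        then show "?r + 2 \<le> ?q" using that ij by (simp add: card_Int_Suc)
      qed
      have sw: "adj_swap i j = j" "adj_swap i (Suc j) = Suc j" "adj_swap j i = i" "adj_swap j (Suc i) = Suc i"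
        using ij by (auto simp: adj_swap_def)
      show "fst ((strand_cocycle n i \<otimes>\<^bsub>wreath (artin_A n)\<^esub> strand_cocycle n j) S) =
        fst ((strand_cocycle n j \<otimes>\<^bsub>wreath (artin_A n)\<^esub> strand_cocycle n i) S)"
        using comm rq ij gen_closed[OF rq(1)] gen_closed[OF rq(2)]
        by (auto simp: wreath_simps strand_cocycle_def mem_adj_swap_image sw
            card_adj_swap_image_Int adj_swap_image_Int)
      have "adj_swap i \<circ> adj_swap j = adj_swap j \<circ> adj_swap i"
        using ij by (auto simp: fun_eq_iff adj_swap_def)
      then show "snd ((strand_cocycle n i \<otimes>\<^bsub>wreath (artin_A n)\<^esub> strand_cocycle n j) S) =
        snd ((strand_cocycle n j \<otimes>\<^bsub>wreath (artin_A n)\<^esub> strand_cocycle n i) S)"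
        unfolding wreath_simps strand_cocycle_def fst_conv snd_conv image_comp by simp
    qed
    show "2 \<le> i \<Longrightarrow> Suc i \<le> n \<Longrightarrow> strand_cocycle n i \<otimes>\<^bsub>wreath (artin_A n)\<^esub> (strand_cocycle n (Suc i) \<otimes>\<^bsub>wreath (artin_A n)\<^esub> strand_cocycle n i) =
     strand_cocycle n (Suc i) \<otimes>\<^bsub>wreath (artin_A n)\<^esub> (strand_cocycle n i \<otimes>\<^bsub>wreath (artin_A n)\<^esub> strand_cocycle n (Suc i))" for i
      using braid by simp
    show "2 \<le> n \<Longrightarrow> strand_cocycle n 1 \<otimes>\<^bsub>wreath (artin_A n)\<^esub> (strand_cocycle n 2 \<otimes>\<^bsub>wreath (artin_A n)\<^esub> strand_cocycle n 1) =
     strand_cocycle n 2 \<otimes>\<^bsub>wreath (artin_A n)\<^esub> (strand_cocycle n 1 \<otimes>\<^bsub>wreath (artin_A n)\<^esub> strand_cocycle n 2)"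
      using braid[of 1] by (simp add: numeral_2_eq_2)
  qed
qed

section \<open>The homomorphism \<open>\<eta>\<close>\<close>

text \<open>As \<open>V\<close> normalizes \<open>N\<close>, the product set of \<open>N\<close> and
  \<open>V\<close> is a subgroup.\<close>

lemma (in group) generate_subset_product:
  assumes N: "subgroup N G" and V: "subgroup V G" "V \<subseteq> normalizer G N"
    and S: "\<And>g. g \<in> S \<Longrightarrow> \<exists>x\<in>N. \<exists>v\<in>V. g = x \<otimes> v" and g: "g \<in> generate G S"
  shows "\<exists>x\<in>N. \<exists>v\<in>V. g = x \<otimes> v"
proof -
  let ?T = "{x \<otimes> v |x v. x \<in> N \<and> v \<in> V}"
  note Nc = subgroup.mem_carrier[OF N] and Vc = subgroup.mem_carrier[OF V(1)]
  have inn: "inner v x \<in> N" if "v \<in> V" "x \<in> N" for v x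
    using that V(2) mem_normalizer_iff[OF subgroup.subset[OF N]] by blast
  have "subgroup ?T G"
  proof (rule subgroupI)
    show "?T \<noteq> {}" using subgroup.one_closed[OF N] subgroup.one_closed[OF V(1)] by blast
  next
    fix t assume "t \<in> ?T"
    then obtain x v where t: "x \<in> N" "v \<in> V" "t = x \<otimes> v" by blast
    then have "inv t = inner (inv v) (inv x) \<otimes> inv v"
      using Nc Vc by (simp add: inner_def inv_mult_group m_assoc)
    then show "inv t \<in> ?T"
      using t inn subgroup.m_inv_closed[OF N] subgroup.m_inv_closed[OF V(1)] by blast
  next
    fix t t' assume "t \<in> ?T" "t' \<in> ?T"
    then obtain x v x' v' where t: "x \<in> N" "v \<in> V" "t = x \<otimes> v" "x' \<in> N" "v' \<in> V" "t' = x' \<otimes> v'"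
      by blast
    then have "t \<otimes> t' = x \<otimes> inner v x' \<otimes> (v \<otimes> v')"
      using Nc Vc by (simp add: inner_def m_assoc inv_l_cancel)
    then show "t \<otimes> t' \<in> ?T"
      using t inn subgroup.m_closed[OF N] subgroup.m_closed[OF V(1)] by blast
  qed (use Nc Vc in auto)
  then have "generate G S \<subseteq> ?T" by (rule generate_subgroup_incl[rotated]) (use S in blast)
  then show ?thesis using g by blast
qed

text \<open>The condition \<open>onto\<close> takes care of inverse letters: the value of the
  inverse of \<open>s\<close> at \<open>a\<close> is read off at a label which \<open>s\<close>
  carries to \<open>a\<close>. As \<open>L\<close> may be infinite, invariance of \<open>L\<close>
  does not give such a label in \<open>L\<close>.\<close>

lemma wreath_hom_invariant:
  assumes h: "group_hom G (wreath M) h" and M: "group M" and S: "S \<subseteq> carrier G"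
    and K: "subgroup K M"
    and inv: "\<And>s a. s \<in> S \<Longrightarrow> a \<in> L \<Longrightarrow> fst (h s a) \<in> K \<and> snd (h s a) \<in> L"
    and onto: "\<And>s a. s \<in> S \<Longrightarrow> a \<in> L \<Longrightarrow> \<exists>a'\<in>L. snd (h s a') = a"
    and g: "g \<in> generate G S" "a \<in> L"
  shows "fst (h g a) \<in> K \<and> snd (h g a) \<in> L"
proof -
  interpret group_hom G "wreath M" h by fact
  note Kc = subgroup.m_closed[OF K] subgroup.m_inv_closed[OF K]
  show ?thesis using g
  proof (induction arbitrary: a rule: generate.induct)
    case one
    then show ?case using subgroup.one_closed[OF K] by (simp add: wreath_simps)
  next
    case (inv s)
    then have s: "s \<in> carrier G" "h s \<in> carrier (wreath M)" using S by auto
    obtain a' where a': "a' \<in> L" "h s a' = (fst (h s a'), a)"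
      using onto[OF inv.hyps inv.prems] by (metis prod.collapse)
    have "h (inv\<^bsub>G\<^esub> s) a = (inv\<^bsub>M\<^esub> fst (h s a'), a')"
      using wreath_inv_apply[OF M s(2) a'(2)] s(1) by simp
    then show ?case using a' assms(5)[OF inv.hyps] Kc by simp
  next
    case (eng g1 g2)
    then show ?case using Kc G.generate_in_carrier[OF S] by (simp add: wreath_simps)
  qed (use assms in auto)
qed

text \<open>The component at the label 1 will invert \<eta>, and the labels record the permutation
  of the strands. The choice operator fixes one of the homomorphisms provided by
  \<open>artin_A_hom_exists\<close>.\<close>

definition monodromy :: "nat \<Rightarrow> (nat \<times> bool) list set \<Rightarrow> nat \<Rightarrow> (nat \<times> bool) list set \<times> nat"
  where "monodromy n = (SOME h. group_hom (artin_A n) (wreath (artin_B n)) h \<and>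
    (\<forall>i\<in>{1..n}. h (sigma n i) = coset_cocycle n i))"

definition delete_strands ::
  "nat \<Rightarrow> (nat \<times> bool) list set \<Rightarrow> nat set \<Rightarrow> (nat \<times> bool) list set \<times> nat set"
  where "delete_strands n = (SOME h. group_hom (artin_A n) (wreath (artin_A n)) h \<and>
    (\<forall>i\<in>{1..n}. h (sigma n i) = strand_cocycle n i))"

text \<open>The permutation of strand positions is read off from the labels; it acts from the right,
  so in a product the left factor is applied first.\<close>

definition perm :: "nat \<Rightarrow> (nat \<times> bool) list set \<Rightarrow> nat \<Rightarrow> nat"
  where "perm n g a = snd (monodromy n g a)"

lemma group_hom_monodromy: "group_hom (artin_A n) (wreath (artin_B n)) (monodromy n)"
  and monodromy_sigma: "i \<in> {1..n} \<Longrightarrow> monodromy n (sigma n i) = coset_cocycle n i"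
proof -
  have "\<exists>h. group_hom (artin_A n) (wreath (artin_B n)) h \<and>
      (\<forall>i\<in>{1..n}. h (sigma n i) = coset_cocycle n i)"
    using type_A_family.artin_A_hom_exists[OF type_A_family_coset_cocycle[of n]]
      group_homI[OF group_artin_A group_wreath[OF group_artin_B]] by blast
  from someI_ex[OF this] show "group_hom (artin_A n) (wreath (artin_B n)) (monodromy n)"
    "i \<in> {1..n} \<Longrightarrow> monodromy n (sigma n i) = coset_cocycle n i"
    unfolding monodromy_def by blast+
qed

lemma group_hom_delete_strands: "group_hom (artin_A n) (wreath (artin_A n)) (delete_strands n)"
  and delete_strands_sigma: "i \<in> {1..n} \<Longrightarrow> delete_strands n (sigma n i) = strand_cocycle n i"
proof -
  have "\<exists>h. group_hom (artin_A n) (wreath (artin_A n)) h \<and>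
      (\<forall>i\<in>{1..n}. h (sigma n i) = strand_cocycle n i)"
    using type_A_family.artin_A_hom_exists[OF type_A_family_strand_cocycle[of n]]
      group_homI[OF group_artin_A group_wreath[OF group_artin_A]] by blast
  from someI_ex[OF this] show "group_hom (artin_A n) (wreath (artin_A n)) (delete_strands n)"
    "i \<in> {1..n} \<Longrightarrow> delete_strands n (sigma n i) = strand_cocycle n i"
    unfolding delete_strands_def by blast+
qed

locale eta_hom =
  fixes n :: nat and \<eta> :: "(nat \<times> bool) list set \<Rightarrow> (nat \<times> bool) list set"
  assumes n_ge_2: "2 \<le> n"
    and eta_hom: "\<eta> \<in> hom (artin_B n) (artin_A n)"
    and eta_tau_1: "\<eta> (tau n 1) = sigma n 1 [^]\<^bsub>artin_A n\<^esub> (2::nat)"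
    and eta_tau: "i \<in> {2..n} \<Longrightarrow> \<eta> (tau n i) = sigma n i"

sublocale eta_hom \<subseteq> A: type_A_family "artin_A n" n "sigma n"
  by (rule type_A_family_sigma)

sublocale eta_hom \<subseteq> B: type_B_family "artin_B n" n "tau n"
  by (rule type_B_family_tau)

sublocale eta_hom \<subseteq> eta: group_hom "artin_B n" "artin_A n" \<eta>
  by unfold_locales (rule eta_hom)

sublocale eta_hom \<subseteq> mono: group_hom "artin_A n" "wreath (artin_B n)" "monodromy n"
  by (rule group_hom_monodromy)

sublocale eta_hom \<subseteq> del: group_hom "artin_A n" "wreath (artin_A n)" "delete_strands n"
  by (rule group_hom_delete_strands)

context eta_hom
begin

abbreviation (input) mult_A (infixl "\<cdot>" 70) where "x \<cdot> y \<equiv> x \<otimes>\<^bsub>artin_A n\<^esub> y"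
abbreviation (input) mult_B (infixl "\<star>" 70) where "x \<star> y \<equiv> x \<otimes>\<^bsub>artin_B n\<^esub> y"
abbreviation (input) inv_A where "inv_A x \<equiv> inv\<^bsub>artin_A n\<^esub> x"
abbreviation (input) inv_B where "inv_B x \<equiv> inv\<^bsub>artin_B n\<^esub> x"
abbreviation "carA \<equiv> carrier (artin_A n)"
abbreviation "carB \<equiv> carrier (artin_B n)"
abbreviation "s \<equiv> sigma n"
abbreviation "t \<equiv> tau n"
abbreviation "parabolic_B a b \<equiv> generate (artin_B n) (t ` {a..b})"

lemma s1 [simp]: "s (Suc 0) \<in> carA" and t1 [simp]: "t (Suc 0) \<in> carB"
  using A.gen_closed[of 1] B.gen_closed[of 1] n_ge_2 by auto

lemma eta_t1: "\<eta> (t 1) = s 1 \<cdot> s 1"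
  using eta_tau_1 by (simp add: numeral_2_eq_2)

subsection \<open>Permutations and injectivity\<close>

lemma perm_simps:
  "perm n \<one>\<^bsub>artin_A n\<^esub> a = a"
  "g \<in> carA \<Longrightarrow> h \<in> carA \<Longrightarrow> perm n (g \<cdot> h) a = perm n h (perm n g a)"
  "i \<in> {1..n} \<Longrightarrow> perm n (s i) a = adj_swap i a"
  by (simp_all add: perm_def wreath_simps monodromy_sigma coset_cocycle_def)

lemma perm_inv [simp]: "g \<in> carA \<Longrightarrow> perm n (inv_A g) (perm n g a) = a"
  using perm_simps(2)[of g "inv_A g" a] by (simp add: perm_simps)

lemma perm_inv' [simp]: "g \<in> carA \<Longrightarrow> perm n g (perm n (inv_A g) a) = a"
  using perm_simps(2)[of "inv_A g" g a] by (simp add: perm_simps)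

lemma perm_stabilizer: "subgroup {g \<in> carA. perm n g a = a} (artin_A n)"
proof (rule A.subgroupI)
  show "{g \<in> carA. perm n g a = a} \<noteq> {}" using perm_simps(1) A.one_closed by blast
  show "inv_A g \<in> {g \<in> carA. perm n g a = a}" if "g \<in> {g \<in> carA. perm n g a = a}" for g
    using that perm_inv[of g a] by auto
qed (auto simp: perm_simps)

lemma carB_generate: "carB = generate (artin_B n) (t ` {1..n})"
  by (rule generate_tau[symmetric])

lemma carA_parabolic: "carA = A.parabolic 1 n"
  by (rule generate_sigma[symmetric])

text \<open>On generators: \<open>\<sigma>\<^sub>1\<^sup>2\<close> takes the label 1 to 2 with
  factor \<open>\<tau>\<^sub>1\<close> and back with trivial factor, while
  \<open>\<sigma>\<^sub>i\<close> with \<open>i \<ge> 2\<close> fixes it with factor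
  \<open>\<tau>\<^sub>i\<close>. This yields the injectivity of \<eta>.\<close>

lemma monodromy_eta:
  assumes "x \<in> carB" shows "monodromy n (\<eta> x) 1 = (x, 1)"
proof -
  have gen: "monodromy n (\<eta> (t i)) 1 = (t i, 1)" if i: "i \<in> {1..n}" for i
  proof (cases "i = 1")
    case True
    have "monodromy n (\<eta> (t 1)) = coset_cocycle n 1 \<otimes>\<^bsub>wreath (artin_B n)\<^esub> coset_cocycle n 1"
      using n_ge_2 monodromy_sigma[of 1 n] unfolding eta_t1 by simp
    then show ?thesis
      unfolding True using n_ge_2 by (simp add: wreath_simps coset_cocycle_def adj_swap_def)
  next
    case False
    then show ?thesis
      using i eta_tau[of i] monodromy_sigma[of i n] by (simp add: coset_cocycle_def adj_swap_def)
  qed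
  have "x \<in> generate (artin_B n) (t ` {1..n})" using assms carB_generate by simp
  then show ?thesis
  proof (induction rule: generate.induct)
    case (incl y)
    then show ?case using gen by blast
  next
    case (inv y)
    then obtain i where i: "i \<in> {1..n}" "y = t i" by auto
    then have "\<eta> (t i) \<in> carA" by simp
    from wreath_inv_apply[OF B.is_group mono.hom_closed[OF this] gen[OF i(1)]]
    show ?case using i by simp
  next
    case (eng y z)
    have "t ` {1..n} \<subseteq> carB" by auto
    then have "y \<in> carB" "z \<in> carB" using eng B.generate_in_carrier by blast+
    then show ?case using eng by (simp add: wreath_simps)
  qed (simp add: wreath_simps)
qed

lemma eta_eq_iff: "x \<in> carB \<Longrightarrow> y \<in> carB \<Longrightarrow> \<eta> x = \<eta> y \<longleftrightarrow> x = y"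
  using monodromy_eta by (metis fst_conv)

lemma perm_eta: "x \<in> carB \<Longrightarrow> perm n (\<eta> x) 1 = 1"
  using monodromy_eta by (simp add: perm_def)

lemma s1_square_neq_one: "s 1 \<cdot> s 1 \<noteq> \<one>\<^bsub>artin_A n\<^esub>"
  using eta_eq_iff[of "t 1" "\<one>\<^bsub>artin_B n\<^esub>"] tau_1_neq_one[of n] n_ge_2 eta_t1 by simp

subsection \<open>Parabolic subgroups and the image of \<open>\<eta>\<close>\<close>

lemma perm_rep: "1 \<le> m \<Longrightarrow> m \<le> j \<Longrightarrow> j \<le> n + 1 \<Longrightarrow> perm n (A.rep m j) m = j"
proof (induction j)
  case (Suc j)
  show ?case
  proof (cases "m = Suc j")
    case False
    then show ?thesis using Suc by (simp add: perm_simps adj_swap_def)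
  qed (simp add: perm_simps)
qed simp

lemma perm_square_parabolic:
  assumes "1 \<le> m" "m \<le> n" "b \<le> n" "g \<in> A.square_parabolic m b" shows "perm n g m = m"
proof -
  have "A.square_parabolic m b \<subseteq> {g \<in> carA. perm n g m = m}"
    by (rule A.generate_subgroup_incl[OF _ perm_stabilizer])
      (use assms in \<open>auto simp: perm_simps adj_swap_def\<close>)
  then show ?thesis using assms by blast
qed

text \<open>In a decomposition of \<open>g\<close> by \<open>parabolic_cosets\<close> the first
  factor fixes \<open>m\<close> and the representative carries \<open>m\<close> to \<open>j\<close>;
  so \<open>j = m\<close> and the representative is trivial.\<close>

lemma parabolic_fixing:
  assumes "1 \<le> m" "m \<le> n" "b \<le> n" "m \<le> b + 1" "g \<in> A.parabolic m b" "perm n g m = m"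
  shows "g \<in> A.square_parabolic m b"
proof -
  obtain h j where h: "h \<in> A.square_parabolic m b" "j \<in> {m..b + 1}" "g = h \<cdot> A.rep m j"
    using A.parabolic_cosets assms by blast
  have hc: "h \<in> carA"
    by (rule A.generate_in_carrier[OF A.square_gens_closed h(1)]) (use assms in auto)
  have "perm n g m = j"
    using h perm_rep[of m j] perm_square_parabolic[OF assms(1-3) h(1)] assms hc
    by (simp add: perm_simps)
  then show ?thesis using h hc assms by simp
qed

lemma eta_image_parabolic:
  assumes "2 \<le> a" "b \<le> n" shows "\<eta> ` parabolic_B a b = A.parabolic a b"
proof -
  have "\<eta> ` t ` {a..b} = s ` {a..b}"
    unfolding image_image using assms eta_tau by (intro image_cong) auto
  moreover have "t ` {a..b} \<subseteq> carB" using assms by auto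
  ultimately show ?thesis using eta.generate_img by metis
qed

lemma eta_image_parabolic_1:
  assumes "1 \<le> b" "b \<le> n" shows "\<eta> ` parabolic_B 1 b = A.square_parabolic 1 b"
proof -
  have "{1..b} = insert 1 {Suc 1..b}" using assms by auto
  then have "\<eta> ` t ` {1..b} = insert (\<eta> (t 1)) (\<eta> ` t ` {Suc 1..b})" by simp
  also have "\<eta> ` t ` {Suc 1..b} = s ` {Suc 1..b}"
    unfolding image_image using assms eta_tau by (intro image_cong) auto
  finally have "\<eta> ` t ` {1..b} = insert (s 1 \<cdot> s 1) (s ` {Suc 1..b})" using eta_t1 by simp
  moreover have "t ` {1..b} \<subseteq> carB" using assms by auto
  ultimately show ?thesis using eta.generate_img by metis
qed

lemma parabolic_B_closed: "1 \<le> a \<Longrightarrow> b \<le> n \<Longrightarrow> x \<in> parabolic_B a b \<Longrightarrow> x \<in> carB"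
  by (rule B.generate_in_carrier[of "t ` {a..b}"]) auto

lemma parabolic_closed: "1 \<le> a \<Longrightarrow> b \<le> n \<Longrightarrow> x \<in> A.parabolic a b \<Longrightarrow> x \<in> carA"
  by (rule A.generate_in_carrier[of "s ` {a..b}"]) auto

text \<open>For \<open>a \<ge> 2\<close> the generators correspond. For \<open>a = 1\<close>, the
  braid \<open>\<eta> x\<close> fixes the first strand, so \<open>parabolic_fixing\<close> puts it
  into the image of \<open>parabolic_B 1 b\<close>, and \<eta> is injective.\<close>

lemma eta_mem_parabolic_iff:
  assumes "1 \<le> a" "a \<le> b" "b \<le> n" "x \<in> carB"
  shows "\<eta> x \<in> A.parabolic a b \<longleftrightarrow> x \<in> parabolic_B a b"
proof -
  have sq: "A.square_parabolic 1 b \<subseteq> A.parabolic 1 b"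
  proof (rule A.generate_subgroup_incl[OF _ A.generate_is_subgroup])
    have "s i \<in> A.parabolic 1 b" if "i \<in> {1..b}" for i using that by (auto intro: generate.incl)
    then show "insert (s 1 \<cdot> s 1) (s ` {Suc 1..b}) \<subseteq> A.parabolic 1 b"
      using assms by (auto intro: generate.eng)
  qed (use assms in auto)
  have "\<eta> x \<in> \<eta> ` parabolic_B a b" if "\<eta> x \<in> A.parabolic a b"
  proof (cases "a = 1")
    case True
    have b: "1 \<le> b" "1 \<le> n" "1 \<le> b + 1" using assms True by auto
    have "\<eta> x \<in> A.square_parabolic 1 b"
      using parabolic_fixing[OF _ b(2) assms(3) b(3)] that perm_eta[OF assms(4)] True by blast
    then show ?thesis unfolding True eta_image_parabolic_1[OF b(1) assms(3)] .
  next
    case False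
    then have "2 \<le> a" using assms by simp
    then show ?thesis using that eta_image_parabolic[OF _ assms(3), of a] by blast
  qed
  moreover have "\<eta> ` parabolic_B a b \<subseteq> A.parabolic a b"
  proof (cases "a = 1")
    case True
    then have "1 \<le> b" using assms by simp
    then show ?thesis using sq unfolding True by (subst eta_image_parabolic_1[OF _ assms(3)])
  next
    case False
    then have "2 \<le> a" using assms by simp
    then show ?thesis using eta_image_parabolic[OF _ assms(3), of a] by blast
  qed
  ultimately show ?thesis using eta_eq_iff[OF assms(4)] parabolic_B_closed[OF assms(1,3)] by blast
qed

subsection \<open>The centralizer of the square of a generator\<close>

lemma snd_delete_strands:
  assumes "g \<in> carA" shows "snd (delete_strands n g S) = perm n g ` S"
  using assms unfolding carA_parabolic
proof (induction arbitrary: S rule: generate.induct)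
  case (incl y)
  then obtain i where i: "i \<in> {1..n}" "y = s i" by auto
  then have "perm n (s i) = adj_swap i" by (simp add: fun_eq_iff perm_simps)
  then show ?case using i by (simp add: delete_strands_sigma strand_cocycle_def)
next
  case (inv y S)
  then obtain i where i: "i \<in> {1..n}" "y = s i" by auto
  have d: "delete_strands n (s i) (adj_swap i ` S) = (fst (delete_strands n (s i) (adj_swap i ` S)), S)"
    using i by (simp add: delete_strands_sigma strand_cocycle_def image_image)
  have c: "delete_strands n (s i) \<in> carrier (wreath (artin_A n))" using i by simp
  have "snd (delete_strands n (inv_A (s i)) S) = adj_swap i ` S"
    using wreath_inv_apply[OF A.is_group c d] i by simp
  moreover have "perm n (inv_A (s i)) = adj_swap i"
  proof
    show "perm n (inv_A (s i)) a = adj_swap i a" for a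
      using perm_inv[of "s i" "adj_swap i a", unfolded perm_simps(3)[OF i(1)]] i by simp
  qed
  ultimately show ?case by (simp only: i(2))
next
  case (eng y z S)
  have "s ` {1..n} \<subseteq> carA" by auto
  then have "y \<in> carA" "z \<in> carA" using eng.hyps by (simp_all add: A.generate_in_carrier)
  moreover from this have "perm n (y \<cdot> z) ` S = perm n z ` perm n y ` S"
    by (simp add: perm_simps image_image)
  ultimately show ?case using eng.IH by (simp add: wreath_simps)
next
  case (one S)
  have "perm n \<one>\<^bsub>artin_A n\<^esub> = (\<lambda>a. a)" by (simp add: fun_eq_iff perm_simps)
  then show ?case by (simp add: wreath_simps)
qed

lemma fst_delete_strands_closed: "g \<in> carA \<Longrightarrow> fst (delete_strands n g S) \<in> carA"
  using del.hom_closed[of g] by (simp add: wreath_simps)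

lemma delete_strands_mult:
  "g \<in> carA \<Longrightarrow> h \<in> carA \<Longrightarrow> fst (delete_strands n (g \<cdot> h) S) =
    fst (delete_strands n g S) \<cdot> fst (delete_strands n h (perm n g ` S))"
  by (simp add: wreath_simps snd_delete_strands)

lemma delete_strands_parabolic:
  assumes "b \<le> n" "g \<in> A.parabolic 1 b" shows "delete_strands n g {1..Suc b} = (g, {1..Suc b})"
proof -
  have s: "delete_strands n (s i) {1..Suc b} = (s i, {1..Suc b})" if "i \<in> {1..b}" for i
  proof -
    have "adj_swap i ` {1..Suc b} = {1..Suc b}"
      using that by (auto simp: mem_adj_swap_image set_eq_iff adj_swap_def)
    moreover have "{1..Suc b} \<inter> {0<..<i} = {0<..<i}" using that by auto
    ultimately show ?thesis using that assms(1) by (simp add: delete_strands_sigma strand_cocycle_def)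
  qed
  show ?thesis using assms(2)
  proof (induction rule: generate.induct)
    case (inv y)
    then obtain i where i: "i \<in> {1..b}" "y = s i" by auto
    then have "s i \<in> carA" using assms by simp
    then have "(inv\<^bsub>wreath (artin_A n)\<^esub> delete_strands n (s i)) {1..Suc b} = (inv_A (s i), {1..Suc b})"
      using wreath_inv_apply[OF A.is_group del.hom_closed s[OF i(1)]] by simp
    then show ?case using \<open>s i \<in> carA\<close> i by simp
  next
    case (eng y z)
    then have "y \<in> carA" "z \<in> carA" using parabolic_closed assms(1) by auto
    then show ?case using eng by (simp add: wreath_simps)
  qed (use s in \<open>auto simp: wreath_simps\<close>)
qed

lemma fst_delete_strands_in_parabolic:
  assumes "g \<in> carA" "finite S" "card S = Suc b" "b \<le> n"
  shows "fst (delete_strands n g S) \<in> A.parabolic 1 b"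
proof -
  have "fst (delete_strands n g S) \<in> A.parabolic 1 b \<and>
      snd (delete_strands n g S) \<in> {S. finite S \<and> card S = Suc b}"
  proof (rule wreath_hom_invariant[OF group_hom_delete_strands A.is_group])
    show "subgroup (A.parabolic 1 b) (artin_A n)"
      using assms by (intro A.generate_is_subgroup) auto
    show "g \<in> A.parabolic 1 n" using assms carA_parabolic by simp
  next
    fix x and S :: "nat set" assume "x \<in> s ` {1..n}" and S: "S \<in> {S. finite S \<and> card S = Suc b}"
    then obtain i where i: "i \<in> {1..n}" "x = s i" by auto
    have c: "card (adj_swap i ` S) = card S"
      by (simp add: card_image inj_on_subset[OF bij_is_inj[OF bij_adj_swap]])
    show "\<exists>S'\<in>{S. finite S \<and> card S = Suc b}. snd (delete_strands n x S') = S"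
      using S i c by (intro bexI[of _ "adj_swap i ` S"])
        (auto simp: delete_strands_sigma strand_cocycle_def image_image)
    \<comment> \<open>The strands at \<open>i\<close> and \<open>i + 1\<close> come in addition to
      those counted by the rank, and \<open>S\<close> has only \<open>b + 1\<close>
      elements.\<close>
    have "Suc (card (S \<inter> {0<..<i})) \<le> b" if "i \<in> S" "Suc i \<in> S"
    proof -
      have "card (insert i (insert (Suc i) (S \<inter> {0<..<i}))) \<le> card S"
        using S that by (intro card_mono) auto
      then show ?thesis using S by simp
    qed
    then show "fst (delete_strands n x S) \<in> A.parabolic 1 b \<and>
        snd (delete_strands n x S) \<in> {S. finite S \<and> card S = Suc b}"
      using S i c by (auto simp: delete_strands_sigma strand_cocycle_def intro: generate.incl generate.one)
  qed (use assms in auto)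
  then show ?thesis by blast
qed

lemma delete_strands_s1_square:
  "fst (delete_strands n (s 1 \<cdot> s 1) S) = (if 1 \<in> S \<and> 2 \<in> S then s 1 \<cdot> s 1 else \<one>\<^bsub>artin_A n\<^esub>)"
proof -
  have e: "{0<..<Suc 0} = {}" by auto
  have "fst (delete_strands n (s 1 \<cdot> s 1) S) =
      fst (delete_strands n (s 1) S) \<cdot> fst (delete_strands n (s 1) (adj_swap 1 ` S))"
    using n_ge_2 perm_simps(3)[of 1] by (subst delete_strands_mult) (simp_all cong: image_cong)
  also have "\<dots> = (if 1 \<in> S \<and> 2 \<in> S then s 1 \<cdot> s 1 else \<one>\<^bsub>artin_A n\<^esub>)"
  proof -
    define X where "X = adj_swap 1 ` S"
    have X: "Suc 0 \<in> X \<longleftrightarrow> Suc (Suc 0) \<in> S" "Suc (Suc 0) \<in> X \<longleftrightarrow> Suc 0 \<in> S"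
      unfolding X_def mem_adj_swap_image by (simp_all add: adj_swap_def)
    have 1: "fst (delete_strands n (s 1) Y) =
        (if Suc 0 \<in> Y \<and> Suc (Suc 0) \<in> Y then s 1 else \<one>\<^bsub>artin_A n\<^esub>)" for Y
      using n_ge_2 e by (simp add: delete_strands_sigma strand_cocycle_def)
    show ?thesis unfolding X_def[symmetric] 1 X numeral_2_eq_2 by simp
  qed
  finally show ?thesis .
qed

text \<open>Each loop is a conjugate of \<open>\<tau>\<^sub>1\<close>, whose image
  \<open>\<sigma>\<^sub>1\<^sup>2\<close> is a pure braid.\<close>

lemma perm_eta_loop:
  assumes "x \<in> B.loop_subgroup" shows "perm n (\<eta> x) a = a"
proof -
  have loop: "perm n (\<eta> (B.loop j)) a = a" if "1 \<le> j" "j \<le> n" for j a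
    using that
  proof (induction j arbitrary: a rule: nat_induct_at_least)
    case base
    then show ?case using eta_t1 by (simp add: perm_simps)
  next
    case (Suc j)
    then have "\<eta> (B.loop (Suc j)) = \<eta> (t (Suc j)) \<cdot> \<eta> (B.loop j) \<cdot> inv_A (\<eta> (t (Suc j)))"
      by (simp add: B.loop_Suc B.inner_def)
    then show ?case using Suc by (simp add: perm_simps)
  qed
  show ?thesis using assms
  proof (induction rule: generate.induct)
    case (inv y)
    then obtain j where j: "j \<in> {1..n}" "y = B.loop j" by auto
    then show ?case using perm_inv[of "\<eta> (B.loop j)" a] loop[of j] by simp
  next
    case (eng y z)
    then have "y \<in> carB" "z \<in> carB" using B.generate_in_carrier[OF B.loops_closed] by auto
    then show ?case using eng by (simp add: perm_simps)
  qed (use loop in \<open>auto simp: perm_simps\<close>)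
qed

end

section \<open>Braids commuting with the square of the first generator\<close>

lemma pair_image_cases:
  assumes "{1, 2} \<subseteq> p ` {1, 2::nat}" shows "p 1 = (1::nat) \<and> p 2 = 2 \<or> p 1 = 2 \<and> p 2 = 1"
  using assms by auto

text \<open>Both \<open>p\<close> and \<open>y\<close> conjugate \<open>q\<close> to
  \<open>r\<close>, so their quotient centralizes \<open>q\<close>.\<close>

lemma (in group) commute_quotient:
  assumes "p \<otimes> q = r \<otimes> p" "y \<otimes> q = r \<otimes> y"
    and c: "p \<in> carrier G" "q \<in> carrier G" "r \<in> carrier G" "y \<in> carrier G"
  shows "inv p \<otimes> y \<otimes> q = q \<otimes> (inv p \<otimes> y)"
proof -
  have "inv p \<otimes> (r \<otimes> p) \<otimes> inv p = inv p \<otimes> (p \<otimes> q) \<otimes> inv p" by (simp only: assms(1))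
  then have pr: "inv p \<otimes> r = q \<otimes> inv p" using c by (simp add: m_assoc inv_l_cancel)
  have "inv p \<otimes> y \<otimes> q = inv p \<otimes> (r \<otimes> y)" using c by (simp add: m_assoc assms(2))
  also have "\<dots> = inv p \<otimes> r \<otimes> y" using c by (simp add: m_assoc)
  also have "\<dots> = q \<otimes> (inv p \<otimes> y)" using c by (simp add: pr) (simp add: m_assoc)
  finally show ?thesis .
qed

lemma (in group) mult_if_one_cases:
  assumes "q \<otimes> p = p \<otimes> (if C then x else \<one>)" "q \<noteq> \<one>" "q \<in> carrier G" "p \<in> carrier G"
  shows C
proof (rule ccontr)
  assume "\<not> C"
  then have "q \<otimes> p = \<one> \<otimes> p" using assms by simp
  then show False using assms(2-4) using right_cancel[of p q "\<one>"] by simp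
qed

context eta_hom
begin

text \<open>The product decomposition of type B into the normal subgroup of loops and the braid
  group generated by \<open>\<tau>\<^sub>2, \<dots>, \<tau>\<^sub>n\<close>, which normalizes
  it.\<close>

lemma carB_decomposition:
  assumes "y \<in> carB" shows "\<exists>x\<in>B.loop_subgroup. \<exists>v\<in>parabolic_B 2 n. y = x \<star> v"
proof (rule B.generate_subset_product)
  show "subgroup B.loop_subgroup (artin_B n)" by (intro B.generate_is_subgroup B.loops_closed)
  show "subgroup (parabolic_B 2 n) (artin_B n)" by (intro B.generate_is_subgroup) auto
  have "parabolic_B 2 n \<subseteq> parabolic_B 1 n" by (intro B.mono_generate) auto
  then show "parabolic_B 2 n \<subseteq> normalizer (artin_B n) B.loop_subgroup"
    using B.loop_subgroup_normalized by auto
  show "y \<in> parabolic_B 1 n" using assms carB_generate by simp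
  show "\<exists>x\<in>B.loop_subgroup. \<exists>v\<in>parabolic_B 2 n. g = x \<star> v" if "g \<in> t ` {1..n}" for g
  proof -
    obtain i where i: "i \<in> {1..n}" "g = t i" using \<open>g \<in> t ` {1..n}\<close> by auto
    show ?thesis
    proof (cases "i = 1")
      case True
      have "B.loop 1 \<in> B.loop ` {1..n}" using n_ge_2 by (intro imageI) auto
      then have "t 1 \<in> B.loop_subgroup" using generate.incl[of "B.loop 1" _ "artin_B n"] by simp
      moreover have "g = t 1 \<star> \<one>\<^bsub>artin_B n\<^esub>" using i True by simp
      ultimately show ?thesis using generate.one by blast
    next
      case False
      then have "t i \<in> parabolic_B 2 n" using i by (auto intro: generate.incl)
      moreover have "g = \<one>\<^bsub>artin_B n\<^esub> \<star> t i" using i by simp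
      ultimately show ?thesis using generate.one by blast
    qed
  qed
qed

text \<open>As \<open>\<tau>\<^sub>2\<^sup>2\<close> is the inverse of \<open>loop 2\<close> times
  \<open>\<tau>\<^sub>2 \<tau>\<^sub>1 \<tau>\<^sub>2\<close>, it can be exchanged, modulo loops,
  for an element whose image commutes with \<open>\<sigma>\<^sub>1\<close>.\<close>

lemma square_decomposition:
  assumes "y \<in> generate (artin_B n) (insert (t 2 \<star> t 2) (t ` {3..n}))"
  shows "\<exists>x\<in>B.loop_subgroup. \<exists>c\<in>generate (artin_B n) (insert (t 2 \<star> t 1 \<star> t 2) (t ` {3..n})). y = x \<star> c"
    (is "\<exists>x\<in>_. \<exists>c\<in>?C. _")
proof (rule B.generate_subset_product)
  have t: "t 1 \<in> carB" "t 2 \<in> carB" using n_ge_2 by auto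
  then have Cc: "insert (t 2 \<star> t 1 \<star> t 2) (t ` {3..n}) \<subseteq> carB" by auto
  show "subgroup B.loop_subgroup (artin_B n)" by (intro B.generate_is_subgroup B.loops_closed)
  show "subgroup ?C (artin_B n)" by (intro B.generate_is_subgroup Cc)
  show "?C \<subseteq> normalizer (artin_B n) B.loop_subgroup"
    using B.loop_subgroup_normalized B.generate_in_carrier[OF Cc] carB_generate by auto
  show "y \<in> generate (artin_B n) (insert (t 2 \<star> t 2) (t ` {3..n}))" by fact
  show "\<exists>x\<in>B.loop_subgroup. \<exists>c\<in>?C. g = x \<star> c" if "g \<in> insert (t 2 \<star> t 2) (t ` {3..n})" for g
  proof (cases "g = t 2 \<star> t 2")
    case True
    have "B.loop 2 = B.inner (t 2) (t 1)" using B.loop_Suc[of 1] by (simp add: numeral_2_eq_2)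
    moreover have "B.loop 2 \<in> B.loop_subgroup" using n_ge_2 by (auto intro: generate.incl)
    ultimately have "inv_B (B.inner (t 2) (t 1)) \<in> B.loop_subgroup"
      using B.generate_m_inv_closed[OF B.loops_closed] by simp
    moreover have "g = inv_B (B.inner (t 2) (t 1)) \<star> (t 2 \<star> t 1 \<star> t 2)"
      using True t by (simp add: B.inner_def B.m_assoc B.inv_mult_group B.inv_l_cancel B.inv_r_cancel)
    ultimately show ?thesis by (blast intro: generate.incl)
  next
    case False
    then have g: "g \<in> ?C" "g \<in> carB" using that by (auto intro: generate.incl)
    then have "g = \<one>\<^bsub>artin_B n\<^esub> \<star> g" by simp
    then show ?thesis using g generate.one by blast
  qed
qed

text \<open>Modulo the free normal subgroup, \<open>g\<close> lies in the group generated by \<open>\<sigma>\<^sub>2\<sigma>\<^sub>1\<^sup>2\<sigma>\<^sub>2\<close> and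
  \<open>\<sigma>\<^sub>3, \<dots>, \<sigma>\<^sub>n\<close>, which centralizes \<open>\<sigma>\<^sub>1\<close>; the free factor then commutes with the free generator
  \<open>\<sigma>\<^sub>1\<^sup>2\<close>, so it is a power of it.\<close>

lemma commute_s1_square_pure:
  assumes g: "g \<in> carA" "g \<cdot> (s 1 \<cdot> s 1) = s 1 \<cdot> s 1 \<cdot> g" "perm n g 1 = 1" "perm n g 2 = 2"
  shows "g \<cdot> s 1 = s 1 \<cdot> g"
proof -
  let ?C = "insert (t 2 \<star> t 1 \<star> t 2) (t ` {3..n})"
  have t: "t 1 \<in> carB" "t 2 \<in> carB" using n_ge_2 by auto
  then have Cc: "?C \<subseteq> carB" by auto
  have "g \<in> A.square_parabolic 1 n"
    using parabolic_fixing[of 1 n g] g n_ge_2 carA_parabolic by simp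
  then have "g \<in> \<eta> ` carB"
    using eta_image_parabolic_1[of n] n_ge_2 unfolding carB_generate by simp
  then obtain y where y: "y \<in> carB" "g = \<eta> y" by blast
  obtain x v where xv: "x \<in> B.loop_subgroup" "v \<in> parabolic_B 2 n" "y = x \<star> v"
    using carB_decomposition[OF y(1)] by blast
  have xvc: "x \<in> carB" "v \<in> carB"
    using xv B.generate_in_carrier[OF B.loops_closed] parabolic_B_closed[of 2 n] by auto
  \<comment> \<open>Loops map to pure braids, so \<open>v\<close> alone determines where strand 2
    goes. Hence \<open>\<eta> v\<close>, a word in
    \<open>\<sigma>\<^sub>2, \<dots>, \<sigma>\<^sub>n\<close>, fixes strand 2, and the coset
    argument applies again with base strand 2.\<close>
  have "perm n g 2 = perm n (\<eta> v) 2" using y xv xvc perm_eta_loop[OF xv(1)] by (simp add: perm_simps)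
  moreover have "\<eta> v \<in> A.parabolic 2 n" using eta_image_parabolic[of 2 n] xv by auto
  ultimately have "\<eta> v \<in> A.square_parabolic 2 n" using parabolic_fixing[of 2 n "\<eta> v"] g n_ge_2 by simp
  moreover have "A.square_parabolic 2 n = \<eta> ` generate (artin_B n) (insert (t 2 \<star> t 2) (t ` {3..n}))"
  proof -
    have "\<eta> ` t ` {3..n} = s ` {3..n}"
      unfolding image_image using eta_tau by (intro image_cong) auto
    moreover have "\<eta> (t 2 \<star> t 2) = s 2 \<cdot> s 2" using t eta_tau[of 2] n_ge_2 by simp
    ultimately have "\<eta> ` insert (t 2 \<star> t 2) (t ` {3..n}) = insert (s 2 \<cdot> s 2) (s ` {Suc 2..n})"
      by (simp add: numeral_3_eq_3 numeral_2_eq_2)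
    moreover have "insert (t 2 \<star> t 2) (t ` {3..n}) \<subseteq> carB" using t by auto
    ultimately show ?thesis using eta.generate_img by metis
  qed
  moreover have "generate (artin_B n) (insert (t 2 \<star> t 2) (t ` {3..n})) \<subseteq> carB"
    using t by (intro B.generate_incl) auto
  ultimately obtain w where w: "w \<in> generate (artin_B n) (insert (t 2 \<star> t 2) (t ` {3..n}))"
    "w \<in> carB" "\<eta> v = \<eta> w"
    by blast
  then have "v \<in> generate (artin_B n) (insert (t 2 \<star> t 2) (t ` {3..n}))"
    using eta_eq_iff[OF xvc(2)] by simp
  then obtain x' c where c: "x' \<in> B.loop_subgroup" "c \<in> generate (artin_B n) ?C" "v = x' \<star> c"
    using square_decomposition by blast
  have xc: "x' \<in> carB" "c \<in> carB"
    using c B.generate_in_carrier[OF B.loops_closed] B.generate_in_carrier[OF Cc] by auto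
  define z where "z = x \<star> x'"
  have z: "z \<in> B.loop_subgroup" "z \<in> carB" "g = \<eta> z \<cdot> \<eta> c"
    using xv c xvc xc y generate.eng[OF xv(1) c(1)] by (simp_all add: z_def B.m_assoc A.m_assoc)
  have s: "s 1 \<in> carA" "s 2 \<in> carA" using n_ge_2 by auto
  have cs: "s 1 \<cdot> \<eta> c = \<eta> c \<cdot> s 1"
  proof -
    have 1: "\<eta> c \<in> generate (artin_A n) (\<eta> ` ?C)" using eta.generate_img[OF Cc] c(2) by auto
    have 2: "\<eta> ` ?C \<subseteq> carA" using Cc by auto
    have "s 1 \<cdot> u = u \<cdot> s 1" if "u \<in> \<eta> ` ?C" for u
    proof -
      consider "u = \<eta> (t 2 \<star> t 1 \<star> t 2)" | i where "i \<in> {3..n}" "u = \<eta> (t i)" using \<open>u \<in> \<eta> ` ?C\<close> by auto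
      then show ?thesis
      proof cases
        case 1
        then have u: "u = s 2 \<cdot> (s 1 \<cdot> (s 1 \<cdot> s 2))"
          using t s eta_t1 eta_tau[of 2] n_ge_2 by (simp add: A.m_assoc)
        have br: "s 1 \<cdot> (s 2 \<cdot> s 1) = s 2 \<cdot> (s 1 \<cdot> s 2)" using A.gen_braid_1 n_ge_2 by simp
        have "s 1 \<cdot> u = s 1 \<cdot> (s 2 \<cdot> s 1) \<cdot> (s 1 \<cdot> s 2)" unfolding u using s by (simp add: A.m_assoc)
        also have "\<dots> = s 2 \<cdot> (s 1 \<cdot> (s 2 \<cdot> (s 1 \<cdot> s 2)))" unfolding br using s by (simp add: A.m_assoc)
        also have "\<dots> = s 2 \<cdot> (s 1 \<cdot> (s 1 \<cdot> (s 2 \<cdot> s 1)))" by (simp only: br)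
        also have "\<dots> = u \<cdot> s 1" unfolding u using s by (simp add: A.m_assoc)
        finally show ?thesis .
      next
        case 2
        then show ?thesis using eta_tau[of i] A.gen_commute[of 1 i] by simp
      qed
    qed
    then show ?thesis by (rule A.commute_generate[OF 1 2 s(1)])
  qed
  have etac: "\<eta> c \<in> carA" "\<eta> z \<in> carA" using xc z by auto
  have "s 1 \<cdot> s 1 \<cdot> \<eta> c = \<eta> c \<cdot> (s 1 \<cdot> s 1)" 
    using A.commute_mult[OF cs[symmetric] cs[symmetric]] s etac by simp
  then have "\<eta> z \<cdot> (s 1 \<cdot> s 1) \<cdot> \<eta> c = s 1 \<cdot> s 1 \<cdot> \<eta> z \<cdot> \<eta> c"
    using g(2) z s etac by (simp add: A.m_assoc)
  then have "\<eta> z \<cdot> (s 1 \<cdot> s 1) = s 1 \<cdot> s 1 \<cdot> \<eta> z" using s etac by simp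
  then have "\<eta> (t 1 \<star> z) = \<eta> (z \<star> t 1)"
    unfolding eta.hom_mult[OF z(2) t(1)] eta.hom_mult[OF t(1) z(2)] eta_t1 by (rule sym)
  then have "t 1 \<star> z = z \<star> t 1"
    by (subst (asm) eta_eq_iff) (use z(2) t(1) in \<open>simp_all only: B.m_closed\<close>)
  then have "z \<in> generate (artin_B n) {t 1}" using loop_subgroup_centralizer[OF _ z(1)] n_ge_2 by simp
  then have "\<eta> z \<in> generate (artin_A n) {s 1 \<cdot> s 1}" using eta.generate_img[of "{t 1}"] t eta_t1 by auto
  then have "s 1 \<cdot> \<eta> z = \<eta> z \<cdot> s 1" 
    by (rule A.commute_generate) (use s in \<open>simp_all add: A.m_assoc\<close>)
  then show ?thesis unfolding z(3) using A.commute_mult[OF _ cs] etac s by simp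
qed

text \<open>Deleting all strands but the first two shows that \<open>g\<close> preserves the pair of these strands.\<close>

lemma commute_s1_square:
  assumes g: "g \<in> carA" "g \<cdot> (s 1 \<cdot> s 1) = s 1 \<cdot> s 1 \<cdot> g"
  shows "g \<cdot> s 1 = s 1 \<cdot> g"
proof -
  let ?S = "{1, 2::nat}"
  have s: "s 1 \<in> carA" by simp
  have del: "fst (delete_strands n g ?S) \<in> carA" using fst_delete_strands_closed g by simp
  have swap: "adj_swap 1 1 = 2" "adj_swap 1 2 = 1" by (auto simp: adj_swap_def)
  have pq: "perm n (s 1 \<cdot> s 1) a = a" for a using n_ge_2 by (simp add: perm_simps)
  have q: "s 1 \<cdot> s 1 \<in> carA" by simp
  have "perm n (s 1 \<cdot> s 1) ` ?S = ?S" using pq by (simp only: image_insert image_empty)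
  moreover have "fst (delete_strands n (s 1 \<cdot> s 1) ?S) = s 1 \<cdot> s 1"
    by (simp only: delete_strands_s1_square) simp
  ultimately have "fst (delete_strands n (s 1 \<cdot> s 1 \<cdot> g) ?S) = s 1 \<cdot> s 1 \<cdot> fst (delete_strands n g ?S)"
    by (simp only: delete_strands_mult[OF q g(1)])
  moreover have "fst (delete_strands n (g \<cdot> (s 1 \<cdot> s 1)) ?S) = fst (delete_strands n g ?S) \<cdot>
      (if 1 \<in> perm n g ` ?S \<and> 2 \<in> perm n g ` ?S then s 1 \<cdot> s 1 else \<one>\<^bsub>artin_A n\<^esub>)"
    by (simp only: delete_strands_mult[OF g(1) q] delete_strands_s1_square)
  ultimately have "s 1 \<cdot> s 1 \<cdot> fst (delete_strands n g ?S) = fst (delete_strands n g ?S) \<cdot>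
      (if 1 \<in> perm n g ` ?S \<and> 2 \<in> perm n g ` ?S then s 1 \<cdot> s 1 else \<one>\<^bsub>artin_A n\<^esub>)"
    by (simp only: g(2))
  \<comment> \<open>If the pair of strands were not preserved, the commutation would turn after
    deletion into the triviality of \<open>\<sigma>\<^sub>1\<^sup>2\<close>.\<close>
  from A.mult_if_one_cases[OF this s1_square_neq_one q del]
  have "{1, 2} \<subseteq> perm n g ` ?S" by blast
  then consider "perm n g 1 = 1" "perm n g 2 = 2" | "perm n g 1 = 2" "perm n g 2 = 1"
    using pair_image_cases by blast
  then show ?thesis
  proof cases
    case 1
    then show ?thesis using commute_s1_square_pure g by blast
  next
    case 2
    \<comment> \<open>If \<open>g\<close> exchanges the two strands, then
      \<open>g \<cdot> s 1\<close> fixes both of them and still commutes with the square.\<close>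
    have "g \<cdot> s 1 \<cdot> (s 1 \<cdot> s 1) = s 1 \<cdot> s 1 \<cdot> (g \<cdot> s 1)"
      using g s by (metis A.m_assoc A.m_closed)
    then have "g \<cdot> s 1 \<cdot> s 1 = s 1 \<cdot> (g \<cdot> s 1)"
      using 2 g s swap n_ge_2 by (intro commute_s1_square_pure) (auto simp: perm_simps)
    then have "g \<cdot> s 1 \<cdot> s 1 = s 1 \<cdot> g \<cdot> s 1" using g s by (simp add: A.m_assoc)
    then show ?thesis using g s by simp
  qed
qed

subsection \<open>Normalizers\<close>

text \<open>Deleting the strands beyond the first \<open>b + 1\<close> replaces \<open>\<eta> y\<close> by some \<open>p\<close> in the parabolic subgroup
  which conjugates \<open>\<sigma>\<^sub>1\<^sup>2\<close> to the same element.\<close>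

lemma inner_eta_s1:
  assumes b: "1 \<le> b" "b \<le> n" and y: "y \<in> carB" "B.inner y (t 1) \<in> parabolic_B 1 b"
  shows "A.inner (\<eta> y) (s 1) \<in> A.parabolic 1 b"
proof -
  let ?S = "{1..Suc b}"
  define r where "r = A.inner (\<eta> y) (s 1 \<cdot> s 1)"
  define p where "p = fst (delete_strands n (\<eta> y) ?S)"
  have s: "s 1 \<in> carA" "\<eta> y \<in> carA" using y by auto
  then have q: "s 1 \<cdot> s 1 \<in> carA" by blast
  have sub: "subgroup (A.parabolic 1 b) (artin_A n)"
    using b by (intro A.generate_is_subgroup) auto
  have p: "p \<in> A.parabolic 1 b" unfolding p_def
    by (rule fst_delete_strands_in_parabolic) (use y b in auto)
  then have pc: "p \<in> carA" by (rule subgroup.mem_carrier[OF sub])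
  have t1: "t 1 \<in> carB" by simp
  have "r = \<eta> (B.inner y (t 1))" unfolding r_def eta.hom_inner[OF y(1) t1] eta_t1 ..
  then have r: "r \<in> A.parabolic 1 b"
    using eta_mem_parabolic_iff[OF order_refl b(1,2) B.inner_closed[OF y(1) t1]] y(2) by blast
  then have rc: "r \<in> carA" by (rule subgroup.mem_carrier[OF sub])
  have yq: "\<eta> y \<cdot> (s 1 \<cdot> s 1) = r \<cdot> \<eta> y"
    using A.inner_eq_iff[OF s(2) q rc] r_def by blast
  \<comment> \<open>As a braid on the first \<open>b + 1\<close> strands, \<open>r\<close> is
    unchanged by the deletion, so \<open>yq\<close> becomes an equation between \<open>r\<close> and
    \<open>p\<close>.\<close>
  have dr: "delete_strands n r ?S = (r, ?S)" using delete_strands_parabolic[OF b(2) r] .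
  then have "perm n r ` ?S = ?S" using snd_delete_strands[OF rc, of ?S] by (simp only: snd_conv)
  then have "fst (delete_strands n (r \<cdot> \<eta> y) ?S) = r \<cdot> p"
    unfolding delete_strands_mult[OF rc s(2)] dr p_def by (simp only: fst_conv)
  moreover have "fst (delete_strands n (\<eta> y \<cdot> (s 1 \<cdot> s 1)) ?S) = p \<cdot> (if 1 \<in> perm n (\<eta> y) ` ?S \<and>
      2 \<in> perm n (\<eta> y) ` ?S then s 1 \<cdot> s 1 else \<one>\<^bsub>artin_A n\<^esub>)"
    unfolding p_def delete_strands_mult[OF s(2) q] delete_strands_s1_square ..
  ultimately have *: "r \<cdot> p = p \<cdot> (if 1 \<in> perm n (\<eta> y) ` ?S \<and>
      2 \<in> perm n (\<eta> y) ` ?S then s 1 \<cdot> s 1 else \<one>\<^bsub>artin_A n\<^esub>)"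
    by (simp only: yq)
  \<comment> \<open>Nontriviality of \<open>r\<close> forces the two strands of
    \<open>\<sigma>\<^sub>1\<^sup>2\<close> to survive the deletion.\<close>
  have "r \<noteq> \<one>\<^bsub>artin_A n\<^esub>"
  proof
    assume "r = \<one>\<^bsub>artin_A n\<^esub>"
    then have "\<eta> y \<cdot> (s 1 \<cdot> s 1) = \<eta> y" unfolding yq using s(2) by simp
    then show False using s1_square_neq_one A.l_cancel_one[OF s(2) q] by blast
  qed
  then have "1 \<in> perm n (\<eta> y) ` ?S \<and> 2 \<in> perm n (\<eta> y) ` ?S"
    using A.mult_if_one_cases[OF *] pc rc by blast
  with * have pq: "p \<cdot> (s 1 \<cdot> s 1) = r \<cdot> p" by (simp only: simp_thms if_True)
  define g where "g = inv_A p \<cdot> \<eta> y"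
  have g: "g \<in> carA" "\<eta> y = p \<cdot> g" using pc s(2) by (simp_all add: g_def A.inv_r_cancel)
  have "g \<cdot> (s 1 \<cdot> s 1) = s 1 \<cdot> s 1 \<cdot> g"
    unfolding g_def by (rule A.commute_quotient[OF pq yq pc q rc s(2)])
  then have "g \<cdot> s 1 = s 1 \<cdot> g" by (rule commute_s1_square[OF g(1)])
  then have "A.inner g (s 1) = s 1" by (rule A.inner_eqI[OF _ g(1) s(1) s(1)])
  then have "A.inner (\<eta> y) (s 1) = A.inner p (s 1)"
    unfolding g(2) A.inner_mult[OF pc g(1) s(1)] by (simp only:)
  moreover have "s 1 \<in> A.parabolic 1 b" by (rule generate.incl) (use b in auto)
  ultimately show ?thesis
    unfolding A.inner_def using p
    by (simp only: subgroup.m_closed[OF sub] subgroup.m_inv_closed[OF sub])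
qed

lemma parabolic_B_sub: "1 \<le> a \<Longrightarrow> b \<le> n \<Longrightarrow> parabolic_B a b \<subseteq> carB"
  using parabolic_B_closed by blast

text \<open>Generators with index at least 2 are images of generators of type B, so their conjugates
  are images as well. Only \<open>\<sigma>\<^sub>1\<close>, which occurs when \<open>a = 1\<close>,
  requires \<open>inner_eta_s1\<close>.\<close>

lemma eta_normalizer:
  assumes ab: "1 \<le> a" "a \<le> b" "b \<le> n" and y: "y \<in> normalizer (artin_B n) (parabolic_B a b)"
  shows "\<eta> y \<in> normalizer (artin_A n) (A.parabolic a b)"
proof -
  note P = parabolic_B_sub[OF ab(1,3)]
  have yc: "y \<in> carB" and yP: "B.inner y ` parabolic_B a b = parabolic_B a b"
    using y B.mem_normalizer_iff[OF P] by auto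
  have yP': "B.inner (inv_B y) ` parabolic_B a b = parabolic_B a b"
    using B.inner_image_inv[OF yc P] yP by simp
  have key: "A.inner (\<eta> w) u \<in> A.parabolic a b"
    if w: "w \<in> carB" "B.inner w ` parabolic_B a b = parabolic_B a b" and u: "u \<in> s ` {a..b}" for w u
  proof -
    obtain i where i: "i \<in> {a..b}" "u = s i" using u by auto
    have ti: "t i \<in> carB" "t i \<in> parabolic_B a b" using i ab by (auto intro: generate.incl)
    then have wt: "B.inner w (t i) \<in> parabolic_B a b" using w by blast
    show ?thesis
    proof (cases "i = 1")
      case True
      then have "a = 1" using i ab by simp
      then show ?thesis using inner_eta_s1[of b w] w wt ab i True by simp
    next
      case False
      then have "A.inner (\<eta> w) u = \<eta> (B.inner w (t i))"
        using eta_tau[of i] i ab eta.hom_inner[OF w(1) ti(1)] by simp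
      then show ?thesis using eta_mem_parabolic_iff[OF ab, of "B.inner w (t i)"] wt w ti by simp
    qed
  qed
  show ?thesis
  proof (rule A.mem_normalizer_generateI)
    show "s ` {a..b} \<subseteq> carA" using ab by auto
    show "A.inner (inv_A (\<eta> y)) u \<in> A.parabolic a b" if "u \<in> s ` {a..b}" for u
      using key[OF _ yP' that] yc by simp
  qed (use yc key[OF yc yP] in auto)
qed

text \<open>Conjugates of generators are sent by \<eta> into the parabolic subgroup of type A, and
  \<open>eta_mem_parabolic_iff\<close> pulls them back.\<close>

lemma normalizer_eta:
  assumes ab: "1 \<le> a" "a \<le> b" "b \<le> n" and y: "y \<in> carB" "\<eta> y \<in> normalizer (artin_A n) (A.parabolic a b)"
  shows "y \<in> normalizer (artin_B n) (parabolic_B a b)"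
proof -
  have P: "A.parabolic a b \<subseteq> carA" using parabolic_closed ab by blast
  have yP: "A.inner (\<eta> y) ` A.parabolic a b = A.parabolic a b"
    using y A.mem_normalizer_iff[OF P] by auto
  have yP': "A.inner (inv_A (\<eta> y)) ` A.parabolic a b = A.parabolic a b"
    using A.inner_image_inv[OF _ P, of "\<eta> y"] yP y by simp
  have key: "B.inner w u \<in> parabolic_B a b"
    if w: "w \<in> carB" "A.inner (\<eta> w) ` A.parabolic a b = A.parabolic a b" and u: "u \<in> t ` {a..b}" for w u
  proof -
    have uP: "u \<in> parabolic_B a b" "u \<in> carB" using u ab by (auto intro: generate.incl)
    then have "\<eta> u \<in> A.parabolic a b" using eta_mem_parabolic_iff[OF ab] by simp
    then have "A.inner (\<eta> w) (\<eta> u) \<in> A.parabolic a b" using w by blast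
    then have "\<eta> (B.inner w u) \<in> A.parabolic a b" using eta.hom_inner w uP by simp
    then show ?thesis using eta_mem_parabolic_iff[OF ab] w uP by simp
  qed
  show ?thesis
  proof (rule B.mem_normalizer_generateI)
    show "t ` {a..b} \<subseteq> carB" using ab by auto
    show "B.inner (inv_B y) u \<in> parabolic_B a b" if "u \<in> t ` {a..b}" for u
      using key[OF _ _ that, of "inv_B y"] yP' y by simp
  qed (use y(1) key[OF y(1) yP] in auto)
qed

end

section \<open>Words of bounded length\<close>

text \<open>The ball about the unit in the word metric. In contrast to a minimal length, membership
  passes directly to products and homomorphic images.\<close>

definition word_ball :: "('g, 'm) monoid_scheme \<Rightarrow> 'g set \<Rightarrow> nat \<Rightarrow> 'g set"
  where "word_ball G S k =
    {foldr (monoid.mult G) ws \<one>\<^bsub>G\<^esub> |ws. set ws \<subseteq> S \<union> m_inv G ` S \<and> length ws \<le> k}"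

context group
begin

lemma foldr_mult_closed: "set ws \<subseteq> carrier G \<Longrightarrow> foldr (\<otimes>) ws \<one> \<in> carrier G"
  by (induction ws) auto

lemma foldr_mult_append:
  "set us \<subseteq> carrier G \<Longrightarrow> set ws \<subseteq> carrier G \<Longrightarrow>
    foldr (\<otimes>) (us @ ws) \<one> = foldr (\<otimes>) us \<one> \<otimes> foldr (\<otimes>) ws \<one>"
  by (induction us) (simp_all add: foldr_mult_closed m_assoc)

lemma letters_closed: "S \<subseteq> carrier G \<Longrightarrow> S \<union> m_inv G ` S \<subseteq> carrier G"
  by auto

lemma word_ball_mult:
  assumes S: "S \<subseteq> carrier G" and "g \<in> word_ball G S k" "h \<in> word_ball G S l"
  shows "g \<otimes> h \<in> word_ball G S (k + l)"
proof -
  obtain us where us: "set us \<subseteq> S \<union> m_inv G ` S" "length us \<le> k" "g = foldr (\<otimes>) us \<one>"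
    using assms(2) unfolding word_ball_def by blast
  obtain ws where ws: "set ws \<subseteq> S \<union> m_inv G ` S" "length ws \<le> l" "h = foldr (\<otimes>) ws \<one>"
    using assms(3) unfolding word_ball_def by blast
  have "g \<otimes> h = foldr (\<otimes>) (us @ ws) \<one>"
    unfolding us(3) ws(3)
    by (rule foldr_mult_append[symmetric]; rule order_trans[OF _ letters_closed[OF S]]) fact+
  then show ?thesis unfolding word_ball_def using us(1,2) ws(1,2)
    by (intro CollectI exI[of _ "us @ ws"]) simp
qed

lemma word_ball_mono: "k \<le> l \<Longrightarrow> word_ball G S k \<subseteq> word_ball G S l"
  unfolding word_ball_def using order_trans by blast

lemma one_word_ball: "\<one> \<in> word_ball G S k"
  unfolding word_ball_def by (intro CollectI exI[of _ "[]"]) simp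

lemma letter_word_ball:
  assumes "S \<subseteq> carrier G" "x \<in> S \<union> m_inv G ` S" shows "x \<in> word_ball G S 1"
proof -
  have "x \<in> carrier G" using assms letters_closed by blast
  then show ?thesis unfolding word_ball_def using assms by (intro CollectI exI[of _ "[x]"]) simp
qed

lemma generate_word_ball:
  assumes "S \<subseteq> carrier G" "g \<in> generate G S" shows "\<exists>k. g \<in> word_ball G S k"
  using assms(2)
proof (induction rule: generate.induct)
  case one
  show ?case using one_word_ball ..
next
  case (incl g)
  then have "g \<in> word_ball G S 1" by (intro letter_word_ball[OF assms(1)]) blast
  then show ?case ..
next
  case (inv g)
  then have "inv g \<in> word_ball G S 1" by (intro letter_word_ball[OF assms(1)]) blast
  then show ?case ..
next
  case (eng g h)
  then obtain k l where "g \<in> word_ball G S k" "h \<in> word_ball G S l" by blast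
  then have "g \<otimes> h \<in> word_ball G S (k + l)" by (rule word_ball_mult[OF assms(1)])
  then show ?case ..
qed

lemma word_metric_le:
  assumes "inv g \<otimes> h \<in> word_ball G S k" shows "word_metric G S g h \<le> k"
proof -
  obtain ws where "set ws \<subseteq> S \<union> m_inv G ` S" "length ws \<le> k" "foldr (\<otimes>) ws \<one> = inv g \<otimes> h"
    using assms unfolding word_ball_def by force
  then have "word_metric G S g h \<le> length ws"
    unfolding word_metric_def by (intro Least_le) blast
  then show ?thesis using \<open>length ws \<le> k\<close> by simp
qed

text \<open>Generation guarantees that some word exists, so that the \<open>LEAST\<close> is
  attained.\<close>

lemma word_ball_word_metric:
  assumes "S \<subseteq> carrier G" "inv g \<otimes> h \<in> generate G S"
  shows "inv g \<otimes> h \<in> word_ball G S (word_metric G S g h)"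
proof -
  let ?P = "\<lambda>k. \<exists>ws. set ws \<subseteq> S \<union> m_inv G ` S \<and> length ws = k \<and> foldr (\<otimes>) ws \<one> = inv g \<otimes> h"
  obtain k where "inv g \<otimes> h \<in> word_ball G S k" using generate_word_ball[OF assms] ..
  then have "\<exists>k. ?P k" unfolding word_ball_def mem_Collect_eq by metis
  then have "?P (word_metric G S g h)" unfolding word_metric_def by (rule LeastI_ex)
  then obtain ws where "set ws \<subseteq> S \<union> m_inv G ` S" "length ws = word_metric G S g h"
    "foldr (\<otimes>) ws \<one> = inv g \<otimes> h"
    by blast
  then show ?thesis unfolding word_ball_def by (intro CollectI exI[of _ ws]) simp
qed

end

section \<open>Conjugates of standard parabolic subgroups\<close>

context type_A_family
begin

lemma inner_rep_parabolic:
  assumes "1 \<le> m" "m \<le> a" "b + 2 \<le> j" "j \<le> n + 1"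
  shows "inner (rep m j) ` parabolic a b = parabolic (Suc a) (Suc b)"
proof -
  have "inner (rep m j) (s i) = s (Suc i)" if "i \<in> {a..b}" for i
    using that assms rep_shift[of m i j] by (intro inner_eqI) auto
  then have "inner (rep m j) ` s ` {a..b} = s ` Suc ` {a..b}"
    unfolding image_image by (intro image_cong) auto
  then show ?thesis using assms by (subst inner_image_generate) (auto simp: image_Suc_atLeastAtMost)
qed

lemma inner_rep_parabolic_commute:
  assumes "1 \<le> m" "Suc j \<le> a" "b \<le> n" "a \<le> b"
  shows "inner (rep m j) ` parabolic a b = parabolic a b"
proof -
  have "inner (rep m j) (s i) = s i" if "i \<in> {a..b}" for i
    using that assms gen_rep_commute[of m j i] by (intro inner_eqI) auto
  then have "inner (rep m j) ` s ` {a..b} = s ` {a..b}"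
    unfolding image_image by (intro image_cong) auto
  then show ?thesis using assms by (subst inner_image_generate) auto
qed

lemma inner_image_parabolic_self:
  assumes "1 \<le> a" "b \<le> n" "g \<in> parabolic a b" shows "inner g ` parabolic a b = parabolic a b"
proof -
  have sub: "subgroup (parabolic a b) G" using assms by (intro generate_is_subgroup) auto
  show ?thesis
    using subset_normalizer[OF sub] mem_normalizer_iff[OF subgroup.subset[OF sub]] assms(3) by blast
qed

lemma rep_split: "m \<le> a \<Longrightarrow> a \<le> j \<Longrightarrow> 1 \<le> m \<Longrightarrow> j \<le> n + 1 \<Longrightarrow> rep m j = rep m a \<otimes> rep a j"
proof (induction j)
  case (Suc j)
  show ?case
  proof (cases "a = Suc j")
    case False
    then have "rep m j = rep m a \<otimes> rep a j" "a \<le> j" using Suc by auto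
    then show ?thesis using Suc.prems by (simp add: m_assoc)
  qed (use Suc.prems in simp)
qed simp

end

section \<open>The set NP in terms of intervals\<close>

lemma proper_irreducible_index_iff:
  "proper_irreducible_index n I \<longleftrightarrow>
    (\<exists>a b. 1 \<le> a \<and> a \<le> b \<and> b \<le> n \<and> (a \<noteq> 1 \<or> b \<noteq> n) \<and> I = {a..b})"
proof
  assume "proper_irreducible_index n I"
  then obtain a b where "I \<noteq> {}" "I \<subset> {1..n}" "I = {a..b}"
    unfolding proper_irreducible_index_def by blast
  then show "\<exists>a b. 1 \<le> a \<and> a \<le> b \<and> b \<le> n \<and> (a \<noteq> 1 \<or> b \<noteq> n) \<and> I = {a..b}"
    by (intro exI[of _ a] exI[of _ b]) auto
next
  assume "\<exists>a b. 1 \<le> a \<and> a \<le> b \<and> b \<le> n \<and> (a \<noteq> 1 \<or> b \<noteq> n) \<and> I = {a..b}"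
  then obtain a b where ab: "1 \<le> a" "a \<le> b" "b \<le> n" "a \<noteq> 1 \<or> b \<noteq> n" "I = {a..b}" by blast
  then have "{a..b} \<noteq> {1..n}" by (auto simp: Icc_eq_Icc)
  then show "proper_irreducible_index n I"
    unfolding proper_irreducible_index_def using ab by auto
qed

lemma mem_NP_iff:
  "x \<in> NP G s n \<longleftrightarrow> (\<exists>a b. 1 \<le> a \<and> a \<le> b \<and> b \<le> n \<and> (a \<noteq> 1 \<or> b \<noteq> n) \<and>
    x \<in> normalizer G (generate G (s ` {a..b})))"
  unfolding NP_def by (auto simp: proper_irreducible_index_iff)

lemma (in artin_family) NP_inv:
  assumes "x \<in> NP G s n" shows "inv x \<in> NP G s n"
proof -
  obtain a b where ab: "1 \<le> a" "a \<le> b" "b \<le> n" "a \<noteq> 1 \<or> b \<noteq> n"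
    "x \<in> normalizer G (generate G (s ` {a..b}))"
    using assms unfolding mem_NP_iff by blast
  have "generate G (s ` {a..b}) \<subseteq> carrier G" using ab by (intro generate_incl) auto
  from subgroup.m_inv_closed[OF normalizer_imp_subgroup[OF this] ab(5)] ab
  show ?thesis unfolding mem_NP_iff by blast
qed

lemma (in artin_family) NP_letters: "NP G s n \<union> m_inv G ` NP G s n = NP G s n"
  using NP_inv by blast

context eta_hom
begin

abbreviation "NP_A \<equiv> NP (artin_A n) s n"
abbreviation "NP_B \<equiv> NP (artin_B n) t n"
abbreviation "ball_A \<equiv> word_ball (artin_A n) NP_A"
abbreviation "ball_B \<equiv> word_ball (artin_B n) NP_B"

lemma eta_NP: "y \<in> NP_B \<Longrightarrow> \<eta> y \<in> NP_A"
  unfolding mem_NP_iff using eta_normalizer by blast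

section \<open>The image of \<eta> and its cosets\<close>

lemma mem_eta_image:
  assumes "g \<in> carA" "perm n g 1 = 1" shows "\<exists>h\<in>carB. g = \<eta> h"
proof -
  have "g \<in> A.square_parabolic 1 n"
    using parabolic_fixing[of 1 n g] assms n_ge_2 carA_parabolic by simp
  then have "g \<in> \<eta> ` carB"
    using eta_image_parabolic_1[of n] n_ge_2 unfolding carB_generate by simp
  then show ?thesis by blast
qed

lemma cosets:
  assumes "g \<in> carA" shows "\<exists>h\<in>carB. \<exists>j\<in>{1..n + 1}. g = \<eta> h \<cdot> A.rep 1 j"
proof -
  have "g \<in> A.parabolic 1 n" using assms carA_parabolic by simp
  then obtain h j where h: "h \<in> A.square_parabolic 1 n" "j \<in> {1..n + 1}" "g = h \<cdot> A.rep 1 j"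
    using A.parabolic_cosets[of 1 n g] n_ge_2 by auto
  have "h \<in> \<eta> ` carB"
    using h(1) eta_image_parabolic_1[of n] n_ge_2 unfolding carB_generate by simp
  then show ?thesis using h by blast
qed

lemma perm_rep_Suc: "1 \<le> a \<Longrightarrow> Suc a \<le> j \<Longrightarrow> j \<le> n + 1 \<Longrightarrow> perm n (A.rep a j) (Suc a) = a"
proof (induction j)
  case (Suc j)
  then have "A.rep a j \<in> carA" "s j \<in> carA" by auto
  then show ?case using Suc by (cases "j = a") (auto simp: perm_simps adj_swap_def)
qed simp

text \<open>A round curve enclosing the positions \<open>a..a + k + 1\<close> is slid to the left end of the row of
  punctures, by a braid which moves its leftmost puncture to the first position.\<close>

lemma slide_parabolic:
  assumes "1 \<le> a" "a + k \<le> n"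
  shows "\<exists>v\<in>carA. perm n v a = 1 \<and> A.inner v ` A.parabolic 1 (Suc k) = A.parabolic a (a + k)"
  using assms
proof (induction a rule: nat_induct_at_least)
  case base
  have "perm n \<one>\<^bsub>artin_A n\<^esub> 1 = 1" by (simp only: perm_simps)
  moreover have "A.inner \<one>\<^bsub>artin_A n\<^esub> ` A.parabolic 1 (Suc k) = A.parabolic 1 (1 + k)"
    using A.inner_image_parabolic_self[of 1 "Suc k", OF _ _ generate.one] base by simp
  ultimately show ?case using A.one_closed by blast
next
  case (Suc a)
  then obtain v where v: "v \<in> carA" "perm n v a = 1"
    "A.inner v ` A.parabolic 1 (Suc k) = A.parabolic a (a + k)"
    by auto
  \<comment> \<open>The braid \<open>\<sigma>\<^sub>a \<dots>
    \<sigma>\<^sub>a\<^sub>+\<^sub>k\<^sub>+\<^sub>1\<close> shifts the generators with index in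
    \<open>a..a + k\<close> by one and carries the position \<open>a + 1\<close> to
    \<open>a\<close>, where \<open>v\<close> takes over.\<close>
  let ?r = "A.rep a (a + k + 2)"
  have r: "?r \<in> carA" using Suc by simp
  have P: "A.parabolic 1 (Suc k) \<subseteq> carA" using Suc by (intro A.generate_incl) auto
  have "perm n (?r \<cdot> v) (Suc a) = 1"
    unfolding perm_simps(2)[OF r v(1)] using perm_rep_Suc[of a "a + k + 2"] Suc v(2) by simp
  moreover have "A.inner (?r \<cdot> v) ` A.parabolic 1 (Suc k) = A.parabolic (Suc a) (Suc a + k)"
    unfolding A.inner_image_mult[OF r v(1) P] v(3)
    using A.inner_rep_parabolic[of a a "a + k" "a + k + 2"] Suc by simp
  ultimately show ?case using r v(1) by (intro bexI[of _ "?r \<cdot> v"]) auto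
qed

text \<open>By \<open>cosets\<close> it suffices to conjugate by a representative
  \<open>rep 1 j\<close>. It commutes with the parabolic subgroup if \<open>j < a\<close> and shifts
  it by one if \<open>j \<ge> b + 2\<close>; in between, the subgroup is first slid to the left
  end.\<close>

lemma conjugate_parabolic:
  assumes ab: "1 \<le> a" "a \<le> b" "b \<le> n" "a \<noteq> 1 \<or> b \<noteq> n" and g: "g \<in> carA"
  shows "\<exists>h\<in>carB. \<exists>a' b'. 1 \<le> a' \<and> a' \<le> b' \<and> b' \<le> n \<and> (a' \<noteq> 1 \<or> b' \<noteq> n) \<and>
    A.inner g ` A.parabolic a b = A.inner (\<eta> h) ` A.parabolic a' b'"
proof -
  have P: "A.parabolic a b \<subseteq> carA" if "1 \<le> a" "b \<le> n" for a b
    using that by (intro A.generate_incl) auto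
  have key: "\<exists>h\<in>carB. \<exists>a' b'. 1 \<le> a' \<and> a' \<le> b' \<and> b' \<le> n \<and> (a' \<noteq> 1 \<or> b' \<noteq> n) \<and>
    A.inner (A.rep 1 j) ` A.parabolic a b = A.inner (\<eta> h) ` A.parabolic a' b'"
    if j: "j \<in> {1..n + 1}" for j
  proof -
    have one: "A.inner (\<eta> \<one>\<^bsub>artin_B n\<^esub>) ` A.parabolic a b = A.parabolic a b" if "1 \<le> a" "b \<le> n" for a b
      using A.inner_image_parabolic_self[OF that generate.one] by simp
    consider "j < a" | "b + 2 \<le> j" | "a \<le> j" "j \<le> b + 1" by linarith
    then show ?thesis
    proof cases
      case 1
      then have "A.inner (A.rep 1 j) ` A.parabolic a b = A.inner (\<eta> \<one>\<^bsub>artin_B n\<^esub>) ` A.parabolic a b"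
        using A.inner_rep_parabolic_commute[of 1 j a b] ab one[OF ab(1,3)] by simp
      then show ?thesis
        using ab by - (rule bexI[OF _ B.one_closed], rule exI[of _ a], rule exI[of _ b], intro conjI; assumption)
    next
      case 2
      then have "A.inner (A.rep 1 j) ` A.parabolic a b = A.inner (\<eta> \<one>\<^bsub>artin_B n\<^esub>) ` A.parabolic (Suc a) (Suc b)"
        using A.inner_rep_parabolic[of 1 a b j] ab j one[of "Suc a" "Suc b"] by simp
      moreover have "1 \<le> Suc a" "Suc a \<le> Suc b" "Suc b \<le> n" "Suc a \<noteq> 1 \<or> Suc b \<noteq> n"
        using 2 ab j by auto
      ultimately show ?thesis
        by - (rule bexI[OF _ B.one_closed], rule exI[of _ "Suc a"], rule exI[of _ "Suc b"], intro conjI; assumption)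
    next
      case 3
      have r: "A.rep 1 a \<in> carA" "A.rep a j \<in> carA" using ab j 3 by auto
      have split: "A.rep 1 j = A.rep 1 a \<cdot> A.rep a j" using A.rep_split[of 1 a j] ab j 3 by simp
      \<comment> \<open>The right factor of the representative lies in the parabolic subgroup and so
        does not change it.\<close>
      have "A.rep a j \<in> A.parabolic a b" using 3 by (intro A.rep_in_parabolic) auto
      then have eq: "A.inner (A.rep 1 j) ` A.parabolic a b = A.inner (A.rep 1 a) ` A.parabolic a b"
        unfolding split A.inner_image_mult[OF r P[OF ab(1,3)]]
        using A.inner_image_parabolic_self[OF ab(1,3)] by simp
      obtain k where k: "b = a + k" using ab(2) le_Suc_ex by blast
      obtain v where v: "v \<in> carA" "perm n v a = 1"
        "A.inner v ` A.parabolic 1 (Suc k) = A.parabolic a b"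
        using slide_parabolic[OF ab(1), of k] ab(3) unfolding k by blast
      \<comment> \<open>The representative carries strand 1 to the position \<open>a\<close> and
        \<open>v\<close> carries it back, so the product lies in the image of \<eta>.\<close>
      have "perm n (A.rep 1 a \<cdot> v) 1 = 1"
        unfolding perm_simps(2)[OF r(1) v(1)] using perm_rep[of 1 a] ab v(2) by simp
      then obtain h where h: "h \<in> carB" "A.rep 1 a \<cdot> v = \<eta> h"
        using mem_eta_image[OF A.m_closed[OF r(1) v(1)]] by blast
      have Sk: "Suc k \<le> n" using k ab by simp
      have "A.inner (A.rep 1 j) ` A.parabolic a b = A.inner (\<eta> h) ` A.parabolic 1 (Suc k)"
        unfolding eq h(2)[symmetric] A.inner_image_mult[OF r(1) v(1) P[OF order_refl Sk]] v(3) ..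
      moreover have "(1::nat) \<noteq> 1 \<or> Suc k \<noteq> n" using k ab by auto
      moreover have "(1::nat) \<le> 1" "1 \<le> Suc k" by simp_all
      ultimately show ?thesis
        using Sk by - (rule bexI[OF _ h(1)], rule exI[of _ 1], rule exI[of _ "Suc k"], intro conjI; assumption)
    qed
  qed
  obtain h j where h: "h \<in> carB" "j \<in> {1..n + 1}" "g = \<eta> h \<cdot> A.rep 1 j"
    using cosets[OF g] by blast
  obtain h' a' b' where h': "h' \<in> carB" "1 \<le> a'" "a' \<le> b'" "b' \<le> n" "a' \<noteq> 1 \<or> b' \<noteq> n"
    "A.inner (A.rep 1 j) ` A.parabolic a b = A.inner (\<eta> h') ` A.parabolic a' b'"
    using key[OF h(2)] by (elim bexE exE conjE) (rule that)
  have c: "\<eta> h \<in> carA" "\<eta> h' \<in> carA" "A.rep 1 j \<in> carA"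
    using h(1,2) h'(1) by simp_all
  have "A.inner g ` A.parabolic a b = A.inner (\<eta> h) ` (A.inner (\<eta> h') ` A.parabolic a' b')"
    unfolding h(3) A.inner_image_mult[OF c(1,3) P[OF ab(1,3)]] h'(6) ..
  also have "\<dots> = A.inner (\<eta> (h \<star> h')) ` A.parabolic a' b'"
    unfolding eta.hom_mult[OF h(1) h'(1)] A.inner_image_mult[OF c(1,2) P[OF h'(2,4)]] ..
  finally show ?thesis
    using h'(2-5)
    by - (rule bexI[OF _ B.m_closed[OF h(1) h'(1)]], rule exI[of _ a'], rule exI[of _ b'], intro conjI; assumption)
qed

subsection \<open>The quasi-isometry\<close>

lemma NP_B_subset: "NP_B \<subseteq> carB" and NP_A_subset: "NP_A \<subseteq> carA"
  by (rule NP_subset)+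

lemma ball_B_exists: "x \<in> carB \<Longrightarrow> \<exists>k. x \<in> ball_B k"
  using B.generate_word_ball[OF NP_B_subset] NP_generates(2)[OF n_ge_2] by simp

lemma ball_A_exists: "x \<in> carA \<Longrightarrow> \<exists>k. x \<in> ball_A k"
  using A.generate_word_ball[OF NP_A_subset] NP_generates(1)[OF n_ge_2] by simp

text \<open>As \<open>z\<close> normalizes \<open>P\<close>, the element
  \<open>r z r\<inverse>\<close> normalizes \<open>r P r\<inverse> = h Q h\<inverse>\<close>;
  conjugation by \<open>h\<inverse>\<close> brings it to \<open>Q\<close>.\<close>

lemma normalizing_conjugate:
  assumes c: "h \<in> carA" "r \<in> carA" "z \<in> carA" "P \<subseteq> carA" "Q \<subseteq> carA"
    and P: "A.inner z ` P = P" and Q: "A.inner r ` P = A.inner h ` Q"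
  shows "A.inner (inv_A h \<cdot> (A.inner r z \<cdot> h)) ` Q = Q"
proof -
  have rz: "A.inner r z \<cdot> r = r \<cdot> z" using c by (simp add: A.inner_def A.m_assoc)
  have cl: "A.inner r z \<in> carA" "inv_A h \<in> carA" "A.inner r z \<cdot> h \<in> carA" using c by auto
  have "A.inner (A.inner r z) ` (A.inner h ` Q) = A.inner (A.inner r z \<cdot> r) ` P"
    unfolding Q[symmetric] A.inner_image_mult[OF cl(1) c(2,4)] ..
  also have "\<dots> = A.inner h ` Q" unfolding rz A.inner_image_mult[OF c(2,3,4)] P Q ..
  finally have "A.inner (A.inner r z \<cdot> h) ` Q = A.inner h ` Q"
    unfolding A.inner_image_mult[OF cl(1) c(1,5)] .
  then show ?thesis
    unfolding A.inner_image_mult[OF cl(2,3) c(5)] using A.inner_image_inv[OF c(1,5)] by simp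
qed

text \<open>All \<open>y\<close> considered here differ from one of them by an element whose image normalizes the
  conjugate of a standard parabolic subgroup by \<open>\<eta> h\<close>, and such an element is the conjugate by \<open>h\<close>
  of one in \<open>NP_B\<close>.\<close>

lemma normalizer_coset_bounded:
  assumes ab: "1 \<le> a" "a \<le> b" "b \<le> n" "a \<noteq> 1 \<or> b \<noteq> n" and r: "r \<in> carA" "r' \<in> carA"
  shows "\<exists>K. \<forall>x\<in>normalizer (artin_A n) (A.parabolic a b). \<forall>y\<in>carB.
    r \<cdot> x = \<eta> y \<cdot> r' \<longrightarrow> y \<in> ball_B K"
proof (cases "\<exists>x\<in>normalizer (artin_A n) (A.parabolic a b). \<exists>y\<in>carB. r \<cdot> x = \<eta> y \<cdot> r'")
  case False
  then show ?thesis by blast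
next
  case True
  let ?P = "A.parabolic a b"
  have P: "?P \<subseteq> carA" using ab by (intro A.generate_incl) auto
  have N: "subgroup (normalizer (artin_A n) ?P) (artin_A n)" by (rule A.normalizer_imp_subgroup[OF P])
  obtain x0 y0 where x0: "x0 \<in> normalizer (artin_A n) ?P" "y0 \<in> carB" "r \<cdot> x0 = \<eta> y0 \<cdot> r'"
    using True by blast
  obtain h a' b' where h: "h \<in> carB" "1 \<le> a'" "a' \<le> b'" "b' \<le> n" "a' \<noteq> 1 \<or> b' \<noteq> n"
    "A.inner r ` ?P = A.inner (\<eta> h) ` A.parabolic a' b'"
    using conjugate_parabolic[OF ab r(1)] by (elim bexE exE conjE) (rule that)
  have Q: "A.parabolic a' b' \<subseteq> carA" using h by (intro A.generate_incl) auto
  obtain k1 k2 k3 where k: "h \<in> ball_B k1" "inv_B h \<in> ball_B k2" "y0 \<in> ball_B k3"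
    using ball_B_exists h(1) x0(2) B.inv_closed by meson
  \<comment> \<open>The bound comes from \<open>y = h \<star> w \<star> inv_B h \<star> y0\<close>
    with a single letter \<open>w\<close> from \<open>NP_B\<close>; the other three factors do not
    depend on \<open>x\<close> and \<open>y\<close>.\<close>
  have "y \<in> ball_B (k1 + 1 + k2 + k3)"
    if x: "x \<in> normalizer (artin_A n) ?P" and y: "y \<in> carB" "r \<cdot> x = \<eta> y \<cdot> r'" for x y
  proof -
    have xc: "x \<in> carA" "x0 \<in> carA" using x x0 subgroup.mem_carrier[OF N] by auto
    define z where "z = x \<cdot> inv_A x0"
    have z: "z \<in> normalizer (artin_A n) ?P" "z \<in> carA"
      using x x0(1) xc subgroup.m_closed[OF N] subgroup.m_inv_closed[OF N] by (auto simp: z_def)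
    have e: "\<eta> y \<in> carA" "\<eta> y0 \<in> carA" "\<eta> h \<in> carA" using y x0 h by auto
    have "r' = inv_A (\<eta> y0) \<cdot> (r \<cdot> x0)" unfolding x0(3) using e r by (simp add: A.inv_l_cancel)
    then have "r \<cdot> x = \<eta> y \<cdot> (inv_A (\<eta> y0) \<cdot> (r \<cdot> x0))" using y(2) by simp
    then have "r \<cdot> x \<cdot> inv_A x0 \<cdot> inv_A r = \<eta> y \<cdot> (inv_A (\<eta> y0) \<cdot> (r \<cdot> x0)) \<cdot> inv_A x0 \<cdot> inv_A r"
      by (simp only:)
    then have rz: "A.inner r z = \<eta> y \<cdot> inv_A (\<eta> y0)"
      using e r xc by (simp add: A.inner_def z_def A.m_assoc A.inv_r_cancel)
    define w where "w = inv_B h \<star> (y \<star> inv_B y0 \<star> h)"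
    have w: "w \<in> carB" using h y x0 by (simp add: w_def)
    have "\<eta> w = inv_A (\<eta> h) \<cdot> (A.inner r z \<cdot> \<eta> h)" unfolding rz w_def using h(1) y(1) x0(2) by simp
    then have "A.inner (\<eta> w) ` A.parabolic a' b' = A.parabolic a' b'"
      using normalizing_conjugate[OF e(3) r(1) z(2) P Q _ h(6)] z(1) A.mem_normalizer_iff[OF P] by simp
    then have "\<eta> w \<in> normalizer (artin_A n) (A.parabolic a' b')"
      using A.mem_normalizer_iff[OF Q] w by simp
    then have "w \<in> normalizer (artin_B n) (parabolic_B a' b')"
      using normalizer_eta[OF h(2-4) w] by blast
    then have "w \<in> NP_B" unfolding mem_NP_iff using h(2-5) by blast
    then have "w \<in> ball_B 1" using B.letter_word_ball[OF NP_B_subset] by blast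
    then have "h \<star> w \<star> inv_B h \<star> y0 \<in> ball_B (k1 + 1 + k2 + k3)"
      using B.word_ball_mult[OF NP_B_subset] k by blast
    moreover have "h \<star> w \<star> inv_B h \<star> y0 = y"
      using h(1) y(1) x0(2) by (simp add: w_def B.m_assoc B.inv_l_cancel B.inv_r_cancel)
    ultimately show ?thesis by simp
  qed
  then show ?thesis by blast
qed

text \<open>There are only finitely many pairs of representatives and intervals, so the bounds of
  \<open>normalizer_coset_bounded\<close> have a common maximum.\<close>

lemma NP_step_bounded:
  "\<exists>K. \<forall>r\<in>{1..n + 1}. \<forall>r'\<in>{1..n + 1}. \<forall>x\<in>NP_A. \<forall>y\<in>carB.
    A.rep 1 r \<cdot> x = \<eta> y \<cdot> A.rep 1 r' \<longrightarrow> y \<in> ball_B K"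
proof -
  let ?Z = "{1..n + 1} \<times> {1..n + 1} \<times> {1..n} \<times> {1..n}"
  define good where "good = (\<lambda>(r, r', a, b) K. 1 \<le> a \<and> a \<le> b \<and> b \<le> n \<and> (a \<noteq> 1 \<or> b \<noteq> n) \<longrightarrow>
    (\<forall>x\<in>normalizer (artin_A n) (A.parabolic a b). \<forall>y\<in>carB.
      A.rep 1 r \<cdot> x = \<eta> y \<cdot> A.rep 1 r' \<longrightarrow> y \<in> ball_B K))"
  have "\<forall>z\<in>?Z. \<exists>K. good z K"
  proof
    fix z assume "z \<in> ?Z"
    then obtain r r' a b where z: "z = (r, r', a, b)" "r \<in> {1..n + 1}" "r' \<in> {1..n + 1}" by auto
    then have "A.rep 1 r \<in> carA" "A.rep 1 r' \<in> carA" by auto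
    then show "\<exists>K. good z K" using normalizer_coset_bounded[of a b "A.rep 1 r" "A.rep 1 r'"]
      unfolding good_def z by (cases "1 \<le> a \<and> a \<le> b \<and> b \<le> n \<and> (a \<noteq> 1 \<or> b \<noteq> n)") auto
  qed
  from bchoice[OF this] obtain f where f: "\<forall>z\<in>?Z. good z (f z)" by blast
  obtain K where K: "\<forall>k\<in>f ` ?Z. k \<le> K" using finite_nat_set_iff_bounded_le[of "f ` ?Z"] by auto
  have "y \<in> ball_B K"
    if r: "r \<in> {1..n + 1}" "r' \<in> {1..n + 1}" and x: "x \<in> NP_A" and y: "y \<in> carB"
      "A.rep 1 r \<cdot> x = \<eta> y \<cdot> A.rep 1 r'" for r r' x y
  proof -
    obtain a b where ab: "1 \<le> a" "a \<le> b" "b \<le> n" "a \<noteq> 1 \<or> b \<noteq> n"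
      "x \<in> normalizer (artin_A n) (A.parabolic a b)"
      using x unfolding mem_NP_iff by blast
    then have z: "(r, r', a, b) \<in> ?Z" using r by auto
    then have "good (r, r', a, b) (f (r, r', a, b))" using f by blast
    then have "y \<in> ball_B (f (r, r', a, b))" unfolding good_def using ab y by blast
    moreover have "f (r, r', a, b) \<le> K" using K z by blast
    ultimately show ?thesis using B.word_ball_mono by blast
  qed
  then show ?thesis by blast
qed

text \<open>Reidemeister-Schreier rewriting: the representative is pushed through the word from left
  to right, and each letter leaves behind a factor in the image of \<eta> of B-length at most
  \<open>K\<close>.\<close>

lemma word_rewriting:
  assumes K: "\<forall>r\<in>{1..n + 1}. \<forall>r'\<in>{1..n + 1}. \<forall>x\<in>NP_A. \<forall>y\<in>carB.
    A.rep 1 r \<cdot> x = \<eta> y \<cdot> A.rep 1 r' \<longrightarrow> y \<in> ball_B K"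
    and ws: "set ws \<subseteq> NP_A" and r: "r \<in> {1..n + 1}"
  shows "\<exists>y\<in>carB. \<exists>j\<in>{1..n + 1}. y \<in> ball_B (K * length ws) \<and>
    A.rep 1 r \<cdot> foldr (\<otimes>\<^bsub>artin_A n\<^esub>) ws \<one>\<^bsub>artin_A n\<^esub> = \<eta> y \<cdot> A.rep 1 j"
  using ws r
proof (induction ws arbitrary: r)
  case Nil
  then have rc: "A.rep 1 r \<in> carA" by simp
  have "A.rep 1 r \<cdot> foldr (\<otimes>\<^bsub>artin_A n\<^esub>) [] \<one>\<^bsub>artin_A n\<^esub> = \<eta> \<one>\<^bsub>artin_B n\<^esub> \<cdot> A.rep 1 r"
    using rc by simp
  then show ?case using Nil B.one_word_ball B.one_closed by blast
next
  case (Cons x ws)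
  have x: "x \<in> NP_A" "x \<in> carA" and ws: "set ws \<subseteq> carA" using Cons.prems NP_A_subset by auto
  have rc: "A.rep 1 j \<in> carA" if "j \<in> {1..n + 1}" for j using that by simp
  have w: "foldr (\<otimes>\<^bsub>artin_A n\<^esub>) ws \<one>\<^bsub>artin_A n\<^esub> \<in> carA" using A.foldr_mult_closed[OF ws] .
  obtain y j where y: "y \<in> carB" "j \<in> {1..n + 1}" "A.rep 1 r \<cdot> x = \<eta> y \<cdot> A.rep 1 j"
    using cosets[OF A.m_closed[OF rc[OF Cons.prems(2)] x(2)]] by blast
  then have yK: "y \<in> ball_B K" using K x(1) Cons.prems(2) by blast
  obtain y' j' where y': "y' \<in> carB" "j' \<in> {1..n + 1}" "y' \<in> ball_B (K * length ws)"
    "A.rep 1 j \<cdot> foldr (\<otimes>\<^bsub>artin_A n\<^esub>) ws \<one>\<^bsub>artin_A n\<^esub> = \<eta> y' \<cdot> A.rep 1 j'"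
    using Cons.IH[OF _ y(2)] Cons.prems(1) by auto
  have e: "\<eta> y \<in> carA" "\<eta> y' \<in> carA" using y y' by auto
  have "A.rep 1 r \<cdot> foldr (\<otimes>\<^bsub>artin_A n\<^esub>) (x # ws) \<one>\<^bsub>artin_A n\<^esub> =
      A.rep 1 r \<cdot> x \<cdot> foldr (\<otimes>\<^bsub>artin_A n\<^esub>) ws \<one>\<^bsub>artin_A n\<^esub>"
    using rc[OF Cons.prems(2)] x(2) w by (simp add: A.m_assoc)
  also have "\<dots> = \<eta> y \<cdot> (A.rep 1 j \<cdot> foldr (\<otimes>\<^bsub>artin_A n\<^esub>) ws \<one>\<^bsub>artin_A n\<^esub>)"
    unfolding y(3) by (rule A.m_assoc[OF e(1) rc[OF y(2)] w])
  also have "\<dots> = \<eta> y \<cdot> \<eta> y' \<cdot> A.rep 1 j'"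
    unfolding y'(4) by (rule A.m_assoc[OF e rc[OF y'(2)], symmetric])
  also have "\<dots> = \<eta> (y \<star> y') \<cdot> A.rep 1 j'" unfolding eta.hom_mult[OF y(1) y'(1)] ..
  finally have "A.rep 1 r \<cdot> foldr (\<otimes>\<^bsub>artin_A n\<^esub>) (x # ws) \<one>\<^bsub>artin_A n\<^esub> = \<eta> (y \<star> y') \<cdot> A.rep 1 j'" .
  moreover have "y \<star> y' \<in> ball_B (K * length (x # ws))"
    using B.word_ball_mult[OF NP_B_subset yK y'(3)] by simp
  ultimately show ?case using y(1) y'(1,2) B.m_closed by blast
qed

lemma ball_eta: "y \<in> ball_B k \<Longrightarrow> \<eta> y \<in> ball_A k"
proof -
  assume "y \<in> ball_B k"
  then obtain ws where ws: "set ws \<subseteq> NP_B" "length ws \<le> k"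
    "y = foldr (\<otimes>\<^bsub>artin_B n\<^esub>) ws \<one>\<^bsub>artin_B n\<^esub>"
    unfolding word_ball_def B.NP_letters by blast
  have "\<eta> (foldr (\<otimes>\<^bsub>artin_B n\<^esub>) ws \<one>\<^bsub>artin_B n\<^esub>) =
      foldr (\<otimes>\<^bsub>artin_A n\<^esub>) (map \<eta> ws) \<one>\<^bsub>artin_A n\<^esub>"
    using ws(1)
  proof (induction ws)
    case (Cons x ws)
    then have "x \<in> carB" "set ws \<subseteq> carB" using NP_B_subset by auto
    then show ?case using Cons B.foldr_mult_closed by simp
  qed simp
  moreover have "set (map \<eta> ws) \<subseteq> NP_A" using ws(1) eta_NP by auto
  ultimately show ?thesis unfolding word_ball_def A.NP_letters using ws(2,3)
    by (intro CollectI exI[of _ "map \<eta> ws"]) simp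
qed

lemma ball_eta_converse: "\<exists>K. \<forall>k. \<forall>y\<in>carB. \<eta> y \<in> ball_A k \<longrightarrow> y \<in> ball_B (K * k)"
proof -
  obtain K where K: "\<forall>r\<in>{1..n + 1}. \<forall>r'\<in>{1..n + 1}. \<forall>x\<in>NP_A. \<forall>y\<in>carB.
    A.rep 1 r \<cdot> x = \<eta> y \<cdot> A.rep 1 r' \<longrightarrow> y \<in> ball_B K"
    using NP_step_bounded by blast
  have "y \<in> ball_B (K * k)" if y: "y \<in> carB" "\<eta> y \<in> ball_A k" for y k
  proof -
    obtain ws where ws: "set ws \<subseteq> NP_A" "length ws \<le> k"
      "\<eta> y = foldr (\<otimes>\<^bsub>artin_A n\<^esub>) ws \<one>\<^bsub>artin_A n\<^esub>"
      using y(2) unfolding word_ball_def A.NP_letters by blast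
    have one: "1 \<in> {1..n + 1}" by simp
    obtain z j where z: "z \<in> carB" "j \<in> {1..n + 1}" "z \<in> ball_B (K * length ws)"
      "A.rep 1 1 \<cdot> \<eta> y = \<eta> z \<cdot> A.rep 1 j"
      using word_rewriting[OF K ws(1) one] unfolding ws(3)[symmetric] by blast
    have c: "\<eta> y \<in> carA" "\<eta> z \<in> carA" "A.rep 1 j \<in> carA" using y z by auto
    have eq: "\<eta> y = \<eta> z \<cdot> A.rep 1 j" using z(4) c(1) by (simp only: A.rep_self A.l_one)
    \<comment> \<open>Rewriting starts at the trivial representative and must also end there, since
      \<open>\<eta> y\<close> fixes the first strand.\<close>
    have "perm n (\<eta> z \<cdot> A.rep 1 j) 1 = j"
      unfolding perm_simps(2)[OF c(2,3)] perm_eta[OF z(1)] using perm_rep[of 1 j] z(2) by simp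
    then have "j = 1" using perm_eta[OF y(1)] unfolding eq by simp
    then have "\<eta> y = \<eta> z" using eq c(2) by (simp only: A.rep_self A.r_one)
    then have "y = z" using eta_eq_iff y(1) z(1) by blast
    moreover have "K * length ws \<le> K * k" using ws(2) by simp
    ultimately show ?thesis using z(3) B.word_ball_mono by blast
  qed
  then show ?thesis by blast
qed

lemma rep_bounded: "\<exists>C. \<forall>j\<in>{1..n + 1}. A.rep 1 j \<in> ball_A C"
proof -
  have "\<forall>j\<in>{1..n + 1}. \<exists>k. A.rep 1 j \<in> ball_A k" using ball_A_exists by simp
  from bchoice[OF this] obtain f where f: "\<forall>j\<in>{1..n + 1}. A.rep 1 j \<in> ball_A (f j)" by blast
  obtain C where "\<forall>k\<in>f ` {1..n + 1}. k \<le> C" using finite_nat_set_iff_bounded_le[of "f ` {1..n + 1}"] by auto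
  then have "\<forall>j\<in>{1..n + 1}. A.rep 1 j \<in> ball_A C" using f A.word_ball_mono by blast
  then show ?thesis ..
qed

text \<open>The upper estimate comes from \<open>ball_eta\<close>, the lower one from
  \<open>ball_eta_converse\<close>, and coarse surjectivity from the finitely many coset
  representatives.\<close>

lemma quasi_isometry_eta:
  "quasi_isometry carB (\<lambda>g h. real (d_NP_B n g h)) carA (\<lambda>g h. real (d_NP_A n g h)) \<eta>"
proof -
  obtain K where K: "\<forall>k. \<forall>y\<in>carB. \<eta> y \<in> ball_A k \<longrightarrow> y \<in> ball_B (K * k)"
    using ball_eta_converse by blast
  obtain C where C: "\<forall>j\<in>{1..n + 1}. A.rep 1 j \<in> ball_A C" using rep_bounded by blast
  have upper: "d_NP_A n (\<eta> x) (\<eta> y) \<le> d_NP_B n x y"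
    and lower: "d_NP_B n x y \<le> K * d_NP_A n (\<eta> x) (\<eta> y)" if xy: "x \<in> carB" "y \<in> carB" for x y
  proof -
    let ?z = "inv_B x \<star> y"
    have z: "?z \<in> carB" and ez: "\<eta> ?z = inv_A (\<eta> x) \<cdot> \<eta> y" using xy by auto
    have "?z \<in> ball_B (d_NP_B n x y)"
      by (rule B.word_ball_word_metric[OF NP_B_subset]) (use z NP_generates(2)[OF n_ge_2] in simp)
    then have "\<eta> ?z \<in> ball_A (d_NP_B n x y)" by (rule ball_eta)
    then show "d_NP_A n (\<eta> x) (\<eta> y) \<le> d_NP_B n x y" unfolding ez by (rule A.word_metric_le)
    have "inv_A (\<eta> x) \<cdot> \<eta> y \<in> ball_A (d_NP_A n (\<eta> x) (\<eta> y))"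
      by (rule A.word_ball_word_metric[OF NP_A_subset]) (use xy NP_generates(1)[OF n_ge_2] in simp)
    then have "?z \<in> ball_B (K * d_NP_A n (\<eta> x) (\<eta> y))" using K z unfolding ez[symmetric] by blast
    then show "d_NP_B n x y \<le> K * d_NP_A n (\<eta> x) (\<eta> y)" by (rule B.word_metric_le)
  qed
  have dense: "\<exists>x\<in>carB. d_NP_A n (\<eta> x) g \<le> C" if g: "g \<in> carA" for g
  proof -
    obtain h j where h: "h \<in> carB" "j \<in> {1..n + 1}" "g = \<eta> h \<cdot> A.rep 1 j" using cosets[OF g] by blast
    have "inv_A (\<eta> h) \<cdot> g = A.rep 1 j" unfolding h(3) using h by (simp add: A.inv_l_cancel)
    then have "d_NP_A n (\<eta> h) g \<le> C" using C h(2) by (intro A.word_metric_le) simp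
    then show ?thesis using h(1) by blast
  qed
  show ?thesis
    unfolding quasi_isometry_def
  \<comment> \<open>Adding 1 makes the factor at least 1 even if \<open>K\<close> is 0;
    \<open>C\<close> bounds the distance of a braid from the image of \<eta>.\<close>
  proof (rule conjI[rotated], rule exI[of _ "real K + 1"], rule conjI, simp, rule exI[of _ "real C"],
      intro conjI ballI)
    fix x y assume xy: "x \<in> carB" "y \<in> carB"
    have "real (d_NP_B n x y) \<le> real K * real (d_NP_A n (\<eta> x) (\<eta> y))"
      using lower[OF xy] by (metis of_nat_le_iff of_nat_mult)
    also have "\<dots> \<le> (real K + 1) * real (d_NP_A n (\<eta> x) (\<eta> y))" by (simp add: mult_right_mono)
    finally have "real (d_NP_B n x y) / (real K + 1) \<le> real (d_NP_A n (\<eta> x) (\<eta> y))"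
      by (simp add: divide_le_eq mult.commute)
    then show "real (d_NP_B n x y) / (real K + 1) - real C \<le> real (d_NP_A n (\<eta> x) (\<eta> y))" by simp
    have "real (d_NP_A n (\<eta> x) (\<eta> y)) \<le> real (d_NP_B n x y)" using upper[OF xy] by simp
    also have "\<dots> \<le> (real K + 1) * real (d_NP_B n x y)" by (simp add: mult_le_cancel_right1)
    finally show "real (d_NP_A n (\<eta> x) (\<eta> y)) \<le> (real K + 1) * real (d_NP_B n x y) + real C" by simp
  next
    show "\<exists>x\<in>carB. real (d_NP_A n (\<eta> x) g) \<le> real C" if "g \<in> carA" for g
      using dense[OF that] by simp
  qed auto
qed

end

theorem proposition1:
  fixes n :: nat
    and \<eta> :: "(nat \<times> bool) list set \<Rightarrow> (nat \<times> bool) list set"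
  assumes "n \<ge> 3"
    and "\<eta> \<in> hom (artin_B n) (artin_A n)"
    and "\<eta> (tau n 1) = sigma n 1 [^]\<^bsub>artin_A n\<^esub> (2::nat)"
    and "\<And>i. i \<in> {2..n} \<Longrightarrow> \<eta> (tau n i) = sigma n i"
  shows "quasi_isometry
      (carrier (artin_B n)) (\<lambda>g h. real (d_NP_B n g h))
      (carrier (artin_A n)) (\<lambda>g h. real (d_NP_A n g h)) \<eta>"
proof -
  interpret eta_hom n \<eta> by unfold_locales (use assms in auto)
  show ?thesis by (rule quasi_isometry_eta)
qed

end
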